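(* Let $F > 2\theta$. For $\rho \in [0, 2^{-F})$, consider the one-dimensional vectorial Deffuant model with $F$ issues and confidence threshold $\theta$ started from the product measure in which the $\eta_0(x)$, $x \in \mathbb{Z}$, are i.i.d. with $P(\eta_0(x) = u) = 1/2 - (2^{F-1} - 1)\rho$ for $u \in \{u_-, u_+\}$ and $P(\eta_0(x) = u) = \rho$ for $u \notin \{u_-,u_+\}$, where $u_- = (0,\ldots,0)$ and $u_+ = (1,\ldots,1)$. Then there exists $\rho_0 > 0$ such that for all $\rho \in (0,\rho_0)$ the system coexists: there is a random configuration $\eta_\infty : \mathbb{Z} \to \{0,1\}^F$ such that for every $x$, almost surely $\eta_t(x) = \eta_\infty(x)$ for all sufficiently large $t$, and almost surely $\#\{\eta_\infty(x) : x \in \mathbb{Z}\} = 2^F$.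
   Context: $F \geq 1$ and $\theta \geq 1$ are integers. The opinion set is $\Gamma = \{0,1\}^F$ with Hamming distance $H(u,v) = \#\{i : u_i \neq v_i\}$. The vectorial Deffuant model on $\mathbb{Z}$ is the continuous-time Markov process $(\eta_t)_{t \geq 0}$, $\eta_t : \mathbb{Z} \to \Gamma$: independently at rate one, each vertex $x$ chooses one of its two nearest neighbors $y \in \{x-1,x+1\}$ uniformly at random; if $1 \leq H(\eta(x),\eta(y)) \leq \theta$, an issue $i$ is chosen uniformly at random among those with $\eta(x)_i \neq \eta(y)_i$ and the $i$-th coordinate of $\eta(x)$ is set equal to $\eta(y)_i$; otherwise nothing happens. *)

theory Defs
  imports "HOL-Probability.Probability"
begin

type_synonym opinion = "bool list"
type_synonym config = "int \<Rightarrow> bool list"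

definition opinions :: "nat \<Rightarrow> opinion set" where
  "opinions F = {u. length u = F}"

definition hamming :: "opinion \<Rightarrow> opinion \<Rightarrow> nat" where
  "hamming u v = card {i. i < length u \<and> u ! i \<noteq> v ! i}"

definition u_minus :: "nat \<Rightarrow> opinion" where
  "u_minus F = replicate F False"

definition u_plus :: "nat \<Rightarrow> opinion" where
  "u_plus F = replicate F True"

definition init_pmf :: "nat \<Rightarrow> real \<Rightarrow> opinion \<Rightarrow> real" where
  "init_pmf F \<rho> u =
     (if u \<notin> opinions F then 0
      else if u = u_minus F \<or> u = u_plus F then 1/2 - (2 ^ (F - 1) - 1) * \<rho>
      else \<rho>)"

definition depends_only_on :: "int set \<Rightarrow> (config \<Rightarrow> real) \<Rightarrow> bool" where
  "depends_only_on D f \<longleftrightarrow> (\<forall>\<eta> \<eta>'. (\<forall>z\<in>D. \<eta> z = \<eta>' z) \<longrightarrow> f \<eta> = f \<eta>')"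

text \<open>Generator of the vectorial Deffuant model applied to a function f depending
  only on the finite set of sites D.  Site x picks neighbour y at rate 1/2; if
  1 \<le> H \<le> \<theta>, each disagreeing issue i is chosen with probability 1/H and
  the i-th coordinate of x is set to that of y.  Updates at sites outside D do not
  change f, so summing over x in D gives the full generator.\<close>
definition deffuant_gen :: "nat \<Rightarrow> nat \<Rightarrow> int set \<Rightarrow> (config \<Rightarrow> real) \<Rightarrow> config \<Rightarrow> real" where
  "deffuant_gen F \<theta> D f \<eta> =
     (\<Sum>x\<in>D. \<Sum>y\<in>{x - 1, x + 1}.
        (if 1 \<le> hamming (\<eta> x) (\<eta> y) \<and> hamming (\<eta> x) (\<eta> y) \<le> \<theta>
         then (1/2) * (1 / real (hamming (\<eta> x) (\<eta> y))) *
              (\<Sum>i\<in>{i. i < F \<and> \<eta> x ! i \<noteq> \<eta> y ! i}.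
                  f (\<eta>(x := (\<eta> x)[i := \<eta> y ! i])) - f \<eta>)
         else 0))"

text \<open>(M, \<eta>) is a version of the vectorial Deffuant model on Z with F issues,
  threshold \<theta>, and initial product measure with parameter \<rho>: state space
  opinions F, right-continuous (piecewise constant) paths, i.i.d. initial condition,
  and the martingale problem for the generator, tested against the natural
  filtration via the generating pi-system of finite-dimensional cylinder events.\<close>
definition deffuant_process ::
  "nat \<Rightarrow> nat \<Rightarrow> real \<Rightarrow> 'a measure \<Rightarrow> (real \<Rightarrow> int \<Rightarrow> 'a \<Rightarrow> opinion) \<Rightarrow> bool" where
  "deffuant_process F \<theta> \<rho> M \<eta> \<longleftrightarrow>
     prob_space M \<and>
     (\<forall>t x. \<eta> t x \<in> measurable M (count_space UNIV)) \<and>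
     (\<forall>t x. \<forall>\<omega>\<in>space M. \<eta> t x \<omega> \<in> opinions F) \<and>
     (\<forall>\<omega>\<in>space M. \<forall>x t. 0 \<le> t \<longrightarrow>
        (\<exists>\<epsilon>>0. \<forall>r. t \<le> r \<and> r < t + \<epsilon> \<longrightarrow> \<eta> r x \<omega> = \<eta> t x \<omega>)) \<and>
     prob_space.indep_vars M (\<lambda>_. count_space UNIV) (\<lambda>x. \<eta> 0 x) UNIV \<and>
     (\<forall>x u. measure M {\<omega>\<in>space M. \<eta> 0 x \<omega> = u} = init_pmf F \<rho> u) \<and>
     (\<forall>D f s t ps. finite D \<longrightarrow> depends_only_on D f \<longrightarrow> 0 \<le> s \<longrightarrow> s \<le> t \<longrightarrow>
        (\<forall>(r, z, a) \<in> set ps. 0 \<le> r \<and> r \<le> s) \<longrightarrow>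
        (\<integral>\<omega>. (f (\<lambda>z. \<eta> t z \<omega>) - f (\<lambda>z. \<eta> s z \<omega>)
                 - (LBINT r=s..t. deffuant_gen F \<theta> D f (\<lambda>z. \<eta> r z \<omega>)))
              * indicator {\<omega>'. \<forall>(r, z, a) \<in> set ps. \<eta> r z \<omega>' = a} \<omega> \<partial>M) = 0)"

end

theory Submission
  imports Defs
begin

text \<open>
  View each disagreement across an edge as a particle on that edge. An edge with more than \<open>\<theta>\<close>
  particles is a blockade: it emits nothing and absorbs what it receives. Give an edge with \<open>h\<close> particles
  the weight \<open>\<bar>h - \<theta>\<bar> - \<theta>\<close>. A particle leaving an edge raises its weight by one and a particle
  entering changes it by at most one. Hence, if the partial sums of the initial weights away from a site next to a
  blockade grow linearly, that blockade can only be broken if a far site flips linearly often, which has small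
  probability because every site flips at rate at most one; such a good site never changes. For small
  \<open>\<rho>\<close> the weights have positive mean since \<open>F > 2 * \<theta>\<close>, so good sites with any prescribed initial
  opinion occur in both directions. Between two good sites active particles perform random
  walks that can never reach the boundary, so a concave weighting of the particles is a
  supermartingale that forces all flips to stop.

  The process is known only through its martingale problem. The pathwise argument is therefore
  applied to the process sampled on a time grid: a grid step of length \<open>h\<close> differs from a single
  legal update of a finite box with probability of order \<open>h\<^sup>2\<close>.
\<close>

subsection \<open>Blockades in discrete time\<close>

text \<open>The weight of an edge is the number of particles it can still absorb, net of those it
  may later release: a blockade with \<open>h\<close> particles needs \<open>h - \<theta>\<close>
  arrivals to become active and then holds \<theta> particles, while an active edge has its
  \<open>h\<close> particles to release.

  The obstacle is the infinite volume. Infinitely many sites may flip in every time interval, so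
  there is no first jump at which an induction could start, and only right-continuity of each single
  site is given. In a finite box the grid restores an induction over steps, at the price of an
  uncontrolled site at distance \<open>k\<close>. Its flips by time \<open>t\<close> have mean at
  most \<open>t\<close> for every mesh, whereas breaking the blockade takes a number of order
  \<open>k\<close>; so the mesh is sent to zero with \<open>k\<close> fixed, and \<open>k\<close> to
  infinity afterwards. Being good is read off the initial configuration alone, so freezing holds
  almost surely at each fixed time, and two good sites cut off the box between them from the rest of
  the line.\<close>

definition edge_weight :: "nat \<Rightarrow> opinion \<Rightarrow> opinion \<Rightarrow> int" where
  "edge_weight \<theta> u v = \<bar>int (hamming u v) - int \<theta>\<bar> - int \<theta>"

text \<open>Agreement is demanded on \<open>D\<close> only, so that for fixed \<eta> this is a
  function of finitely many sites of \<open>\<eta>'\<close> and can be tested with the generator.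
  The updated site lies in \<open>D\<close>, the copied neighbour may lie just outside; a step in
  which nothing moves is legal.\<close>

definition legal_step :: "nat \<Rightarrow> nat \<Rightarrow> int set \<Rightarrow> config \<Rightarrow> config \<Rightarrow> bool" where
  "legal_step F \<theta> D \<eta> \<eta>' \<longleftrightarrow> (\<forall>z\<in>D. \<eta>' z = \<eta> z) \<or>
     (\<exists>v\<in>D. \<exists>y\<in>{v - 1, v + 1}. \<exists>i<F.
        1 \<le> hamming (\<eta> v) (\<eta> y) \<and> hamming (\<eta> v) (\<eta> y) \<le> \<theta> \<and> \<eta> v ! i \<noteq> \<eta> y ! i \<and>
        (\<forall>z\<in>D. \<eta>' z = (\<eta>(v := (\<eta> v)[i := \<eta> y ! i])) z))"

section \<open>Hamming distance under a single flip\<close>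

lemma hamming_commute: "length u = length v \<Longrightarrow> hamming u v = hamming v u"
  unfolding hamming_def by (rule arg_cong[where f = card]) auto

lemma hamming_refl [simp]: "hamming u u = 0"
  by (simp add: hamming_def)

lemma hamming_flip_disagree:
  assumes "i < length u" "u ! i \<noteq> v ! i"
  shows "hamming u v = Suc (hamming (u[i := v ! i]) v)"
proof -
  let ?S = "{j. j < length u \<and> u ! j \<noteq> v ! j}"
  have "{j. j < length (u[i := v ! i]) \<and> u[i := v ! i] ! j \<noteq> v ! j} = ?S - {i}"
    using assms by (auto simp: nth_list_update split: if_splits)
  moreover have "i \<in> ?S" "finite ?S" using assms by auto
  ultimately show ?thesis unfolding hamming_def
    by (metis card_Suc_Diff1)
qed

lemma hamming_flip_agree:
  assumes "i < length u" "u ! i = v ! i" "b \<noteq> u ! i"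
  shows "hamming (u[i := b]) v = Suc (hamming u v)"
proof -
  let ?S = "{j. j < length u \<and> u ! j \<noteq> v ! j}"
  have "{j. j < length (u[i := b]) \<and> u[i := b] ! j \<noteq> v ! j} = insert i ?S"
    using assms by (auto simp: nth_list_update)
  moreover have "i \<notin> ?S" "finite ?S" using assms by auto
  ultimately show ?thesis unfolding hamming_def by simp
qed

text \<open>Issues are binary: flipping an issue on which \<open>u\<close> and \<open>v\<close>
  disagree makes them agree. Hence an update changes the particle count of both adjacent edges by
  exactly one.\<close>

lemma hamming_flip_abs:
  assumes "i < length u" "b \<noteq> u ! i"
  shows "\<bar>int (hamming (u[i := b]) v) - int (hamming u v)\<bar> = 1"
proof (cases "u ! i = v ! i")
  case True
  then show ?thesis using hamming_flip_agree[OF assms(1) True assms(2)] by simp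
next
  case False
  then have "b = v ! i" using assms by auto
  then show ?thesis using hamming_flip_disagree[OF assms(1) False] by simp
qed

text \<open>Downward induction on the edge: an edge can only emit towards the origin while active,
  that is while its weight is negative, and then what it received from beyond exceeds the bound
  for the next edge.\<close>
lemma flux_bound:
  fixes \<xi> \<delta> :: "nat \<Rightarrow> nat \<Rightarrow> int" and S :: "nat \<Rightarrow> int" and w :: "int \<Rightarrow> int"
  assumes balance: "\<And>m i. m < n \<Longrightarrow> 1 \<le> i \<Longrightarrow> i < k \<Longrightarrow>
      w (\<xi> (Suc m) i) \<ge> w (\<xi> m i) - \<delta> m (Suc i) + \<delta> m i"
    and le1: "\<And>m i. \<delta> m i \<le> 1"
    and active: "\<And>m i. m < n \<Longrightarrow> 1 \<le> i \<Longrightarrow> i < k \<Longrightarrow> \<delta> m i = 1 \<Longrightarrow> w (\<xi> m i) < 0"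
    and base: "\<And>m. m \<le> n \<Longrightarrow> (\<Sum>m'<m. \<delta> m' k) \<le> S k"
    and S_nonneg: "\<And>i. 1 \<le> i \<Longrightarrow> i \<le> k \<Longrightarrow> S i \<ge> 0"
    and S_Suc: "\<And>i. 1 \<le> i \<Longrightarrow> i < k \<Longrightarrow> S (Suc i) = S i + w (\<xi> 0 i)"
    and "1 \<le> i" "i \<le> k" "m \<le> n"
  shows "(\<Sum>m'<m. \<delta> m' i) \<le> S i"
proof -
  have weight: "w (\<xi> m i) \<ge> w (\<xi> 0 i) - (\<Sum>m'<m. \<delta> m' (Suc i)) + (\<Sum>m'<m. \<delta> m' i)"
    if "m \<le> n" "1 \<le> i" "i < k" for m i
    using that
  proof (induction m)
    case (Suc m)
    then show ?case using balance[of m i] by simp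
  qed simp
  have "\<forall>m\<le>n. (\<Sum>m'<m. \<delta> m' i) \<le> S i"
    using \<open>i \<le> k\<close> \<open>1 \<le> i\<close>
  proof (induction i rule: inc_induct)
    case base
    then show ?case using assms(4) by blast
  next
    case (step i)
    show ?case
    proof (intro allI impI)
      fix m assume "m \<le> n"
      then show "(\<Sum>m'<m. \<delta> m' i) \<le> S i"
      proof (induction m)
        case 0
        then show ?case using S_nonneg[of i] step by simp
      next
        case (Suc m)
        then have IH: "(\<Sum>m'<m. \<delta> m' i) \<le> S i" by simp
        \<comment> \<open>Only an emission at the moment when the bound is attained could violate
          it. The weight is then negative by \<open>active\<close>, while \<open>weight\<close> and
          the bound for \<open>Suc i\<close> make it at least
          \<open>w (\<xi> 0 i) - S (Suc i) + S i\<close>, which is zero.\<close>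
        show ?case
        proof (cases "\<delta> m i = 1 \<and> (\<Sum>m'<m. \<delta> m' i) = S i")
          case True
          have "w (\<xi> m i) < 0" using active[of m i] True Suc step by simp
          moreover have "w (\<xi> m i) \<ge> w (\<xi> 0 i) - (\<Sum>m'<m. \<delta> m' (Suc i)) + S i"
            using weight[of m i] True Suc step by simp
          moreover have "(\<Sum>m'<m. \<delta> m' (Suc i)) \<le> S (Suc i)"
            using step Suc by simp
          ultimately show ?thesis using S_Suc[of i] step by simp
        next
          case False
          then show ?thesis using IH le1[of m i] by (auto simp: less_le)
        qed
      qed
    qed
  qed
  then show ?thesis using \<open>m \<le> n\<close> by blast
qed

text \<open>If \<open>z\<close> changes it is the updated site, and a particle crosses it: the edge
  to the copied neighbour is active and loses one, the opposite edge gains one or, if it held a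
  particle of the same issue, loses that one by annihilation. The sign \<sigma> fixes an
  orientation, so that the same facts serve both sides of a blockade.\<close>

lemma legal_step_edges:
  assumes step: "legal_step F \<theta> D \<eta> \<eta>'" and len: "\<And>z. length (\<eta> z) = F"
    and z: "z \<in> D" and ch: "\<eta>' z \<noteq> \<eta> z" and sig: "\<sigma> = 1 \<or> \<sigma> = (-1::int)"
    and nb: "z - \<sigma> \<in> D" "z + \<sigma> \<in> D"
  shows "\<eta>' (z - \<sigma>) = \<eta> (z - \<sigma>)" "\<eta>' (z + \<sigma>) = \<eta> (z + \<sigma>)"
    "\<bar>int (hamming (\<eta>' z) (\<eta>' (z + \<sigma>))) - int (hamming (\<eta> z) (\<eta> (z + \<sigma>)))\<bar> = 1"
    "\<bar>int (hamming (\<eta>' (z - \<sigma>)) (\<eta>' z)) - int (hamming (\<eta> (z - \<sigma>)) (\<eta> z))\<bar> = 1"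
    "(1 \<le> hamming (\<eta> z) (\<eta> (z + \<sigma>)) \<and> hamming (\<eta> z) (\<eta> (z + \<sigma>)) \<le> \<theta> \<and>
        int (hamming (\<eta>' z) (\<eta>' (z + \<sigma>))) = int (hamming (\<eta> z) (\<eta> (z + \<sigma>))) - 1) \<or>
     (1 \<le> hamming (\<eta> (z - \<sigma>)) (\<eta> z) \<and> hamming (\<eta> (z - \<sigma>)) (\<eta> z) \<le> \<theta> \<and>
        int (hamming (\<eta>' (z - \<sigma>)) (\<eta>' z)) = int (hamming (\<eta> (z - \<sigma>)) (\<eta> z)) - 1)"
proof -
  obtain v y i where v: "v \<in> D" "y \<in> {v - 1, v + 1}" "i < F"
    "1 \<le> hamming (\<eta> v) (\<eta> y)" "hamming (\<eta> v) (\<eta> y) \<le> \<theta>" "\<eta> v ! i \<noteq> \<eta> y ! i"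
    "\<forall>z\<in>D. \<eta>' z = (\<eta>(v := (\<eta> v)[i := \<eta> y ! i])) z"
    using step z ch unfolding legal_step_def by blast
  have "v = z" using v(7) z ch by (auto split: if_splits)
  have z': "\<eta>' z = (\<eta> z)[i := \<eta> y ! i]" using v(7) z \<open>v = z\<close> by auto
  show a: "\<eta>' (z - \<sigma>) = \<eta> (z - \<sigma>)" "\<eta>' (z + \<sigma>) = \<eta> (z + \<sigma>)"
    using v(7) nb sig \<open>v = z\<close> by auto
  have i: "i < length (\<eta> z)" "\<eta> y ! i \<noteq> \<eta> z ! i" using v \<open>v = z\<close> len by auto
  have len': "length (\<eta>' z) = F" using z' len by simp
  have comm: "hamming (\<eta> z) u = hamming u (\<eta> z)" "hamming (\<eta>' z) u = hamming u (\<eta>' z)"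
    if "length u = F" for u
    using hamming_commute that len len' by metis+
  show "\<bar>int (hamming (\<eta>' z) (\<eta>' (z + \<sigma>))) - int (hamming (\<eta> z) (\<eta> (z + \<sigma>)))\<bar> = 1"
    unfolding a z' by (rule hamming_flip_abs[OF i])
  show "\<bar>int (hamming (\<eta>' (z - \<sigma>)) (\<eta>' z)) - int (hamming (\<eta> (z - \<sigma>)) (\<eta> z))\<bar> = 1"
    unfolding a comm[OF len, symmetric] unfolding z' by (rule hamming_flip_abs[OF i])
  have dec: "int (hamming (\<eta>' z) (\<eta> y)) = int (hamming (\<eta> z) (\<eta> y)) - 1"
    using hamming_flip_disagree[of i "\<eta> z" "\<eta> y"] i z' by simp
  have "y = z + \<sigma> \<or> y = z - \<sigma>" using v(2) \<open>v = z\<close> sig by auto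
  then show "(1 \<le> hamming (\<eta> z) (\<eta> (z + \<sigma>)) \<and> hamming (\<eta> z) (\<eta> (z + \<sigma>)) \<le> \<theta> \<and>
        int (hamming (\<eta>' z) (\<eta>' (z + \<sigma>))) = int (hamming (\<eta> z) (\<eta> (z + \<sigma>))) - 1) \<or>
     (1 \<le> hamming (\<eta> (z - \<sigma>)) (\<eta> z) \<and> hamming (\<eta> (z - \<sigma>)) (\<eta> z) \<le> \<theta> \<and>
        int (hamming (\<eta>' (z - \<sigma>)) (\<eta>' z)) = int (hamming (\<eta> (z - \<sigma>)) (\<eta> z)) - 1)"
  proof
    assume "y = z + \<sigma>"
    then show ?thesis using v(4,5) dec \<open>v = z\<close> a by simp
  next
    assume "y = z - \<sigma>"
    then show ?thesis using v(4,5) dec \<open>v = z\<close> a comm len by simp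
  qed
qed

text \<open>Edge \<open>j\<close> joins \<open>s j\<close> and \<open>s (Suc j)\<close>, counted
  outwards from the centre \<open>s 0\<close>. The assumption that \<open>s 0\<close> stands still
  decouples the two sides of the centre: edge \<open>0\<close> can then lose particles only through
  flips of \<open>s 1\<close>, whose flux is bounded by \<open>flux_bound\<close> with the flips of
  \<open>s k\<close> as the source at the far end.\<close>

lemma blockade_side:
  fixes c :: "nat \<Rightarrow> config" and x \<sigma> :: int
  defines "s \<equiv> \<lambda>j::nat. x + \<sigma> * int j"
  assumes sig: "\<sigma> = 1 \<or> \<sigma> = -1"
    and len: "\<And>m z. length (c m z) = F"
    and steps: "\<And>m. m < n \<Longrightarrow> legal_step F \<theta> D (c m) (c (Suc m))"
    and D: "\<And>j. j \<le> Suc k \<Longrightarrow> s j \<in> D"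
    and k: "1 \<le> k"
    and blocked: "hamming (c 0 (s 0)) (c 0 (s 1)) > \<theta>"
    and sums: "\<And>j. 1 \<le> j \<Longrightarrow> j \<le> k \<Longrightarrow> 0 \<le> (\<Sum>i=1..<j. edge_weight \<theta> (c 0 (s i)) (c 0 (s (Suc i))))"
    and few: "int (card {m. m < n \<and> c (Suc m) (s k) \<noteq> c m (s k)})
        \<le> (\<Sum>i=1..<k. edge_weight \<theta> (c 0 (s i)) (c 0 (s (Suc i))))"
    and still: "\<And>m. m < n \<Longrightarrow> c (Suc m) (s 0) = c m (s 0)"
    and "m \<le> n"
  shows "hamming (c m (s 0)) (c m (s 1)) > \<theta>"
proof -
  define \<xi> where "\<xi> m j = int (hamming (c m (s j)) (c m (s (Suc j))))" for m j
  define w where "w h = \<bar>h - int \<theta>\<bar> - int \<theta>" for h :: int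
  \<comment> \<open>Flux through \<open>s j\<close> towards the centre. A flip counts as inward
    whenever the outer edge \<open>j\<close> is active and loses a particle, thus also when an
    outward move annihilates there; otherwise the inner edge is the active one that loses. Under
    either sign the edge named as losing gains one unit of weight, and the other loses at most one
    unit.\<close>
  define \<delta> :: "nat \<Rightarrow> nat \<Rightarrow> int" where "\<delta> m j = (if c (Suc m) (s j) = c m (s j) then 0
     else if \<xi> m j \<le> int \<theta> \<and> \<xi> (Suc m) j = \<xi> m j - 1 then 1 else -1)" for m j
  \<comment> \<open>The inward flux through \<open>s j\<close> that the edges before it can take:
    edge \<open>0\<close> may lose \<open>\<xi> 0 0 - \<theta> - 1\<close> particles and still
    exceed \<theta>, and each further edge adds its weight.\<close>
  define S where "S j = \<xi> 0 0 - int \<theta> - 1 + (\<Sum>i=1..<j. w (\<xi> 0 i))" for j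
  have wS: "(\<Sum>i=1..<j. edge_weight \<theta> (c 0 (s i)) (c 0 (s (Suc i)))) = (\<Sum>i=1..<j. w (\<xi> 0 i))" for j
    by (simp add: edge_weight_def w_def \<xi>_def)
  have flip: "c (Suc m) (s j) = c m (s j) \<and> c (Suc m) (s (Suc (Suc j))) = c m (s (Suc (Suc j)))"
      "\<bar>\<xi> (Suc m) (Suc j) - \<xi> m (Suc j)\<bar> = 1" "\<bar>\<xi> (Suc m) j - \<xi> m j\<bar> = 1"
      "1 \<le> \<xi> m (Suc j) \<and> \<xi> m (Suc j) \<le> int \<theta> \<and> \<xi> (Suc m) (Suc j) = \<xi> m (Suc j) - 1 \<or>
       1 \<le> \<xi> m j \<and> \<xi> m j \<le> int \<theta> \<and> \<xi> (Suc m) j = \<xi> m j - 1"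
    if "m < n" "j < k" "c (Suc m) (s (Suc j)) \<noteq> c m (s (Suc j))" for m j
  proof -
    have nb: "s (Suc j) - \<sigma> = s j" "s (Suc j) + \<sigma> = s (Suc (Suc j))"
      by (simp_all add: s_def algebra_simps)
    have *: "s (Suc j) \<in> D" "s (Suc j) - \<sigma> \<in> D" "s (Suc j) + \<sigma> \<in> D"
      unfolding nb using D that by auto
    note e = legal_step_edges[OF steps[OF that(1)] len *(1) that(3) sig *(2,3), unfolded nb]
    show "c (Suc m) (s j) = c m (s j) \<and> c (Suc m) (s (Suc (Suc j))) = c m (s (Suc (Suc j)))"
      using e(1,2) by blast
    show "\<bar>\<xi> (Suc m) (Suc j) - \<xi> m (Suc j)\<bar> = 1" "\<bar>\<xi> (Suc m) j - \<xi> m j\<bar> = 1"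
      using e(3,4) by (simp_all add: \<xi>_def)
    show "1 \<le> \<xi> m (Suc j) \<and> \<xi> m (Suc j) \<le> int \<theta> \<and> \<xi> (Suc m) (Suc j) = \<xi> m (Suc j) - 1 \<or>
       1 \<le> \<xi> m j \<and> \<xi> m j \<le> int \<theta> \<and> \<xi> (Suc m) j = \<xi> m j - 1"
      using e(5) unfolding \<xi>_def by simp
  qed
  have \<delta>_le1: "\<delta> m i \<le> 1" for m i by (simp add: \<delta>_def)
  have \<delta>_zero: "\<delta> m i = 0" if "c (Suc m) (s i) = c m (s i)" for m i
    using that by (simp add: \<delta>_def)
  have lipschitz: "w a - 1 \<le> w b" if "\<bar>b - a\<bar> = 1" for a b using that unfolding w_def by linarith
  have dec: "w b = w a + 1" if "a \<le> int \<theta>" "b = a - 1" for a b using that unfolding w_def by linarith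
  have balance: "w (\<xi> (Suc m) i) \<ge> w (\<xi> m i) - \<delta> m (Suc i) + \<delta> m i"
    if "m < n" "1 \<le> i" "i < k" for m i
  proof -
    obtain j where i: "i = Suc j" using \<open>1 \<le> i\<close> by (cases i) auto
    show ?thesis
    proof (cases "c (Suc m) (s i) = c m (s i)")
      case False
      have f: "c (Suc m) (s (Suc i)) = c m (s (Suc i))" "\<bar>\<xi> (Suc m) i - \<xi> m i\<bar> = 1"
        using flip(1,2)[of m j] that i False by auto
      show ?thesis using lipschitz[OF f(2)] dec[of "\<xi> m i" "\<xi> (Suc m) i"] \<delta>_zero[OF f(1)] False
        unfolding \<delta>_def[of m i] by auto
    next
      case True
      show ?thesis
      proof (cases "c (Suc m) (s (Suc i)) = c m (s (Suc i))")
        case True': True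
        then have "\<xi> (Suc m) i = \<xi> m i" using True by (simp add: \<xi>_def)
        then show ?thesis using \<delta>_zero[OF True] \<delta>_zero[OF True'] by simp
      next
        case False
        have f: "\<bar>\<xi> (Suc m) i - \<xi> m i\<bar> = 1"
          "1 \<le> \<xi> m (Suc i) \<and> \<xi> m (Suc i) \<le> int \<theta> \<and> \<xi> (Suc m) (Suc i) = \<xi> m (Suc i) - 1 \<or>
           1 \<le> \<xi> m i \<and> \<xi> m i \<le> int \<theta> \<and> \<xi> (Suc m) i = \<xi> m i - 1"
          using flip(3,4)[of m i] that False by auto
        show ?thesis using lipschitz[OF f(1)] f(2) dec[of "\<xi> m i" "\<xi> (Suc m) i"] \<delta>_zero[OF True] False
          unfolding \<delta>_def[of m "Suc i"] by auto
      qed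
    qed
  qed
  have active: "w (\<xi> m i) < 0" if "m < n" "1 \<le> i" "i < k" "\<delta> m i = 1" for m i
  proof -
    have "\<xi> m i \<le> int \<theta>" "\<xi> (Suc m) i = \<xi> m i - 1" using that(4) by (auto simp: \<delta>_def split: if_splits)
    moreover have "\<xi> (Suc m) i \<ge> 0" by (simp add: \<xi>_def)
    ultimately show ?thesis unfolding w_def by linarith
  qed
  have "\<xi> 0 0 > int \<theta>" using blocked by (simp add: \<xi>_def s_def)
  have S_nonneg: "0 \<le> S i" if "1 \<le> i" "i \<le> k" for i
    using sums[OF that] \<open>\<xi> 0 0 > int \<theta>\<close> unfolding wS S_def by simp
  have base: "(\<Sum>m'<m. \<delta> m' k) \<le> S k" if "m \<le> n" for m
  proof -
    have "(\<Sum>m'<m. \<delta> m' k) \<le> (\<Sum>m'<m. if c (Suc m') (s k) \<noteq> c m' (s k) then 1 else 0)"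
      by (rule sum_mono) (simp add: \<delta>_def)
    also have "\<dots> = int (card {m'. m' < m \<and> c (Suc m') (s k) \<noteq> c m' (s k)})"
      by (subst sum.If_cases) (auto intro!: arg_cong[where f = card])
    also have "\<dots> \<le> int (card {m'. m' < n \<and> c (Suc m') (s k) \<noteq> c m' (s k)})"
      using that by (intro of_nat_mono card_mono) auto
    finally show ?thesis using few \<open>\<xi> 0 0 > int \<theta>\<close> unfolding wS S_def by simp
  qed
  have flux: "(\<Sum>m'<m. \<delta> m' 1) \<le> S 1" if "m \<le> n" for m
    by (rule flux_bound[where w = w and \<xi> = \<xi> and n = n and k = k])
       (use balance \<delta>_le1 active base S_nonneg that k in \<open>auto simp: S_def\<close>)
  have "\<xi> m 0 \<ge> \<xi> 0 0 - (\<Sum>m'<m. \<delta> m' 1) \<and> \<xi> m 0 > int \<theta>"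
    using \<open>m \<le> n\<close>
  proof (induction m)
    case 0
    then show ?case using \<open>\<xi> 0 0 > int \<theta>\<close> by simp
  next
    case (Suc m)
    then have m: "m < n" and IH: "\<xi> m 0 \<ge> \<xi> 0 0 - (\<Sum>m'<m. \<delta> m' 1)" "\<xi> m 0 > int \<theta>" by auto
    \<comment> \<open>Above \<theta> the edge \<open>0\<close> is not active, so a flip of
      \<open>s 1\<close> must draw on edge \<open>1\<close>; it therefore has
      \<open>\<delta> = 1\<close>, which pays for the particle that edge \<open>0\<close> may
      lose.\<close>
    have "\<xi> (Suc m) 0 \<ge> \<xi> m 0 - \<delta> m 1"
    proof (cases "c (Suc m) (s 1) = c m (s 1)")
      case True
      then show ?thesis using still[OF m] \<delta>_zero[OF True] by (simp add: \<xi>_def)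
    next
      case False
      then show ?thesis using flip(3,4)[of m 0] m k IH(2) by (auto simp: \<delta>_def)
    qed
    then have "\<xi> (Suc m) 0 \<ge> \<xi> 0 0 - (\<Sum>m'<Suc m. \<delta> m' 1)" using IH(1) by simp
    moreover have "(\<Sum>m'<Suc m. \<delta> m' 1) \<le> S 1" using flux[OF Suc.prems] .
    ultimately show ?case by (auto simp: S_def)
  qed
  then show ?thesis by (simp add: \<xi>_def)
qed

text \<open>Growth of the partial weights with slope \<open>1 / 64\<close>, kept in integers. With
  the additive \<open>1\<close>, the case \<open>k = 1\<close> demands only a nonnegative weight.
  The sum starts at the second edge because the first one is the blockade to be protected.\<close>

definition good_side :: "nat \<Rightarrow> int \<Rightarrow> int \<Rightarrow> config \<Rightarrow> bool" where
  "good_side \<theta> \<sigma> x \<eta> \<longleftrightarrow> \<theta> < hamming (\<eta> x) (\<eta> (x + \<sigma>)) \<and>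
     (\<forall>k\<ge>1. int k \<le> 64 * (\<Sum>i=1..k. edge_weight \<theta> (\<eta> (x + \<sigma> * int i)) (\<eta> (x + \<sigma> * int (Suc i)))) + 1)"

definition good :: "nat \<Rightarrow> int \<Rightarrow> config \<Rightarrow> bool" where
  "good \<theta> x \<eta> \<longleftrightarrow> good_side \<theta> 1 x \<eta> \<and> good_side \<theta> (-1) x \<eta>"

text \<open>Each side needs the centre to stand still, and the centre stands still because both
  adjacent edges are blockades; an induction on the step resolves this circle. The bound
  \<open>k - 2\<close> is what the growth condition yields for the \<open>k - 1\<close> edges before
  the far site.\<close>

lemma blockade:
  fixes c :: "nat \<Rightarrow> config" and x :: int
  assumes len: "\<And>m z. length (c m z) = F"
    and steps: "\<And>m. m < n \<Longrightarrow> legal_step F \<theta> D (c m) (c (Suc m))"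
    and D: "{x - int k - 1 .. x + int k + 1} \<subseteq> D"
    and k: "1 \<le> k"
    and good: "good \<theta> x (c 0)"
    and few: "\<And>\<sigma>. \<sigma> \<in> {1, -1} \<Longrightarrow> 
      64 * int (card {m. m < n \<and> c (Suc m) (x + \<sigma> * int k) \<noteq> c m (x + \<sigma> * int k)}) \<le> int k - 2"
    and "m \<le> n"
  shows "c m x = c 0 x \<and> \<theta> < hamming (c m x) (c m (x + 1)) \<and> \<theta> < hamming (c m x) (c m (x - 1))"
proof -
  have side: "\<theta> < hamming (c m x) (c m (x + \<sigma>))"
    if sig: "\<sigma> \<in> {1, -1}" and m: "m \<le> n" and still: "\<And>m'. m' < m \<Longrightarrow> c (Suc m') x = c m' x" for \<sigma> m
  proof -
    let ?W = "\<lambda>j. \<Sum>i=1..<j. edge_weight \<theta> (c 0 (x + \<sigma> * int i)) (c 0 (x + \<sigma> * int (Suc i)))"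
    have gs: "good_side \<theta> \<sigma> x (c 0)" using good sig by (auto simp: good_def)
    have W: "int j - 2 \<le> 64 * ?W j" if "2 \<le> j" for j
    proof -
      have "{1..<j} = {1..j-1}" using that by auto
      then show ?thesis using gs that unfolding good_side_def by (auto dest!: spec[of _ "j - 1"])
    qed
    have Wnn: "0 \<le> ?W j" if "1 \<le> j" for j
      using W[of j] that by (cases "j = 1") auto
    have "{m'. m' < m \<and> c (Suc m') (x + \<sigma> * int k) \<noteq> c m' (x + \<sigma> * int k)} \<subseteq>
          {m. m < n \<and> c (Suc m) (x + \<sigma> * int k) \<noteq> c m (x + \<sigma> * int k)}" using m by auto
    then have "card {m'. m' < m \<and> c (Suc m') (x + \<sigma> * int k) \<noteq> c m' (x + \<sigma> * int k)} \<le>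
          card {m. m < n \<and> c (Suc m) (x + \<sigma> * int k) \<noteq> c m (x + \<sigma> * int k)}"
      by (rule card_mono[rotated]) auto
    then have few': "64 * int (card {m'. m' < m \<and> c (Suc m') (x + \<sigma> * int k) \<noteq> c m' (x + \<sigma> * int k)}) \<le> int k - 2"
      using few[OF sig] by linarith
    then have k2: "k \<ge> 2" by linarith
    have "\<theta> < hamming (c m (x + \<sigma> * int 0)) (c m (x + \<sigma> * int 1))"
    proof (rule blockade_side[where n = m and k = k and D = D])
      show "\<sigma> = 1 \<or> \<sigma> = -1" using sig by auto
      show "legal_step F \<theta> D (c m') (c (Suc m'))" if "m' < m" for m' using steps that m by auto
      show "x + \<sigma> * int j \<in> D" if "j \<le> Suc k" for j using D sig that by auto
      show "\<theta> < hamming (c 0 (x + \<sigma> * int 0)) (c 0 (x + \<sigma> * int 1))"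
        using gs by (simp add: good_side_def)
      show "int (card {m'. m' < m \<and> c (Suc m') (x + \<sigma> * int k) \<noteq> c m' (x + \<sigma> * int k)}) \<le> ?W k"
        using few' W[OF k2] by linarith
    qed (use len k Wnn still in auto)
    then show ?thesis by simp
  qed
  have "\<forall>m'<m. c (Suc m') x = c m' x" if "m \<le> n" for m
    using that
  proof (induction m)
    case (Suc m)
    then have IH: "\<forall>m'<m. c (Suc m') x = c m' x" and m: "m < n" by auto
    have "c (Suc m) x = c m x"
    proof (rule ccontr)
      assume ch: "c (Suc m) x \<noteq> c m x"
      have "x \<in> D" "x - 1 \<in> D" "x + 1 \<in> D" using D k by auto
      then have e: "hamming (c m x) (c m (x + 1)) \<le> \<theta> \<or> hamming (c m (x - 1)) (c m x) \<le> \<theta>"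
        using legal_step_edges(5)[OF steps[OF m] len _ ch, of 1] by auto
      have "\<theta> < hamming (c m x) (c m (x + 1))" "\<theta> < hamming (c m x) (c m (x + (-1)))"
        using IH m by (intro side; auto)+
      moreover have "hamming (c m x) (c m (x - 1)) = hamming (c m (x - 1)) (c m x)"
        using hamming_commute len by metis
      ultimately show False using e by auto
    qed
    then show ?case using IH by (auto simp: less_Suc_eq)
  qed simp
  then have still: "\<forall>m'<m. c (Suc m') x = c m' x" using \<open>m \<le> n\<close> by blast
  then have "c m x = c 0 x" by (induction m) auto
  moreover have "\<theta> < hamming (c m x) (c m (x + 1))" "\<theta> < hamming (c m x) (c m (x + (-1)))"
    using still \<open>m \<le> n\<close> by (intro side; auto)+
  ultimately show ?thesis by auto
qed

subsection \<open>The martingale problem\<close>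

lemma depends_only_onI:
  "(\<And>c c'. (\<And>z. z \<in> D \<Longrightarrow> c z = c' z) \<Longrightarrow> f c = f c') \<Longrightarrow> depends_only_on D f"
  unfolding depends_only_on_def by blast

lemma depends_only_onD:
  "depends_only_on D f \<Longrightarrow> (\<And>z. z \<in> D \<Longrightarrow> c z = c' z) \<Longrightarrow> f c = f c'"
  unfolding depends_only_on_def by blast

text \<open>The opinions form a countable type. Freezing one coordinate of \<open>D\<close> at each
  of its countably many values removes that site from \<open>D\<close>, until \<open>f\<close> is
  constant.\<close>

lemma measurable_local:
  fixes f :: "config \<Rightarrow> 'b"
  assumes "finite D" and "\<And>c c'. (\<And>z. z \<in> D \<Longrightarrow> c z = c' z) \<Longrightarrow> f c = f c'"
    and "\<And>z. z \<in> D \<Longrightarrow> X z \<in> measurable N (count_space UNIV)"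
  shows "(\<lambda>\<omega>. f (\<lambda>z. X z \<omega>)) \<in> measurable N (count_space UNIV)"
  using assms
proof (induction D arbitrary: f rule: finite_induct)
  case empty
  then have "f c = f c'" for c c' by blast
  then have "(\<lambda>\<omega>. f (\<lambda>z. X z \<omega>)) = (\<lambda>\<omega>. f (\<lambda>z. []))" by blast
  then show ?case by simp
next
  case (insert y D)
  have "(\<lambda>\<omega>. f ((\<lambda>z. X z \<omega>)(y := a))) \<in> measurable N (count_space UNIV)" for a
    using insert.prems by (intro insert.IH[where f = "\<lambda>c. f (c(y := a))"] insert.prems(1)) auto
  then have "(\<lambda>\<omega>. f ((\<lambda>z. X z \<omega>)(y := X y \<omega>))) \<in> measurable N (count_space UNIV)"
    by (rule measurable_compose_countable) (use insert.prems in auto)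
  then show ?case by (simp add: fun_upd_idem)
qed

lemma borel_measurable_local:
  assumes "finite D" "depends_only_on D f"
    and "\<And>z. z \<in> D \<Longrightarrow> X z \<in> measurable N (count_space UNIV)"
  shows "(\<lambda>\<omega>. f (\<lambda>z. X z \<omega>)) \<in> borel_measurable N"
proof -
  have "(\<lambda>\<omega>. f (\<lambda>z. X z \<omega>)) \<in> measurable N (count_space UNIV)"
  proof (rule measurable_local[of D])
    show "f c = f c'" if "\<And>z. z \<in> D \<Longrightarrow> c z = c' z" for c c'
      using assms(2) that by (rule depends_only_onD)
  qed (use assms in auto)
  then show ?thesis
    using measurable_compose[of _ N "count_space UNIV" "\<lambda>x. x" borel] by simp
qed

lemma finite_opinions: "finite (opinions F)"
  using finite_lists_length_eq[of "UNIV :: bool set" F] by (simp add: opinions_def)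

lemma card_opinions: "card (opinions F) = 2 ^ F"
  using card_lists_length_eq[of "UNIV :: bool set" F] by (simp add: opinions_def)

lemma local_bounded:
  assumes "finite D" "depends_only_on D f"
  obtains b :: real where "0 \<le> b" "\<And>c. (\<And>z. length (c z) = F) \<Longrightarrow> \<bar>f c\<bar> \<le> b"
proof -
  let ?A = "(\<lambda>a. \<bar>f a\<bar>) ` (PiE D (\<lambda>_. opinions F))"
  have fin: "finite ?A" by (intro finite_imageI finite_PiE assms(1) finite_opinions)
  show ?thesis
  proof (rule that[of "Max (insert 0 ?A)"])
    show "0 \<le> Max (insert 0 ?A)" using fin by simp
    fix c :: config assume "\<And>z. length (c z) = F"
    then have "restrict c D \<in> PiE D (\<lambda>_. opinions F)" by (auto simp: opinions_def)
    moreover have "f c = f (restrict c D)"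
      by (rule depends_only_onD[OF assms(2)]) simp
    ultimately have "\<bar>f c\<bar> \<in> ?A" by (metis image_eqI)
    then show "\<bar>f c\<bar> \<le> Max (insert 0 ?A)" using fin by (intro Max_ge) auto
  qed
qed

definition nbhd :: "int set \<Rightarrow> int set" where
  "nbhd D = (\<Union>x\<in>D. {x - 1, x, x + 1})"

lemma finite_nbhd: "finite D \<Longrightarrow> finite (nbhd D)"
  by (simp add: nbhd_def)

lemma gen_local:
  assumes "depends_only_on D f"
  shows "depends_only_on (nbhd D) (deffuant_gen F \<theta> D f)"
  unfolding depends_only_on_def
proof (intro allI impI)
  fix c c' :: config assume eq: "\<forall>z\<in>nbhd D. c z = c' z"
  have f: "f c = f c'" "f (c(x := u)) = f (c'(x := u))" for x u
    by (rule depends_only_onD[OF assms]; use eq in \<open>auto simp: nbhd_def\<close>)+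
  have c: "c x = c' x" "c (x - 1) = c' (x - 1)" "c (x + 1) = c' (x + 1)" if "x \<in> D" for x
    using eq that unfolding nbhd_def by auto
  show "deffuant_gen F \<theta> D f c = deffuant_gen F \<theta> D f c'"
    unfolding deffuant_gen_def by (intro sum.cong refl) (auto simp: f c)
qed

text \<open>A site updates at total rate at most one: \<open>1 / 2\<close> for each neighbour,
  spread over the \<open>hamming\<close> many disagreeing issues. One update raises a function with
  values in \<open>[0, 1]\<close> by at most one.\<close>

lemma gen_le_card:
  assumes "finite D" "\<And>c. 0 \<le> f c" "\<And>c. f c \<le> 1" "\<And>z. length (c z) = F"
  shows "deffuant_gen F \<theta> D f c \<le> real (card D)"
proof -
  have "deffuant_gen F \<theta> D f c \<le> (\<Sum>x\<in>D. \<Sum>y\<in>{x - 1, x + 1}. 1 / 2)"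
    unfolding deffuant_gen_def
  proof (intro sum_mono)
    fix x y :: int
    let ?h = "hamming (c x) (c y)" and ?S = "{i. i < F \<and> c x ! i \<noteq> c y ! i}"
    show "(if 1 \<le> ?h \<and> ?h \<le> \<theta> then 1 / 2 * (1 / real ?h) *
        (\<Sum>i\<in>?S. f (c(x := (c x)[i := c y ! i])) - f c) else 0) \<le> 1 / 2"
    proof (cases "1 \<le> ?h \<and> ?h \<le> \<theta>")
      case True
      have "f (c(x := (c x)[i := c y ! i])) - f c \<le> 1" for i
        using assms(2)[of c] assms(3)[of "c(x := (c x)[i := c y ! i])"] by linarith
      then have "(\<Sum>i\<in>?S. f (c(x := (c x)[i := c y ! i])) - f c) \<le> (\<Sum>i\<in>?S. 1)"
        by (intro sum_mono)
      also have "\<dots> = real ?h" by (simp add: hamming_def assms(4))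
      finally have "(\<Sum>i\<in>?S. f (c(x := (c x)[i := c y ! i])) - f c) \<le> real ?h" .
      then have "1 / 2 * (1 / real ?h) * (\<Sum>i\<in>?S. f (c(x := (c x)[i := c y ! i])) - f c)
          \<le> 1 / 2 * (1 / real ?h) * real ?h"
        by (rule mult_left_mono) simp
      also have "\<dots> = 1 / 2" using True by simp
      finally show ?thesis using True by simp
    next
      case False
      then show ?thesis by (subst if_not_P) auto
    qed
  qed
  also have "\<dots> = real (card D)" using assms(1) by simp
  finally show ?thesis .
qed

section \<open>The process: joint measurability and Fubini\<close>

locale deffuant = prob_space M for M :: "'a measure" +
  fixes F \<theta> :: nat and \<rho> :: real and \<eta> :: "real \<Rightarrow> int \<Rightarrow> 'a \<Rightarrow> opinion"
  assumes process: "deffuant_process F \<theta> \<rho> M \<eta>"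
begin

abbreviation conf :: "real \<Rightarrow> 'a \<Rightarrow> config" where
  "conf t \<omega> \<equiv> (\<lambda>z. \<eta> t z \<omega>)"

lemma rv [measurable]: "\<eta> t x \<in> measurable M (count_space UNIV)"
  using process[unfolded deffuant_process_def, THEN conjunct2, THEN conjunct1] by blast

lemma len [simp]: "\<omega> \<in> space M \<Longrightarrow> length (\<eta> t x \<omega>) = F"
  using process[unfolded deffuant_process_def, THEN conjunct2, THEN conjunct2, THEN conjunct1]
  unfolding opinions_def by blast

lemma right_cont:
  assumes "\<omega> \<in> space M" "0 \<le> t"
  obtains e where "e > 0" "\<And>r. t \<le> r \<Longrightarrow> r < t + e \<Longrightarrow> \<eta> r x \<omega> = \<eta> t x \<omega>"
proof -
  have "\<forall>\<omega>\<in>space M. \<forall>x t. 0 \<le> t \<longrightarrow> (\<exists>\<epsilon>>0. \<forall>r. t \<le> r \<and> r < t + \<epsilon> \<longrightarrow> \<eta> r x \<omega> = \<eta> t x \<omega>)"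
    by (rule process[unfolded deffuant_process_def, THEN conjunct2, THEN conjunct2, THEN conjunct2, THEN conjunct1])
  then show ?thesis using assms that by meson
qed

text \<open>By right-continuity a path is the eventual value of its samples at the next dyadic time,
  and these samples are measurable in time and \<omega> together. Right-continuity is given for
  nonnegative times, hence \<open>max 0 r\<close>.\<close>

lemma joint_measurable [measurable]:
  "(\<lambda>(r, \<omega>). \<eta> (max 0 r) z \<omega>) \<in> measurable (lborel \<Otimes>\<^sub>M M) (count_space UNIV)"
proof -
  let ?LM = "(lborel :: real measure) \<Otimes>\<^sub>M M"
  define X where "X n p = \<eta> ((real_of_int \<lfloor>max 0 (fst p) * 2 ^ n\<rfloor> + 1) / 2 ^ n) z (snd p)" 
    for n :: nat and p :: "real \<times> 'a"
  have X [measurable]: "X n \<in> measurable ?LM (count_space UNIV)" for n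
  proof -
    have "(\<lambda>p. \<eta> ((real_of_int k + 1) / 2 ^ n) z (snd p)) \<in> measurable ?LM (count_space UNIV)"
      for k by measurable
    then show ?thesis unfolding X_def
      by (rule measurable_compose_countable) measurable
  qed
  have ev: "\<forall>\<^sub>F n in sequentially. X n p = \<eta> (max 0 (fst p)) z (snd p)"
    if p: "p \<in> space ?LM" for p
  proof -
    obtain r \<omega> where p': "p = (r, \<omega>)" "\<omega> \<in> space M" using p by (auto simp: space_pair_measure)
    define q where "q = max 0 r"
    obtain e where e: "e > 0" "\<And>s. q \<le> s \<Longrightarrow> s < q + e \<Longrightarrow> \<eta> s z \<omega> = \<eta> q z \<omega>"
      using right_cont[OF p'(2), of q z] by (metis q_def max.cobounded1)
    have "(\<lambda>n. (1/2::real) ^ n) \<longlonglongrightarrow> 0" by (rule LIMSEQ_realpow_zero) auto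
    then have "\<forall>\<^sub>F n in sequentially. (1/2::real) ^ n < e" using e(1) by (rule order_tendstoD)
    then show ?thesis
    proof eventually_elim
      case (elim n)
      let ?k = "\<lfloor>q * 2 ^ n\<rfloor>"
      have "q * 2 ^ n < real_of_int ?k + 1" "real_of_int ?k \<le> q * 2 ^ n" by linarith+
      then have "q \<le> (real_of_int ?k + 1) / 2 ^ n" "(real_of_int ?k + 1) / 2 ^ n \<le> q + (1/2) ^ n"
        by (auto simp: field_simps power_divide)
      then have "\<eta> ((real_of_int ?k + 1) / 2 ^ n) z \<omega> = \<eta> q z \<omega>"
        using elim by (intro e(2)) auto
      then show ?case by (simp add: X_def p' q_def)
    qed
  qed
  have same: "{p \<in> space ?LM. \<eta> (max 0 (fst p)) z (snd p) = a} =
        {p \<in> space ?LM. \<exists>N. \<forall>n\<ge>N. X n p = a}" for a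
  proof (intro Collect_cong conj_cong refl)
    fix p :: "real \<times> 'a" assume p: "p \<in> space ?LM"
    show "(\<eta> (max 0 (fst p)) z (snd p) = a) = (\<exists>N. \<forall>n\<ge>N. X n p = a)"
    proof
      assume "\<eta> (max 0 (fst p)) z (snd p) = a"
      then show "\<exists>N. \<forall>n\<ge>N. X n p = a" using ev[OF p] by (simp add: eventually_sequentially)
    next
      assume "\<exists>N. \<forall>n\<ge>N. X n p = a"
      then have "\<forall>\<^sub>F n in sequentially. X n p = a" by (simp add: eventually_sequentially)
      then have "\<forall>\<^sub>F n in sequentially. \<eta> (max 0 (fst p)) z (snd p) = a"
        using ev[OF p] by eventually_elim simp
      then show "\<eta> (max 0 (fst p)) z (snd p) = a" by simp
    qed
  qed
  have "{p \<in> space ?LM. \<eta> (max 0 (fst p)) z (snd p) = a} \<in> sets ?LM" for a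
    unfolding same by measurable
  moreover have "(\<lambda>p. \<eta> (max 0 (fst p)) z (snd p)) -` {a} \<inter> space ?LM =
    {p \<in> space ?LM. \<eta> (max 0 (fst p)) z (snd p) = a}" for a by auto
  ultimately show ?thesis
    unfolding measurable_count_space_eq2_countable by (auto simp: case_prod_unfold)
qed

lemma borel_measurable_conf:
  assumes "finite D" "depends_only_on D g"
  shows "(\<lambda>\<omega>. g (conf t \<omega>)) \<in> borel_measurable M"
  using assms by (rule borel_measurable_local) measurable

lemma borel_measurable_joint:
  assumes "finite D" "depends_only_on D g"
  shows "(\<lambda>(r, \<omega>). g (conf (max 0 r) \<omega>)) \<in> borel_measurable (lborel \<Otimes>\<^sub>M M)"
proof -
  have "(\<lambda>p. g (\<lambda>z. (\<lambda>(r, \<omega>). \<eta> (max 0 r) z \<omega>) p)) \<in> borel_measurable (lborel \<Otimes>\<^sub>M M)"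
    using assms joint_measurable by (rule borel_measurable_local[where X = "\<lambda>z (r, \<omega>). \<eta> (max 0 r) z \<omega>"])
  then show ?thesis by (simp add: case_prod_unfold)
qed

lemma integrable_local:
  assumes "finite D" "depends_only_on D g"
  shows "integrable M (\<lambda>\<omega>. g (conf t \<omega>))"
proof -
  obtain b where "0 \<le> b" "\<And>c. (\<And>z. length (c z) = F) \<Longrightarrow> \<bar>g c\<bar> \<le> b"
    using local_bounded[OF assms] by blast
  then show ?thesis
    by (intro integrable_const_bound[of _ b] borel_measurable_conf[OF assms]) auto
qed

lemma integrable_ind_local:
  assumes "finite D" "depends_only_on D g" "B \<in> sets M"
  shows "integrable M (\<lambda>\<omega>. indicator B \<omega> * g (conf t \<omega>))"
  using integrable_mult_indicator[OF assms(3) integrable_local[OF assms(1,2)]] by simp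

lemma fubini_local:
  assumes "finite D" "depends_only_on D g" "0 \<le> s" "B \<in> sets M"
  shows "integrable M (\<lambda>\<omega>. LBINT r:{s..t}. g (conf r \<omega>))"
    and "set_integrable lborel {s..t} (\<lambda>r. \<integral>\<omega>. indicator B \<omega> * g (conf r \<omega>) \<partial>M)"
    and "(\<integral>\<omega>. indicator B \<omega> * (LBINT r:{s..t}. g (conf r \<omega>)) \<partial>M) =
         (LBINT r:{s..t}. \<integral>\<omega>. indicator B \<omega> * g (conf r \<omega>) \<partial>M)"
proof -
  interpret P: pair_sigma_finite lborel M ..
  note [measurable] = borel_measurable_joint[OF assms(1,2)] assms(4)
  obtain b where b: "0 \<le> b" "\<And>c. (\<And>z. length (c z) = F) \<Longrightarrow> \<bar>g c\<bar> \<le> b"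
    using local_bounded[OF assms(1,2)] by blast
  define h where "h A = (\<lambda>(r, \<omega>). indicator {s..t} r * (indicator A \<omega> * g (conf (max 0 r) \<omega>)))" for A
  have int: "integrable (lborel \<Otimes>\<^sub>M M) (h A)" if [measurable]: "A \<in> sets M" for A
  proof (rule integrableI_bounded_set[where A = "{s..t} \<times> space M" and B = b])
    have "(\<lambda>p. indicator {s..t} (fst p) * (indicator A (snd p) * (case p of (r, \<omega>) \<Rightarrow> g (conf (max 0 r) \<omega>))))
        \<in> borel_measurable (lborel \<Otimes>\<^sub>M M)" by measurable
    then show "h A \<in> borel_measurable (lborel \<Otimes>\<^sub>M M)"
      by (simp add: h_def case_prod_unfold)
    show "emeasure (lborel \<Otimes>\<^sub>M M) ({s..t} \<times> space M) < \<infinity>"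
      by (subst emeasure_pair_measure_Times)
         (auto simp: ennreal_mult_less_top not_less top_unique emeasure_space_1 emeasure_lborel_Icc_eq)
    show "AE p in lborel \<Otimes>\<^sub>M M. p \<in> {s..t} \<times> space M \<longrightarrow> norm (h A p) \<le> b"
      using b by (auto simp: h_def indicator_def)
    show "AE p in lborel \<Otimes>\<^sub>M M. p \<notin> {s..t} \<times> space M \<longrightarrow> h A p = 0"
      by (rule AE_I2) (auto simp: h_def indicator_def space_pair_measure)
  qed simp
  have 1: "(\<integral>r. h A (r, \<omega>) \<partial>lborel) = indicator A \<omega> * (LBINT r:{s..t}. g (conf r \<omega>))" for A \<omega>
  proof -
    have "(\<integral>r. h A (r, \<omega>) \<partial>lborel) = (\<integral>r. indicator A \<omega> * (indicator {s..t} r * g (conf r \<omega>)) \<partial>lborel)"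
      using \<open>0 \<le> s\<close> by (intro Bochner_Integration.integral_cong) (auto simp: h_def indicator_def max_def)
    also have "\<dots> = indicator A \<omega> * (\<integral>r. indicator {s..t} r * g (conf r \<omega>) \<partial>lborel)"
      by (rule integral_mult_right_zero)
    finally show ?thesis by (simp add: set_lebesgue_integral_def)
  qed
  have 2: "(\<integral>\<omega>. h A (r, \<omega>) \<partial>M) = indicator {s..t} r * (\<integral>\<omega>. indicator A \<omega> * g (conf r \<omega>) \<partial>M)" for A r
    using \<open>0 \<le> s\<close> by (auto simp: h_def indicator_def max_def)
  have "integrable M (\<lambda>\<omega>. \<integral>r. h (space M) (r, \<omega>) \<partial>lborel)"
    by (rule P.integrable_snd[of "\<lambda>r \<omega>. h (space M) (r, \<omega>)"]) (use int[of "space M"] in simp)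
  then have "integrable M (\<lambda>\<omega>. indicator (space M) \<omega> * (LBINT r:{s..t}. g (conf r \<omega>)))"
    unfolding 1 .
  then show "integrable M (\<lambda>\<omega>. LBINT r:{s..t}. g (conf r \<omega>))"
    by (subst Bochner_Integration.integrable_cong[OF refl, of _ _ "\<lambda>\<omega>. indicator (space M) \<omega> * (LBINT r:{s..t}. g (conf r \<omega>))"]) auto
  have "integrable lborel (\<lambda>r. \<integral>\<omega>. h B (r, \<omega>) \<partial>M)"
    by (rule P.integrable_fst') (use int[of B] in simp)
  then show "set_integrable lborel {s..t} (\<lambda>r. \<integral>\<omega>. indicator B \<omega> * g (conf r \<omega>) \<partial>M)"
    unfolding 2 by (simp add: set_integrable_def)
  have "(\<integral>\<omega>. (\<integral>r. h B (r, \<omega>) \<partial>lborel) \<partial>M) = (\<integral>r. (\<integral>\<omega>. h B (r, \<omega>) \<partial>M) \<partial>lborel)"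
    using P.Fubini_integral[of "\<lambda>r \<omega>. h B (r, \<omega>)"] int[of B] by simp
  then show "(\<integral>\<omega>. indicator B \<omega> * (LBINT r:{s..t}. g (conf r \<omega>)) \<partial>M) =
         (LBINT r:{s..t}. \<integral>\<omega>. indicator B \<omega> * g (conf r \<omega>) \<partial>M)"
    unfolding 1 2 by (simp add: set_lebesgue_integral_def)
qed

section \<open>The natural filtration and Dynkin's formula\<close>

definition cyl :: "(real \<times> int \<times> opinion) list \<Rightarrow> 'a set" where
  "cyl ps = {\<omega> \<in> space M. \<forall>(r, z, a) \<in> set ps. \<eta> r z \<omega> = a}"

text \<open>The natural filtration at time \<open>s\<close>. Its generators are the cylinder events
  against which the martingale problem is tested.\<close>

definition hist :: "real \<Rightarrow> 'a measure" where
  "hist s = sigma (space M) {cyl ps |ps. \<forall>(r, z, a) \<in> set ps. 0 \<le> r \<and> r \<le> s}"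

lemma cyl_sets: "cyl ps \<in> sets M"
proof (induction ps)
  case (Cons p ps)
  have "cyl (p # ps) = {\<omega> \<in> space M. \<eta> (fst p) (fst (snd p)) \<omega> = snd (snd p)} \<inter> cyl ps"
    unfolding cyl_def by (auto simp: case_prod_unfold)
  moreover have "{\<omega> \<in> space M. \<eta> (fst p) (fst (snd p)) \<omega> = snd (snd p)} \<in> sets M" by measurable
  ultimately show ?case using Cons by auto
qed (simp add: cyl_def)

lemma cyl_in_space: "{cyl ps |ps. P ps} \<subseteq> Pow (space M)"
  by (auto simp: cyl_def)

lemma space_hist [simp]: "space (hist s) = space M"
  by (simp add: hist_def cyl_in_space)

lemma sets_hist: "sets (hist s) = sigma_sets (space M) {cyl ps |ps. \<forall>(r, z, a) \<in> set ps. 0 \<le> r \<and> r \<le> s}"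
  by (simp add: hist_def cyl_in_space)

lemma hist_sets: "B \<in> sets (hist s) \<Longrightarrow> B \<in> sets M"
  unfolding sets_hist by (rule subsetD[OF sets.sigma_sets_subset]) (use cyl_sets in auto)

lemma rv_hist: "0 \<le> r \<Longrightarrow> r \<le> s \<Longrightarrow> \<eta> r z \<in> measurable (hist s) (count_space UNIV)"
proof -
  assume r: "0 \<le> r" "r \<le> s"
  have "\<eta> r z -` {a} \<inter> space (hist s) \<in> sets (hist s)" for a
  proof -
    have "\<eta> r z -` {a} \<inter> space (hist s) = cyl [(r, z, a)]" by (auto simp: cyl_def)
    moreover have "cyl [(r, z, a)] \<in> sets (hist s)" unfolding sets_hist using r
      by (intro sigma_sets.Basic) auto
    ultimately show ?thesis by simp
  qed
  then show ?thesis unfolding measurable_count_space_eq2_countable by simp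
qed

text \<open>The increment over \<open>[s, t]\<close> of the Dynkin martingale of
  \<open>f\<close>.\<close>

definition incr :: "int set \<Rightarrow> (config \<Rightarrow> real) \<Rightarrow> real \<Rightarrow> real \<Rightarrow> 'a \<Rightarrow> real" where
  "incr D f s t \<omega> = f (conf t \<omega>) - f (conf s \<omega>) - (LBINT r:{s..t}. deffuant_gen F \<theta> D f (conf r \<omega>))"

lemma integrable_incr:
  assumes "finite D" "depends_only_on D f" "0 \<le> s"
  shows "integrable M (incr D f s t)"
  unfolding incr_def[abs_def]
  using assms fubini_local(1)[OF finite_nbhd gen_local, of D f "s" "space M"]
  by (intro Bochner_Integration.integrable_diff integrable_local[of D]) auto

text \<open>The events with vanishing integral form a Dynkin system: complements use the empty
  cylinder, which is the whole space, and countable disjoint unions use integrability of the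
  increment. Cylinders are closed under intersection, by concatenating their lists of
  constraints.\<close>

lemma martingale:
  assumes D: "finite D" "depends_only_on D f" and s: "0 \<le> s" "s \<le> t" and B: "B \<in> sets (hist s)"
  shows "(\<integral>\<omega>. indicator B \<omega> * incr D f s t \<omega> \<partial>M) = 0"
proof -
  let ?G = "{cyl ps |ps. \<forall>(r, z, a) \<in> set ps. 0 \<le> r \<and> r \<le> s}"
  note int = integrable_incr[OF D s(1), of t]
  have cylinder: "(\<integral>\<omega>. indicator (cyl ps) \<omega> * incr D f s t \<omega> \<partial>M) = 0"
    if "\<forall>(r, z, a) \<in> set ps. 0 \<le> r \<and> r \<le> s" for ps
  proof -
    have "(\<integral>\<omega>. (f (conf t \<omega>) - f (conf s \<omega>) - (LBINT r=s..t. deffuant_gen F \<theta> D f (conf r \<omega>)))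
              * indicator {\<omega>'. \<forall>(r, z, a) \<in> set ps. \<eta> r z \<omega>' = a} \<omega> \<partial>M) = 0"
      using process[unfolded deffuant_process_def, THEN conjunct2, THEN conjunct2, THEN conjunct2,
          THEN conjunct2, THEN conjunct2, THEN conjunct2] D s that by blast
    also have "(\<integral>\<omega>. (f (conf t \<omega>) - f (conf s \<omega>) - (LBINT r=s..t. deffuant_gen F \<theta> D f (conf r \<omega>)))
              * indicator {\<omega>'. \<forall>(r, z, a) \<in> set ps. \<eta> r z \<omega>' = a} \<omega> \<partial>M) =
       (\<integral>\<omega>. indicator (cyl ps) \<omega> * incr D f s t \<omega> \<partial>M)"
      by (intro Bochner_Integration.integral_cong refl)
         (auto simp: incr_def cyl_def interval_integral_Icc[OF s(2)] indicator_def)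
    finally show ?thesis .
  qed
  have total: "(\<integral>\<omega>. incr D f s t \<omega> \<partial>M) = 0"
  proof -
    have "(\<integral>\<omega>. indicator (cyl []) \<omega> * incr D f s t \<omega> \<partial>M) = (\<integral>\<omega>. incr D f s t \<omega> \<partial>M)"
      by (intro Bochner_Integration.integral_cong refl) (auto simp: cyl_def)
    then show ?thesis using cylinder[of "[]"] by simp
  qed
  have "Int_stable ?G"
  proof (rule Int_stableI)
    fix a b assume "a \<in> ?G" "b \<in> ?G"
    from \<open>a \<in> ?G\<close> obtain ps where a: "a = cyl ps" "\<forall>(r, z, a) \<in> set ps. 0 \<le> r \<and> r \<le> s"
      by blast
    from \<open>b \<in> ?G\<close> obtain qs where b: "b = cyl qs" "\<forall>(r, z, a) \<in> set qs. 0 \<le> r \<and> r \<le> s"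
      by blast
    have "a \<inter> b = cyl (ps @ qs)" unfolding a(1) b(1)
      by (rule set_eqI) (simp only: cyl_def set_append ball_Un Int_iff mem_Collect_eq, argo)
    moreover have "\<forall>(r, z, a) \<in> set (ps @ qs). 0 \<le> r \<and> r \<le> s"
      unfolding set_append ball_Un using a(2) b(2) by blast
    ultimately show "a \<inter> b \<in> ?G" by blast
  qed
  moreover have "?G \<subseteq> Pow (space M)" by (rule cyl_in_space)
  moreover have "B \<in> sigma_sets (space M) ?G" using B unfolding sets_hist .
  ultimately show ?thesis
  proof (induction rule: sigma_sets_induct_disjoint)
    case (basic A)
    then show ?case using cylinder by auto
  next
    case empty
    then show ?case by simp
  next
    case (compl A)
    have A: "A \<in> sets M" using compl(1) hist_sets unfolding sets_hist by blast
    have "(\<integral>\<omega>. indicator (space M - A) \<omega> * incr D f s t \<omega> \<partial>M) =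
          (\<integral>\<omega>. incr D f s t \<omega> - indicator A \<omega> * incr D f s t \<omega> \<partial>M)"
      by (intro Bochner_Integration.integral_cong refl) (auto simp: indicator_def)
    also have "\<dots> = 0"
      using int integrable_mult_indicator[OF A int] total compl(2)
      by (subst Bochner_Integration.integral_diff) auto
    finally show ?case .
  next
    case (union A)
    have A: "A i \<in> sets M" for i using union(2) hist_sets[of _ s] unfolding sets_hist by auto
    have "set_integrable M (\<Union>i. A i) (incr D f s t)"
      unfolding set_integrable_def using A by (intro integrable_mult_indicator int) auto
    then have "(LINT \<omega>:(\<Union>i. A i)|M. incr D f s t \<omega>) = (\<Sum>i. LINT \<omega>:A i|M. incr D f s t \<omega>)"
      using A union(1) by (intro lebesgue_integral_countable_add) (auto simp: disjoint_family_on_def)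
    then show ?case using union(3) by (simp add: set_lebesgue_integral_def)
  qed
qed

lemma dynkin_le:
  assumes D: "finite D" "depends_only_on D f" and s: "0 \<le> s" "s \<le> t" and B: "B \<in> sets (hist s)"
    and le: "\<And>r. s \<le> r \<Longrightarrow> r \<le> t \<Longrightarrow> (\<integral>\<omega>. indicator B \<omega> * deffuant_gen F \<theta> D f (conf r \<omega>) \<partial>M) \<le> K"
  shows "(\<integral>\<omega>. indicator B \<omega> * f (conf t \<omega>) \<partial>M) \<le> (\<integral>\<omega>. indicator B \<omega> * f (conf s \<omega>) \<partial>M) + K * (t - s)"
proof -
  let ?L = "\<lambda>r \<omega>. deffuant_gen F \<theta> D f (conf r \<omega>)"
  have BM: "B \<in> sets M" using B by (rule hist_sets)
  note fub = fubini_local[OF finite_nbhd[OF D(1)] gen_local[OF D(2)] s(1) BM]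
  have "0 = (\<integral>\<omega>. indicator B \<omega> * f (conf t \<omega>) - indicator B \<omega> * f (conf s \<omega>)
       - indicator B \<omega> * (LBINT r:{s..t}. ?L r \<omega>) \<partial>M)"
    using martingale[OF D s B] by (simp add: incr_def right_diff_distrib)
  also have "\<dots> = (\<integral>\<omega>. indicator B \<omega> * f (conf t \<omega>) \<partial>M) - (\<integral>\<omega>. indicator B \<omega> * f (conf s \<omega>) \<partial>M)
       - (\<integral>\<omega>. indicator B \<omega> * (LBINT r:{s..t}. ?L r \<omega>) \<partial>M)"
    using integrable_ind_local[OF D BM] integrable_mult_indicator[OF BM fub(1)]
    by (subst Bochner_Integration.integral_diff | simp)+
  finally have "(\<integral>\<omega>. indicator B \<omega> * f (conf t \<omega>) \<partial>M) - (\<integral>\<omega>. indicator B \<omega> * f (conf s \<omega>) \<partial>M) =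
       (LBINT r:{s..t}. \<integral>\<omega>. indicator B \<omega> * ?L r \<omega> \<partial>M)"
    unfolding fub(3) by simp
  also have "\<dots> \<le> (LBINT r:{s..t}. K)"
  proof (rule set_integral_mono)
    have "integrable lborel (indicator {s..t} :: real \<Rightarrow> real)"
      by (rule integrable_real_indicator) (auto simp: emeasure_lborel_Icc_eq)
    then show "set_integrable lborel {s..t} (\<lambda>r. K)" by (simp add: set_integrable_def)
  qed (use fub(2) le in auto)
  also have "\<dots> = K * (t - s)" using s by (simp add: set_lebesgue_integral_def)
  finally show ?thesis by simp
qed

end

subsection \<open>Good sites are frozen\<close>

lemma pred_local:
  fixes P :: "config \<Rightarrow> bool"
  assumes "finite D" "\<And>c c'. (\<And>z. z \<in> D \<Longrightarrow> c z = c' z) \<Longrightarrow> P c = P c'"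
    and "\<And>z. z \<in> D \<Longrightarrow> X z \<in> measurable N (count_space UNIV)"
  shows "Measurable.pred N (\<lambda>\<omega>. P (\<lambda>z. X z \<omega>))"
  using assms by (rule measurable_local)

lemma good_side_measurable:
  assumes "\<And>z. X z \<in> measurable N (count_space UNIV)"
  shows "Measurable.pred N (\<lambda>\<omega>. good_side \<theta> \<sigma> x (\<lambda>z. X z \<omega>))"
proof -
  have 1: "Measurable.pred N (\<lambda>\<omega>. (\<lambda>c. \<theta> < hamming (c x) (c (x + \<sigma>))) (\<lambda>z. X z \<omega>))"
    by (rule pred_local[of "{x, x + \<sigma>}"]) (auto simp: assms)
  have 2: "Measurable.pred N (\<lambda>\<omega>. (\<lambda>c. int k \<le> 64 * (\<Sum>i=1..k. edge_weight \<theta> (c (x + \<sigma> * int i)) (c (x + \<sigma> * int (Suc i)))) + 1)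
      (\<lambda>z. X z \<omega>))" for k
  proof (rule pred_local[of "(\<lambda>i. x + \<sigma> * int i) ` {1..Suc k}"])
    fix c c' :: config assume eq: "\<And>z. z \<in> (\<lambda>i. x + \<sigma> * int i) ` {1..Suc k} \<Longrightarrow> c z = c' z"
    have "(\<Sum>i=1..k. edge_weight \<theta> (c (x + \<sigma> * int i)) (c (x + \<sigma> * int (Suc i)))) =
          (\<Sum>i=1..k. edge_weight \<theta> (c' (x + \<sigma> * int i)) (c' (x + \<sigma> * int (Suc i))))"
      by (intro sum.cong refl arg_cong2[where f = "edge_weight \<theta>"] eq imageI) auto
    then show "(int k \<le> 64 * (\<Sum>i=1..k. edge_weight \<theta> (c (x + \<sigma> * int i)) (c (x + \<sigma> * int (Suc i)))) + 1) =
      (int k \<le> 64 * (\<Sum>i=1..k. edge_weight \<theta> (c' (x + \<sigma> * int i)) (c' (x + \<sigma> * int (Suc i)))) + 1)"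
      by simp
  qed (auto simp: assms)
  show ?thesis unfolding good_side_def using 1 2 by measurable
qed

lemma good_measurable:
  assumes "\<And>z. X z \<in> measurable N (count_space UNIV)"
  shows "Measurable.pred N (\<lambda>\<omega>. good \<theta> x (\<lambda>z. X z \<omega>))"
  unfolding good_def using good_side_measurable[OF assms] by measurable

section \<open>Legality of one grid step\<close>

lemma legal_step_cong:
  assumes c: "\<And>z. z \<in> nbhd D \<Longrightarrow> c z = d z" and c': "\<And>z. z \<in> D \<Longrightarrow> c' z = d' z"
  shows "legal_step F \<theta> D c c' = legal_step F \<theta> D d d'"
proof -
  have *: "c v = d v" "c (v - 1) = d (v - 1)" "c (v + 1) = d (v + 1)" if "v \<in> D" for v
    using c that by (auto simp: nbhd_def)
  have 1: "(\<forall>z\<in>D. c' z = c z) \<longleftrightarrow> (\<forall>z\<in>D. d' z = d z)" using * c' by simp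
  have 2: "(\<forall>z\<in>D. c' z = (c(v := u)) z) \<longleftrightarrow> (\<forall>z\<in>D. d' z = (d(v := u)) z)" for v u
    using * c' by simp
  have 3: "(\<exists>y\<in>{v - 1, v + 1}. \<exists>i<F. 1 \<le> hamming (c v) (c y) \<and> hamming (c v) (c y) \<le> \<theta> \<and>
      c v ! i \<noteq> c y ! i \<and> (\<forall>z\<in>D. c' z = (c(v := (c v)[i := c y ! i])) z)) \<longleftrightarrow>
     (\<exists>y\<in>{v - 1, v + 1}. \<exists>i<F. 1 \<le> hamming (d v) (d y) \<and> hamming (d v) (d y) \<le> \<theta> \<and>
      d v ! i \<noteq> d y ! i \<and> (\<forall>z\<in>D. d' z = (d(v := (d v)[i := d y ! i])) z))" if "v \<in> D" for v
    unfolding 2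
  proof (rule bex_cong[OF refl])
    fix y assume "y \<in> {v - 1, v + 1}"
    then have "c y = d y" using *[OF that] by auto
    then show "(\<exists>i<F. 1 \<le> hamming (c v) (c y) \<and> hamming (c v) (c y) \<le> \<theta> \<and>
        c v ! i \<noteq> c y ! i \<and> (\<forall>z\<in>D. d' z = (d(v := (c v)[i := c y ! i])) z)) \<longleftrightarrow>
      (\<exists>i<F. 1 \<le> hamming (d v) (d y) \<and> hamming (d v) (d y) \<le> \<theta> \<and>
        d v ! i \<noteq> d y ! i \<and> (\<forall>z\<in>D. d' z = (d(v := (d v)[i := d y ! i])) z))"
      by (simp only: *[OF that])
  qed
  show ?thesis unfolding legal_step_def 1 by (simp only: 3 cong: bex_cong)
qed

text \<open>As long as the state agrees with the reference \<open>a\<close> around \<open>D\<close>,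
  it is legal and so is every single update of it, so illegality has no drift. A positive rate
  arises only once some site near \<open>D\<close> has changed; that two changes are needed is the
  source of the quadratic bound.\<close>

lemma gen_illegal:
  assumes D: "finite D" and len: "\<And>z. length (c z) = F"
  shows "deffuant_gen F \<theta> D (\<lambda>c'. of_bool (\<not> legal_step F \<theta> D a c')) c
    \<le> real (card D) * of_bool (\<exists>z\<in>nbhd D. c z \<noteq> a z)"
proof (cases "\<exists>z\<in>nbhd D. c z \<noteq> a z")
  case True
  then show ?thesis using gen_le_card[OF D, of "\<lambda>c'. of_bool (\<not> legal_step F \<theta> D a c')" c F \<theta>] len by simp
next
  case False
  then have eq: "\<And>z. z \<in> nbhd D \<Longrightarrow> a z = c z" by auto
  have "legal_step F \<theta> D c c" by (simp add: legal_step_def)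
  then have 0: "legal_step F \<theta> D a c" using legal_step_cong[OF eq, where c' = c and d' = c] by simp
  have 1: "legal_step F \<theta> D a (c(v := (c v)[i := c y ! i]))"
    if "v \<in> D" "y \<in> {v - 1, v + 1}" "1 \<le> hamming (c v) (c y)" "hamming (c v) (c y) \<le> \<theta>"
      "i < F" "c v ! i \<noteq> c y ! i" for v y i
  proof -
    have "legal_step F \<theta> D c (c(v := (c v)[i := c y ! i]))"
      unfolding legal_step_def using that by blast
    then show ?thesis
      using legal_step_cong[OF eq, where c' = "c(v := (c v)[i := c y ! i])" and d' = "c(v := (c v)[i := c y ! i])"]
      by simp
  qed
  have "deffuant_gen F \<theta> D (\<lambda>c'. of_bool (\<not> legal_step F \<theta> D a c')) c = 0"
    unfolding deffuant_gen_def
  proof (intro sum.neutral ballI)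
    fix v y assume v: "v \<in> D" "y \<in> {v - 1, v + 1}"
    have "(\<Sum>i\<in>{i. i < F \<and> c v ! i \<noteq> c y ! i}.
        of_bool (\<not> legal_step F \<theta> D a (c(v := (c v)[i := c y ! i]))) -
        of_bool (\<not> legal_step F \<theta> D a c) :: real) = 0"
      if "1 \<le> hamming (c v) (c y)" "hamming (c v) (c y) \<le> \<theta>"
    proof (intro sum.neutral ballI)
      fix i assume "i \<in> {i. i < F \<and> c v ! i \<noteq> c y ! i}"
      then show "of_bool (\<not> legal_step F \<theta> D a (c(v := (c v)[i := c y ! i]))) -
        of_bool (\<not> legal_step F \<theta> D a c) = (0 :: real)" using 0 1[OF v that] by simp
    qed
    then show "(if 1 \<le> hamming (c v) (c y) \<and> hamming (c v) (c y) \<le> \<theta>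
         then 1 / 2 * (1 / real (hamming (c v) (c y))) *
              (\<Sum>i\<in>{i. i < F \<and> c v ! i \<noteq> c y ! i}.
                  of_bool (\<not> legal_step F \<theta> D a (c(v := (c v)[i := c y ! i]))) -
                  of_bool (\<not> legal_step F \<theta> D a c)) else 0 :: real) = 0" by simp
  qed
  then show ?thesis by simp
qed

context deffuant
begin

text \<open>Stands in for conditioning on the state at time \<open>s\<close>. A test function of the
  martingale problem sees one time only, so a comparison with the state at time \<open>s\<close> is
  made on each of the finitely many events where that state equals a fixed \<open>a\<close> on
  \<open>E\<close>.\<close>

definition pattern :: "real \<Rightarrow> int set \<Rightarrow> config \<Rightarrow> 'a set" where
  "pattern s E a = {\<omega> \<in> space M. \<forall>z\<in>E. \<eta> s z \<omega> = a z}"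

lemma pattern_hist: 
  assumes "finite E" "0 \<le> r" "r \<le> s" 
  shows "pattern r E a \<in> sets (hist s)"
proof -
  have "Measurable.pred (hist s) (\<lambda>\<omega>. (\<lambda>c. \<forall>z\<in>E. c z = a z) (conf r \<omega>))"
    using assms by (intro pred_local[of E] rv_hist) auto
  then show ?thesis unfolding pattern_def pred_def by simp
qed

lemma integral_ind_le:
  assumes D: "finite D" "depends_only_on D g" and B: "B \<in> sets M"
    and le: "\<And>\<omega>. \<omega> \<in> B \<Longrightarrow> g (conf r \<omega>) \<le> K"
  shows "(\<integral>\<omega>. indicator B \<omega> * g (conf r \<omega>) \<partial>M) \<le> K * prob B"
proof -
  have "(\<integral>\<omega>. indicator B \<omega> * g (conf r \<omega>) \<partial>M) \<le> (\<integral>\<omega>. K * indicator B \<omega> \<partial>M)"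
  proof (rule integral_mono)
    show "integrable M (\<lambda>\<omega>. K * indicator B \<omega>)"
      using B by (intro integrable_mult_right integrable_real_indicator) (auto simp: less_top[symmetric])
    show "indicator B \<omega> * g (conf r \<omega>) \<le> K * indicator B \<omega>" for \<omega>
      using le by (simp add: indicator_def)
  qed (rule integrable_ind_local[OF D B])
  also have "\<dots> = K * prob B" using B by simp
  finally show ?thesis .
qed

lemma change_integral_le:
  assumes E: "finite E" and s: "0 \<le> s" "s \<le> t" and B: "B \<in> sets (hist s)" "B \<subseteq> pattern s E a"
  shows "(\<integral>\<omega>. indicator B \<omega> * of_bool (\<exists>z\<in>E. \<eta> t z \<omega> \<noteq> a z) \<partial>M) \<le> real (card E) * prob B * (t - s)"
proof -
  define f where "f c = (of_bool (\<exists>z\<in>E. c z \<noteq> a z) :: real)" for c :: config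
  have f: "depends_only_on E f" unfolding f_def by (rule depends_only_onI) auto
  have BM: "B \<in> sets M" using B(1) by (rule hist_sets)
  have "(\<integral>\<omega>. indicator B \<omega> * f (conf t \<omega>) \<partial>M) \<le>
      (\<integral>\<omega>. indicator B \<omega> * f (conf s \<omega>) \<partial>M) + (real (card E) * prob B) * (t - s)"
  proof (rule dynkin_le[OF E f s B(1)])
    show "(\<integral>\<omega>. indicator B \<omega> * deffuant_gen F \<theta> E f (conf r \<omega>) \<partial>M) \<le> real (card E) * prob B" for r
    proof (rule integral_ind_le[OF finite_nbhd[OF E] gen_local[OF f] BM])
      fix \<omega> assume "\<omega> \<in> B"
      then have "\<omega> \<in> space M" using sets.sets_into_space[OF BM] by blast
      then show "deffuant_gen F \<theta> E f (conf r \<omega>) \<le> real (card E)"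
        by (intro gen_le_card[OF E]) (auto simp: f_def)
    qed
  qed
  also have "(\<integral>\<omega>. indicator B \<omega> * f (conf s \<omega>) \<partial>M) = (\<integral>\<omega>. 0 \<partial>M)"
    using B(2) by (intro Bochner_Integration.integral_cong refl) (auto simp: f_def pattern_def indicator_def)
  finally show ?thesis by (simp add: f_def)
qed

lemma integral_patterns:
  fixes h :: "'a \<Rightarrow> real"
  assumes E: "finite E" and h: "integrable M h" and s: "0 \<le> s"
  shows "(\<integral>\<omega>. h \<omega> \<partial>M) = (\<Sum>a\<in>PiE E (\<lambda>_. opinions F). \<integral>\<omega>. indicator (pattern s E a) \<omega> * h \<omega> \<partial>M)"
proof -
  let ?A = "PiE E (\<lambda>_. opinions F)"
  have A: "finite ?A" by (intro finite_PiE E finite_opinions)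
  have P: "pattern s E a \<in> sets M" for a using pattern_hist[OF E s order_refl] by (rule hist_sets)
  have "(\<Sum>a\<in>?A. indicator (pattern s E a) \<omega> * h \<omega>) = h \<omega>" if \<omega>: "\<omega> \<in> space M" for \<omega>
  proof -
    have r: "restrict (conf s \<omega>) E \<in> ?A" using \<omega> by (auto simp: opinions_def)
    have "indicator (pattern s E a) \<omega> = (of_bool (a = restrict (conf s \<omega>) E) :: real)" if "a \<in> ?A" for a
      using that \<omega> by (auto simp: pattern_def indicator_def PiE_def extensional_def restrict_def fun_eq_iff)
        metis
    then have "(\<Sum>a\<in>?A. indicator (pattern s E a) \<omega> * h \<omega>) =
        (\<Sum>a\<in>?A. if a = restrict (conf s \<omega>) E then h \<omega> else 0)"
      by (intro sum.cong) auto
    then show ?thesis using A r by simp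
  qed
  then have "(\<integral>\<omega>. h \<omega> \<partial>M) = (\<integral>\<omega>. (\<Sum>a\<in>?A. indicator (pattern s E a) \<omega> * h \<omega>) \<partial>M)"
    by (intro Bochner_Integration.integral_cong) auto
  also have "\<dots> = (\<Sum>a\<in>?A. \<integral>\<omega>. indicator (pattern s E a) \<omega> * h \<omega> \<partial>M)"
    using integrable_mult_indicator[OF P h] by (intro Bochner_Integration.integral_sum) simp
  finally show ?thesis .
qed

lemma sum_prob_patterns:
  assumes "finite E" "0 \<le> s"
  shows "(\<Sum>a\<in>PiE E (\<lambda>_. opinions F). prob (pattern s E a)) = 1"
proof -
  have "pattern s E a \<in> sets M" for a using pattern_hist[OF assms order_refl] by (rule hist_sets)
  then show ?thesis using integral_patterns[OF assms(1) _ assms(2), of "\<lambda>_. 1"] by (simp add: prob_space)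
qed

lemma pred_two_times:
  assumes E: "finite E" and s: "0 \<le> s" and D: "finite D"
    and P: "\<And>c c' d d'. (\<And>z. z \<in> E \<Longrightarrow> c z = d z) \<Longrightarrow> (\<And>z. z \<in> D \<Longrightarrow> c' z = d' z) \<Longrightarrow> P c c' = P d d'"
  shows "Measurable.pred M (\<lambda>\<omega>. P (conf s \<omega>) (conf t \<omega>))"
proof -
  have [measurable]: "pattern s E a \<in> sets M" for a using pattern_hist[OF E s order_refl] by (rule hist_sets)
  have [measurable]: "Measurable.pred M (\<lambda>\<omega>. P a (conf t \<omega>))" for a
    by (rule pred_local[OF D], rule P, auto)
  have fin: "finite (PiE E (\<lambda>_. opinions F))" by (intro finite_PiE E finite_opinions)
  have "P (conf s \<omega>) (conf t \<omega>) \<longleftrightarrow> (\<exists>a\<in>PiE E (\<lambda>_. opinions F). \<omega> \<in> pattern s E a \<and> P a (conf t \<omega>))"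
    if \<omega>: "\<omega> \<in> space M" for \<omega>
  proof
    assume "P (conf s \<omega>) (conf t \<omega>)"
    moreover have "P (conf s \<omega>) (conf t \<omega>) = P (restrict (conf s \<omega>) E) (conf t \<omega>)" by (rule P) auto
    moreover have "restrict (conf s \<omega>) E \<in> PiE E (\<lambda>_. opinions F)" "\<omega> \<in> pattern s E (restrict (conf s \<omega>) E)"
      using \<omega> by (auto simp: opinions_def pattern_def)
    ultimately show "\<exists>a\<in>PiE E (\<lambda>_. opinions F). \<omega> \<in> pattern s E a \<and> P a (conf t \<omega>)" by blast
  next
    assume "\<exists>a\<in>PiE E (\<lambda>_. opinions F). \<omega> \<in> pattern s E a \<and> P a (conf t \<omega>)"
    then obtain a where "\<omega> \<in> pattern s E a" "P a (conf t \<omega>)" by blast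
    moreover have "P (conf s \<omega>) (conf t \<omega>) = P a (conf t \<omega>)"
      using \<open>\<omega> \<in> pattern s E a\<close> by (intro P) (auto simp: pattern_def)
    ultimately show "P (conf s \<omega>) (conf t \<omega>)" by simp
  qed
  moreover have "Measurable.pred M (\<lambda>\<omega>. \<exists>a\<in>PiE E (\<lambda>_. opinions F). \<omega> \<in> pattern s E a \<and> P a (conf t \<omega>))"
    using fin by measurable
  ultimately show ?thesis by (subst measurable_cong) auto
qed

lemma pred_legal_step:
  assumes "finite D" "0 \<le> s"
  shows "Measurable.pred M (\<lambda>\<omega>. legal_step F \<theta> D (conf s \<omega>) (conf t \<omega>))"
  by (rule pred_two_times[OF finite_nbhd[OF assms(1)] assms(2,1)]) (rule legal_step_cong)

text \<open>Dynkin's formula is applied twice on each pattern of \<open>nbhd D\<close>: the chance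
  that this neighbourhood has changed by time \<open>r\<close> is at most its size times
  \<open>r - s\<close>, and this chance times \<open>card D\<close> bounds the drift of
  illegality.\<close>

lemma prob_illegal_le:
  assumes D: "finite D" and s: "0 \<le> s" "s \<le> t"
  shows "prob {\<omega> \<in> space M. \<not> legal_step F \<theta> D (conf s \<omega>) (conf t \<omega>)} \<le> real (card D) * real (card (nbhd D)) * (t - s)\<^sup>2"
proof -
  let ?E = "nbhd D" and ?C = "real (card D) * real (card (nbhd D))"
  have E: "finite ?E" using D by (rule finite_nbhd)
  note [measurable] = pred_legal_step[OF D s(1)]
  define h where "h \<omega> = (of_bool (\<not> legal_step F \<theta> D (conf s \<omega>) (conf t \<omega>)) :: real)" for \<omega>
  have "h \<in> borel_measurable M" unfolding h_def[abs_def] by measurable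
  then have h: "integrable M h"
    by (intro integrable_const_bound[of _ 1]) (auto simp: h_def)
  have part: "(\<integral>\<omega>. indicator (pattern s ?E a) \<omega> * h \<omega> \<partial>M) \<le> ?C * (t - s)\<^sup>2 * prob (pattern s ?E a)" for a
  proof -
    let ?B = "pattern s ?E a"
    define f where "f c' = (of_bool (\<not> legal_step F \<theta> D a c') :: real)" for c' :: config
    have f: "depends_only_on D f" unfolding f_def
      by (rule depends_only_onI) (simp cong: legal_step_cong)
    have B: "?B \<in> sets (hist s)" using pattern_hist[OF E s(1) order_refl] .
    then have BM: "?B \<in> sets M" by (rule hist_sets)
    have "(\<integral>\<omega>. indicator ?B \<omega> * f (conf t \<omega>) \<partial>M) \<le>
        (\<integral>\<omega>. indicator ?B \<omega> * f (conf s \<omega>) \<partial>M) + (?C * (t - s) * prob ?B) * (t - s)"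
    proof (rule dynkin_le[OF D f s B])
      fix r assume r: "s \<le> r" "r \<le> t"
      define g where "g c = (of_bool (\<exists>z\<in>?E. c z \<noteq> a z) :: real)" for c :: config
      have g: "depends_only_on ?E g" unfolding g_def by (rule depends_only_onI) auto
      have "(\<integral>\<omega>. indicator ?B \<omega> * deffuant_gen F \<theta> D f (conf r \<omega>) \<partial>M) \<le>
            (\<integral>\<omega>. real (card D) * (indicator ?B \<omega> * g (conf r \<omega>)) \<partial>M)"
      proof (rule integral_mono)
        show "integrable M (\<lambda>\<omega>. indicator ?B \<omega> * deffuant_gen F \<theta> D f (conf r \<omega>))"
          by (rule integrable_ind_local[OF E gen_local[OF f] BM])
        show "integrable M (\<lambda>\<omega>. real (card D) * (indicator ?B \<omega> * g (conf r \<omega>)))"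
          by (intro integrable_mult_right integrable_ind_local[OF E g BM])
        fix \<omega> assume "\<omega> \<in> space M"
        then show "indicator ?B \<omega> * deffuant_gen F \<theta> D f (conf r \<omega>) \<le> real (card D) * (indicator ?B \<omega> * g (conf r \<omega>))"
          using gen_illegal[OF D, of "conf r \<omega>" F \<theta> a] by (simp add: f_def[abs_def] g_def indicator_def)
      qed
      also have "\<dots> = real (card D) * (\<integral>\<omega>. indicator ?B \<omega> * g (conf r \<omega>) \<partial>M)"
        by (rule integral_mult_right_zero)
      also have "\<dots> \<le> real (card D) * (real (card ?E) * prob ?B * (r - s))"
        unfolding g_def using r s by (intro mult_left_mono change_integral_le[OF E s(1) r(1) B]) auto
      also have "\<dots> \<le> real (card D) * (real (card ?E) * prob ?B * (t - s))"
        using r by (intro mult_left_mono) auto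
      finally show "(\<integral>\<omega>. indicator ?B \<omega> * deffuant_gen F \<theta> D f (conf r \<omega>) \<partial>M) \<le> ?C * (t - s) * prob ?B"
        by (simp add: mult_ac)
    qed
    also have "(\<integral>\<omega>. indicator ?B \<omega> * f (conf s \<omega>) \<partial>M) = (\<integral>\<omega>. 0 \<partial>M)"
    proof (intro Bochner_Integration.integral_cong refl)
      fix \<omega> assume "\<omega> \<in> space M"
      have "f (conf s \<omega>) = 0" if "\<omega> \<in> ?B"
      proof -
        have "legal_step F \<theta> D a (conf s \<omega>) = legal_step F \<theta> D (conf s \<omega>) (conf s \<omega>)"
          using that by (intro legal_step_cong) (auto simp: pattern_def)
        then show ?thesis by (simp add: f_def legal_step_def)
      qed
      then show "indicator ?B \<omega> * f (conf s \<omega>) = 0" by (simp add: indicator_def)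
    qed
    also have "(\<integral>\<omega>. indicator ?B \<omega> * f (conf t \<omega>) \<partial>M) = (\<integral>\<omega>. indicator ?B \<omega> * h \<omega> \<partial>M)"
    proof (intro Bochner_Integration.integral_cong refl)
      fix \<omega> assume "\<omega> \<in> space M"
      have "f (conf t \<omega>) = h \<omega>" if "\<omega> \<in> ?B"
      proof -
        have "legal_step F \<theta> D a (conf t \<omega>) = legal_step F \<theta> D (conf s \<omega>) (conf t \<omega>)"
          using that by (intro legal_step_cong) (auto simp: pattern_def)
        then show ?thesis by (simp add: f_def h_def)
      qed
      then show "indicator ?B \<omega> * f (conf t \<omega>) = indicator ?B \<omega> * h \<omega>" by (simp add: indicator_def)
    qed
    finally show ?thesis by (simp add: power2_eq_square mult_ac)
  qed
  have "prob {\<omega> \<in> space M. \<not> legal_step F \<theta> D (conf s \<omega>) (conf t \<omega>)} =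
      (\<integral>\<omega>. indicator {\<omega> \<in> space M. \<not> legal_step F \<theta> D (conf s \<omega>) (conf t \<omega>)} \<omega> \<partial>M)" by simp
  also have "\<dots> = (\<integral>\<omega>. h \<omega> \<partial>M)"
    by (intro Bochner_Integration.integral_cong refl) (auto simp: h_def indicator_def)
  also have "\<dots> \<le> (\<Sum>a\<in>PiE ?E (\<lambda>_. opinions F). ?C * (t - s)\<^sup>2 * prob (pattern s ?E a))"
    unfolding integral_patterns[OF E h s(1)] by (intro sum_mono part)
  also have "\<dots> = ?C * (t - s)\<^sup>2"
    using sum_prob_patterns[OF E s(1)] by (simp add: sum_distrib_left[symmetric])
  finally show ?thesis .
qed

lemma prob_flip_le:
  assumes s: "0 \<le> s" "s \<le> t"
  shows "prob {\<omega> \<in> space M. \<eta> t x \<omega> \<noteq> \<eta> s x \<omega>} \<le> t - s"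
proof -
  define h where "h \<omega> = (of_bool (\<eta> t x \<omega> \<noteq> \<eta> s x \<omega>) :: real)" for \<omega>
  have "h \<in> borel_measurable M" unfolding h_def[abs_def] by measurable
  then have h: "integrable M h"
    by (intro integrable_const_bound[of _ 1]) (auto simp: h_def)
  have part: "(\<integral>\<omega>. indicator (pattern s {x} a) \<omega> * h \<omega> \<partial>M) \<le> (t - s) * prob (pattern s {x} a)" for a
  proof -
    let ?B = "pattern s {x} a"
    have B: "?B \<in> sets (hist s)" using s by (intro pattern_hist) auto
    have "(\<integral>\<omega>. indicator ?B \<omega> * of_bool (\<exists>z\<in>{x}. \<eta> t z \<omega> \<noteq> a z) \<partial>M) \<le> real (card {x}) * prob ?B * (t - s)"
      by (rule change_integral_le[OF _ s B]) auto
    also have "(\<integral>\<omega>. indicator ?B \<omega> * of_bool (\<exists>z\<in>{x}. \<eta> t z \<omega> \<noteq> a z) \<partial>M) = (\<integral>\<omega>. indicator ?B \<omega> * h \<omega> \<partial>M)"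
      by (intro Bochner_Integration.integral_cong refl) (auto simp: h_def pattern_def indicator_def)
    finally show ?thesis by (simp add: mult_ac)
  qed
  have "prob {\<omega> \<in> space M. \<eta> t x \<omega> \<noteq> \<eta> s x \<omega>} =
      (\<integral>\<omega>. indicator {\<omega> \<in> space M. \<eta> t x \<omega> \<noteq> \<eta> s x \<omega>} \<omega> \<partial>M)" by simp
  also have "\<dots> = (\<integral>\<omega>. h \<omega> \<partial>M)"
    by (intro Bochner_Integration.integral_cong refl) (auto simp: h_def indicator_def)
  also have "\<dots> \<le> (\<Sum>a\<in>PiE {x} (\<lambda>_. opinions F). (t - s) * prob (pattern s {x} a))"
    unfolding integral_patterns[OF finite.intros(2)[OF finite.intros(1)] h s(1), of x] by (intro sum_mono part)
  also have "\<dots> = t - s"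
    using sum_prob_patterns[of "{x}" s] s by (simp add: sum_distrib_left[symmetric])
  finally show ?thesis .
qed

text \<open>Each grid step flips \<open>x\<close> with probability at most its length, so the
  expected number of flips is at most \<open>t\<close> for every mesh, and Markov's inequality gives
  a bound free of \<open>n\<close>.\<close>

lemma prob_many_flips_le:
  assumes t: "0 \<le> t" and n: "0 < n" and b: "0 < b"
  shows "prob {\<omega> \<in> space M. b \<le> real (card {m. m < n \<and> \<eta> (t * real (Suc m) / n) x \<omega> \<noteq> \<eta> (t * real m / n) x \<omega>})} \<le> t / b"
proof -
  define h where "h \<omega> = real (card {m. m < n \<and> \<eta> (t * real (Suc m) / n) x \<omega> \<noteq> \<eta> (t * real m / n) x \<omega>})" for \<omega>
  define A where "A m = {\<omega> \<in> space M. \<eta> (t * real (Suc m) / n) x \<omega> \<noteq> \<eta> (t * real m / n) x \<omega>}" for m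
  have [measurable]: "A m \<in> sets M" for m unfolding A_def by measurable
  have hA: "h \<omega> = (\<Sum>m<n. indicator (A m) \<omega>)" if "\<omega> \<in> space M" for \<omega>
  proof -
    have "(\<Sum>m<n. indicator (A m) \<omega>) = (\<Sum>m<n. if \<eta> (t * real (Suc m) / n) x \<omega> \<noteq> \<eta> (t * real m / n) x \<omega> then 1 else 0 :: real)"
      using that by (intro sum.cong) (auto simp: A_def)
    also have "\<dots> = h \<omega>" unfolding h_def
      by (subst sum.If_cases) (auto intro!: arg_cong[where f = card])
    finally show ?thesis by simp
  qed
  have int: "integrable M h"
    by (subst Bochner_Integration.integrable_cong[OF refl hA])
       (auto intro!: Bochner_Integration.integrable_sum integrable_real_indicator simp: less_top[symmetric])
  have "(\<integral>\<omega>. h \<omega> \<partial>M) = (\<integral>\<omega>. (\<Sum>m<n. indicator (A m) \<omega>) \<partial>M)"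
    using hA by (intro Bochner_Integration.integral_cong) auto
  also have "\<dots> = (\<Sum>m<n. prob (A m))"
    by (subst Bochner_Integration.integral_sum)
       (auto intro!: integrable_real_indicator simp: less_top[symmetric])
  also have "\<dots> \<le> (\<Sum>m<n. t / n)"
  proof (rule sum_mono)
    fix m
    have "prob (A m) \<le> t * real (Suc m) / n - t * real m / n"
      unfolding A_def using t n by (intro prob_flip_le) (auto simp: field_simps)
    then show "prob (A m) \<le> t / n" using n by (simp add: field_simps)
  qed
  also have "\<dots> = t" using n by simp
  finally have E: "(\<integral>\<omega>. h \<omega> \<partial>M) \<le> t" .
  have "prob {\<omega> \<in> space M. b \<le> h \<omega>} \<le> (\<integral>\<omega>. h \<omega> \<partial>M) / b"
  proof (rule integral_Markov_inequality_measure[where A = "space M"])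
    show "integrable M h" by (rule int)
  qed (use b in \<open>auto simp: h_def\<close>)
  also have "\<dots> \<le> t / b" using E b by (simp add: divide_right_mono)
  finally show ?thesis unfolding h_def .
qed

text \<open>The failure event mentions neither mesh nor box. The illegal steps cost \<open>n\<close>
  times a term of order \<open>1 / n^2\<close> and disappear for large \<open>n\<close> with
  \<open>k\<close> fixed; the two far sites cost \<open>128 * t / (k - 1)\<close> and disappear for
  large \<open>k\<close>.\<close>

lemma freeze:
  assumes t: "0 \<le> t"
  shows "AE \<omega> in M. good \<theta> x (conf 0 \<omega>) \<longrightarrow> \<eta> t x \<omega> = \<eta> 0 x \<omega> \<and>
    \<theta> < hamming (\<eta> t x \<omega>) (\<eta> t (x + 1) \<omega>) \<and> \<theta> < hamming (\<eta> t x \<omega>) (\<eta> t (x - 1) \<omega>)"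
proof -
  define Q where "Q c c' \<longleftrightarrow> c' x = c x \<and> \<theta> < hamming (c' x) (c' (x + 1)) \<and> \<theta> < hamming (c' x) (c' (x - 1))"
    for c c' :: config
  have [measurable]: "Measurable.pred M (\<lambda>\<omega>. Q (conf 0 \<omega>) (conf t \<omega>))"
    by (rule pred_two_times[of "{x}" 0 "{x - 1, x, x + 1}"]) (auto simp: Q_def)
  have [measurable]: "Measurable.pred M (\<lambda>\<omega>. good \<theta> x (conf 0 \<omega>))"
    by (rule good_measurable) measurable
  define Bad where "Bad = {\<omega> \<in> space M. good \<theta> x (conf 0 \<omega>) \<and> \<not> Q (conf 0 \<omega>) (conf t \<omega>)}"
  have Bad [measurable]: "Bad \<in> sets M" unfolding Bad_def by measurable
  have bound: "prob Bad \<le> (real (card {x - int k - 1 .. x + int k + 1}) * real (card (nbhd {x - int k - 1 .. x + int k + 1})) * t\<^sup>2)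
      * (1 / real n) + 128 * t * (1 / (real k - 1))" if n: "0 < n" and k: "2 < k" for n k
  proof -
    let ?D = "{x - int k - 1 .. x + int k + 1}" and ?T = "\<lambda>m. t * real m / n"
    \<comment> \<open>An integer count \<open>N\<close> below \<open>(k - 1) / 64\<close> satisfies
      \<open>64 * N \<le> k - 2\<close>, the bound required by \<open>blockade\<close>. The two
      sides together give the factor \<open>128\<close>.\<close>
    let ?C = "real (card ?D) * real (card (nbhd ?D))" and ?b = "(real k - 1) / 64"
    define I where "I m = {\<omega> \<in> space M. \<not> legal_step F \<theta> ?D (conf (?T m) \<omega>) (conf (?T (Suc m)) \<omega>)}" for m
    define J where "J \<sigma> = {\<omega> \<in> space M. ?b \<le> 
       real (card {m. m < n \<and> \<eta> (?T (Suc m)) (x + \<sigma> * int k) \<omega> \<noteq> \<eta> (?T m) (x + \<sigma> * int k) \<omega>})}" for \<sigma> :: int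
    have Tnn: "0 \<le> ?T m" for m using t by simp
    have [measurable]: "I m \<in> sets M" for m
      using pred_legal_step[OF _ Tnn, of ?D m] unfolding I_def by measurable
    have [measurable]: "J \<sigma> \<in> sets M" for \<sigma> unfolding J_def by measurable
    have "Bad \<subseteq> (\<Union>m<n. I m) \<union> (J 1 \<union> J (-1))"
    proof (rule ccontr)
      assume "\<not> Bad \<subseteq> (\<Union>m<n. I m) \<union> (J 1 \<union> J (-1))"
      then obtain \<omega> where \<omega>: "\<omega> \<in> Bad" "\<And>m. m < n \<Longrightarrow> \<omega> \<notin> I m" "\<omega> \<notin> J 1" "\<omega> \<notin> J (-1)" by blast
      then have sp: "\<omega> \<in> space M" and gd: "good \<theta> x (conf 0 \<omega>)" by (auto simp: Bad_def)
      define c where "c m = conf (?T m) \<omega>" for m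
      have "c n x = c 0 x \<and> \<theta> < hamming (c n x) (c n (x + 1)) \<and> \<theta> < hamming (c n x) (c n (x - 1))"
      proof (rule blockade[where F = F and n = n and D = ?D and k = k])
        show "length (c m z) = F" for m z using sp by (simp add: c_def)
        show "legal_step F \<theta> ?D (c m) (c (Suc m))" if "m < n" for m
          using \<omega>(2)[OF that] sp by (simp add: I_def c_def)
        show "good \<theta> x (c 0)" using gd by (simp add: c_def)
        show "64 * int (card {m. m < n \<and> c (Suc m) (x + \<sigma> * int k) \<noteq> c m (x + \<sigma> * int k)}) \<le> int k - 2"
          if "\<sigma> \<in> {1, -1}" for \<sigma>
        proof -
          define N where "N = card {m. m < n \<and> c (Suc m) (x + \<sigma> * int k) \<noteq> c m (x + \<sigma> * int k)}"
          have "\<omega> \<notin> J \<sigma>" using that \<omega>(3,4) by auto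
          then have "real N < ?b" using sp by (simp add: J_def c_def N_def)
          then have "real (64 * N + 1) < real k" by simp
          then have "64 * N + 1 < k" by (simp only: of_nat_less_iff)
          then show ?thesis unfolding N_def[symmetric] by linarith
        qed
      qed (use k in auto)
      then have "Q (c 0) (c n)" unfolding Q_def .
      moreover have "c n = conf t \<omega>" "c 0 = conf 0 \<omega>" using n by (simp_all add: c_def)
      ultimately show False using \<omega>(1) by (simp add: Bad_def)
    qed
    then have "prob Bad \<le> prob ((\<Union>m<n. I m) \<union> (J 1 \<union> J (-1)))"
      by (rule finite_measure_mono) measurable
    also have "\<dots> \<le> prob (\<Union>m<n. I m) + prob (J 1 \<union> J (-1))"
      by (rule measure_Un_le) measurable
    finally have 1: "prob Bad \<le> prob (\<Union>m<n. I m) + prob (J 1 \<union> J (-1))" .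
    have 2: "prob (J 1 \<union> J (-1)) \<le> prob (J 1) + prob (J (-1))"
      by (rule measure_Un_le) measurable
    have "prob (\<Union>m<n. I m) \<le> (\<Sum>m<n. prob (I m))"
      by (rule measure_UNION_le) auto
    also have "\<dots> \<le> (\<Sum>m<n. ?C * (t / n)\<^sup>2)"
    proof (rule sum_mono)
      fix m
      have "prob (I m) \<le> ?C * (?T (Suc m) - ?T m)\<^sup>2"
        unfolding I_def using t n by (intro prob_illegal_le) (auto simp: field_simps)
      also have "?T (Suc m) - ?T m = t / n" using n by (simp add: field_simps)
      finally show "prob (I m) \<le> ?C * (t / n)\<^sup>2" .
    qed
    also have "\<dots> = ?C * t\<^sup>2 * (1 / n)"
      using n by (simp add: power_divide power2_eq_square)
    finally have "prob Bad \<le> ?C * t\<^sup>2 * (1 / n) + (prob (J 1) + prob (J (-1)))"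
      using 1 2 by linarith
    moreover have "prob (J \<sigma>) \<le> t / ?b" for \<sigma>
      unfolding J_def using t n k by (intro prob_many_flips_le) auto
    from this[of 1] this[of "-1"] have "prob (J 1) + prob (J (-1)) \<le> t / ?b + t / ?b" by linarith
    moreover have "t / ?b + t / ?b = 128 * t * (1 / (real k - 1))" by simp
    ultimately show ?thesis by linarith
  qed
  have "prob Bad \<le> 128 * t * (1 / (real k - 1))" if k: "2 < k" for k
  proof (rule LIMSEQ_le_const)
    let ?C = "real (card {x - int k - 1 .. x + int k + 1}) * real (card (nbhd {x - int k - 1 .. x + int k + 1})) * t\<^sup>2"
    have "(\<lambda>n. ?C * (1 / real n) + 128 * t * (1 / (real k - 1))) \<longlonglongrightarrow> ?C * 0 + 128 * t * (1 / (real k - 1))"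
      by (intro tendsto_intros lim_1_over_n)
    then show "(\<lambda>n. ?C * (1 / real n) + 128 * t * (1 / (real k - 1))) \<longlonglongrightarrow> 128 * t * (1 / (real k - 1))" by simp
    show "\<exists>N. \<forall>n\<ge>N. prob Bad \<le> ?C * (1 / real n) + 128 * t * (1 / (real k - 1))"
      using bound[OF _ k] by (intro exI[of _ 1]) auto
  qed
  then have "prob Bad \<le> 0"
  proof (intro LIMSEQ_le_const)
    have "(\<lambda>k. 128 * t * (1 / (real k - 1))) \<longlonglongrightarrow> 128 * t * 0"
    proof (intro tendsto_intros)
      show "(\<lambda>k. 1 / (real k - 1)) \<longlonglongrightarrow> 0"
      proof (rule LIMSEQ_imp_Suc)
        show "(\<lambda>k. 1 / (real (Suc k) - 1)) \<longlonglongrightarrow> 0" using lim_1_over_n[where 'a = real] by simp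
      qed
    qed
    then show "(\<lambda>k. 128 * t * (1 / (real k - 1))) \<longlonglongrightarrow> 0" by simp
    show "\<exists>N. \<forall>n\<ge>N. prob Bad \<le> 128 * t * (1 / (real n - 1))" if "\<And>k. 2 < k \<Longrightarrow> prob Bad \<le> 128 * t * (1 / (real k - 1))"
      using that by (intro exI[of _ 3]) auto
  qed
  then have "prob Bad = 0" using measure_nonneg[of M Bad] by linarith
  then have "AE \<omega> in M. \<omega> \<notin> Bad" using prob_eq_0[OF Bad] by simp
  with AE_space show ?thesis
    by eventually_elim (auto simp: Bad_def Q_def)
qed

end

subsection \<open>Fixation between good sites\<close>

text \<open>A particle on edge \<open>j\<close> weighs \<open>(j - y) * (z - j)\<close>, the mean
  exit time of simple random walk started at \<open>j\<close> from the interval between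
  \<open>y\<close> and \<open>z\<close>.\<close>

definition potential :: "int \<Rightarrow> int \<Rightarrow> config \<Rightarrow> real" where
  "potential y z c = (\<Sum>j\<in>{y..<z}. real_of_int ((j - y) * (z - j)) * real (hamming (c j) (c (j + 1))))"

lemma potential_nonneg: "0 \<le> potential y z c"
  unfolding potential_def by (intro sum_nonneg mult_nonneg_nonneg) auto

lemma potential_local: "depends_only_on {y..z} (potential y z)"
proof (rule depends_only_onI)
  fix c c' :: config assume eq: "\<And>v. v \<in> {y..z} \<Longrightarrow> c v = c' v"
  show "potential y z c = potential y z c'"
    unfolding potential_def by (intro sum.cong refl) (simp add: eq)
qed

text \<open>The flip takes a particle off the edge towards \<open>u\<close> and puts it on the other
  edge at \<open>v\<close>; if it annihilates there, the potential is smaller still because the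
  weights are nonnegative.\<close>

lemma potential_flip_le:
  assumes v: "y < v" "v < z" and i: "i < F" "c v ! i \<noteq> c u ! i"
    and u: "u = v + 1 \<or> u = v - 1" and len: "\<And>z. length (c z) = F"
  shows "potential y z (c(v := (c v)[i := c u ! i])) - potential y z c \<le>
    (if u = v + 1 then real_of_int ((v - 1 - y) * (z - (v - 1))) - real_of_int ((v - y) * (z - v))
     else real_of_int ((v - y) * (z - v)) - real_of_int ((v - 1 - y) * (z - (v - 1))))"
proof -
  define h where "h j = real_of_int ((j - y) * (z - j))" for j
  define c' where "c' = c(v := (c v)[i := c u ! i])"
  have hnn: "0 \<le> h (v - 1)" "0 \<le> h v" using v by (auto simp: h_def)
  define d where "d j = real (hamming (c' j) (c' (j + 1))) - real (hamming (c j) (c (j + 1)))" for j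
  have "potential y z c' - potential y z c = (\<Sum>j\<in>{y..<z}. h j * d j)"
    unfolding potential_def h_def d_def by (simp add: sum_subtractf right_diff_distrib)
  also have "\<dots> = (\<Sum>j\<in>{v - 1, v}. h j * d j)"
    using v by (intro sum.mono_neutral_right) (auto simp: d_def c'_def)
  also have "\<dots> = h (v - 1) * d (v - 1) + h v * d v" by simp
  finally have eq: "potential y z c' - potential y z c = h (v - 1) * d (v - 1) + h v * d v" .
  have i': "i < length (c v)" "c u ! i \<noteq> c v ! i" using i len by auto
  have len': "length (c' w) = F" for w using len by (simp add: c'_def)
  have cv: "c' v = (c v)[i := c u ! i]" "c' (v + 1) = c (v + 1)" "c' (v - 1) = c (v - 1)"
    by (auto simp: c'_def)
  have comm: "hamming (c w) (c w') = hamming (c w') (c w)" "hamming (c' w) (c' w') = hamming (c' w') (c' w)" for w w'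
    by (simp_all add: hamming_commute len len')
  have dv: "d v = real (hamming (c' v) (c (v + 1))) - real (hamming (c v) (c (v + 1)))"
    by (simp add: d_def cv)
  have "d (v - 1) = real (hamming (c' v) (c' (v - 1))) - real (hamming (c v) (c (v - 1)))"
    unfolding d_def using comm(1)[of "v - 1" v] comm(2)[of "v - 1" v] by simp
  then have dv1: "d (v - 1) = real (hamming (c' v) (c (v - 1))) - real (hamming (c v) (c (v - 1)))"
    by (simp only: cv)
  have up: "d v \<le> 1" "d (v - 1) \<le> 1"
    unfolding dv dv1 cv(1) using hamming_flip_abs[OF i', of "c (v + 1)"] hamming_flip_abs[OF i', of "c (v - 1)"]
    by linarith+
  have down: "real (hamming (c' v) (c u)) - real (hamming (c v) (c u)) = -1"
    using hamming_flip_disagree[OF i'(1), of "c u"] i(2) by (simp add: cv)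
  show ?thesis
  proof (cases "u = v + 1")
    case True
    then have "d v = -1" using down dv by simp
    then have "h (v - 1) * d (v - 1) + h v * d v \<le> h (v - 1) - h v"
      using mult_left_mono[OF up(2) hnn(1)] by simp
    then show ?thesis using eq True unfolding c'_def h_def by simp
  next
    case False
    then have "u = v - 1" using u by simp
    then have "d (v - 1) = -1" using down dv1 by simp
    then have "h (v - 1) * d (v - 1) + h v * d v \<le> h v - h (v - 1)"
      using mult_left_mono[OF up(1) hnn(2)] by simp
    then show ?thesis using eq False unfolding c'_def h_def by simp
  qed
qed

text \<open>An active edge drives both its end sites; the shift collects both contributions at the
  edge. The boundary terms will vanish because the outermost edges are blockades.\<close>

lemma sum_shift_boundary:
  fixes G :: "int \<Rightarrow> real"
  assumes "G y = 0" "G (z - 1) = 0"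
  shows "(\<Sum>v\<in>{y<..<z}. G (v - 1)) = (\<Sum>v\<in>{y<..<z}. G v)"
proof -
  have "(\<Sum>v\<in>{y<..<z}. G (v - 1)) = (\<Sum>v\<in>{y..<z - 1}. G v)"
    by (rule sum.reindex_bij_witness[of _ "\<lambda>v. v + 1" "\<lambda>v. v - 1"]) auto
  also have "\<dots> = (\<Sum>v\<in>{y<..<z - 1}. G v)"
    by (rule sum.mono_neutral_right) (use assms in \<open>auto simp: less_le\<close>)
  also have "\<dots> = (\<Sum>v\<in>{y<..<z}. G v)"
  proof (rule sum.mono_neutral_left)
    show "\<forall>i\<in>{y<..<z} - {y<..<z - 1}. G i = 0"
    proof
      fix i assume "i \<in> {y<..<z} - {y<..<z - 1}"
      then have "i = z - 1" by auto
      then show "G i = 0" using assms by simp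
    qed
  qed auto
  finally show ?thesis .
qed

text \<open>The weights \<open>(j - y) * (z - j)\<close> have second difference \<open>-2\<close>, so every active edge contributes
  drift at most \<open>-1\<close>; this pays for the rate at which the site \<open>x\<close> flips.\<close>
lemma potential_drift:
  assumes x: "y < x" "x < z" and len: "\<And>z. length (c z) = F"
    and quiet: "\<theta> < hamming (c y) (c (y + 1))" "\<theta> < hamming (c y) (c (y - 1))"
      "\<theta> < hamming (c z) (c (z + 1))" "\<theta> < hamming (c z) (c (z - 1))"
  shows "deffuant_gen F \<theta> {y..z} (\<lambda>c. potential y z c + of_bool (c x \<noteq> a)) c \<le> 0"
proof -
  define \<Phi> where "\<Phi> c = potential y z c + of_bool (c x \<noteq> a)" for c
  define h where "h j = real_of_int ((j - y) * (z - j))" for j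
  define A where "A j = (of_bool (1 \<le> hamming (c j) (c (j + 1)) \<and> hamming (c j) (c (j + 1)) \<le> \<theta>) :: real)" for j
  define \<delta> where "\<delta> v = (of_bool (v = x) :: real)" for v
  define T where "T v u = (if 1 \<le> hamming (c v) (c u) \<and> hamming (c v) (c u) \<le> \<theta>
         then (1/2) * (1 / real (hamming (c v) (c u))) *
              (\<Sum>i\<in>{i. i < F \<and> c v ! i \<noteq> c u ! i}. \<Phi> (c(v := (c v)[i := c u ! i])) - \<Phi> c) else 0)" for v u
  have gen: "deffuant_gen F \<theta> {y..z} \<Phi> c = (\<Sum>v\<in>{y..z}. T v (v - 1) + T v (v + 1))"
    unfolding deffuant_gen_def T_def by simp
  have T_le: "T v u \<le> K / 2" if act: "1 \<le> hamming (c v) (c u)" "hamming (c v) (c u) \<le> \<theta>"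
    and K: "\<And>i. i < F \<Longrightarrow> c v ! i \<noteq> c u ! i \<Longrightarrow> \<Phi> (c(v := (c v)[i := c u ! i])) - \<Phi> c \<le> K" for v u K
  proof -
    let ?S = "{i. i < F \<and> c v ! i \<noteq> c u ! i}"
    have "(\<Sum>i\<in>?S. \<Phi> (c(v := (c v)[i := c u ! i])) - \<Phi> c) \<le> (\<Sum>i\<in>?S. K)"
      using K by (intro sum_mono) auto
    also have "\<dots> = real (hamming (c v) (c u)) * K" by (simp add: hamming_def len)
    finally have "1 / 2 * (1 / real (hamming (c v) (c u))) * (\<Sum>i\<in>?S. \<Phi> (c(v := (c v)[i := c u ! i])) - \<Phi> c)
      \<le> 1 / 2 * (1 / real (hamming (c v) (c u))) * (real (hamming (c v) (c u)) * K)"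
      by (rule mult_left_mono) simp
    also have "\<dots> = K / 2" using act by simp
    finally show ?thesis using act by (simp add: T_def)
  qed
  have \<Phi>_flip: "\<Phi> (c(v := u)) - \<Phi> c \<le> potential y z (c(v := u)) - potential y z c + \<delta> v" for v u
    by (auto simp: \<Phi>_def \<delta>_def)
  have right: "T v (v + 1) \<le> A v * (h (v - 1) - h v + \<delta> v) / 2" if v: "y < v" "v < z" for v
  proof (cases "A v = 0")
    case True
    then have "\<not> (1 \<le> hamming (c v) (c (v + 1)) \<and> hamming (c v) (c (v + 1)) \<le> \<theta>)"
      by (simp add: A_def)
    then have "T v (v + 1) = 0" unfolding T_def by (rule if_not_P)
    then show ?thesis using True by simp
  next
    case False
    then have A: "A v = 1" "1 \<le> hamming (c v) (c (v + 1))" "hamming (c v) (c (v + 1)) \<le> \<theta>"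
      by (auto simp: A_def split: if_splits)
    have "T v (v + 1) \<le> (h (v - 1) - h v + \<delta> v) / 2"
    proof (rule T_le[OF A(2,3)])
      fix i assume i: "i < F" "c v ! i \<noteq> c (v + 1) ! i"
      show "\<Phi> (c(v := (c v)[i := c (v + 1) ! i])) - \<Phi> c \<le> h (v - 1) - h v + \<delta> v"
        using potential_flip_le[OF v i _ len] \<Phi>_flip[of v "(c v)[i := c (v + 1) ! i]"] unfolding h_def by simp
    qed
    then show ?thesis using A by simp
  qed
  have left: "T v (v - 1) \<le> A (v - 1) * (h v - h (v - 1) + \<delta> v) / 2" if v: "y < v" "v < z" for v
  proof (cases "A (v - 1) = 0")
    case True
    then have "\<not> (1 \<le> hamming (c v) (c (v - 1)) \<and> hamming (c v) (c (v - 1)) \<le> \<theta>)"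
      by (simp add: A_def hamming_commute[of "c v" "c (v - 1)"] len)
    then have "T v (v - 1) = 0" unfolding T_def by (rule if_not_P)
    then show ?thesis using True by simp
  next
    case False
    then have A: "A (v - 1) = 1" "1 \<le> hamming (c v) (c (v - 1))" "hamming (c v) (c (v - 1)) \<le> \<theta>"
      by (auto simp: A_def hamming_commute[of "c v" "c (v - 1)"] len split: if_splits)
    have "T v (v - 1) \<le> (h v - h (v - 1) + \<delta> v) / 2"
    proof (rule T_le[OF A(2,3)])
      fix i assume i: "i < F" "c v ! i \<noteq> c (v - 1) ! i"
      show "\<Phi> (c(v := (c v)[i := c (v - 1) ! i])) - \<Phi> c \<le> h v - h (v - 1) + \<delta> v"
        using potential_flip_le[OF v i _ len] \<Phi>_flip[of v "(c v)[i := c (v - 1) ! i]"] unfolding h_def by simp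
    qed
    then show ?thesis using A by simp
  qed
  have A0: "A y = 0" "A (z - 1) = 0"
    using quiet hamming_commute[of "c z" "c (z - 1)"] by (auto simp: A_def len)
  have T0: "T y (y - 1) = 0" "T y (y + 1) = 0" "T z (z - 1) = 0" "T z (z + 1) = 0"
    using quiet by (auto simp: T_def)
  have "deffuant_gen F \<theta> {y..z} \<Phi> c = (\<Sum>v\<in>{y<..<z}. T v (v - 1) + T v (v + 1))"
    unfolding gen
  proof (rule sum.mono_neutral_right)
    show "\<forall>v\<in>{y..z} - {y<..<z}. T v (v - 1) + T v (v + 1) = 0"
    proof
      fix v assume "v \<in> {y..z} - {y<..<z}"
      then have "v = y \<or> v = z" by auto
      then show "T v (v - 1) + T v (v + 1) = 0" using T0 by auto
    qed
  qed auto
  also have "\<dots> \<le> (\<Sum>v\<in>{y<..<z}. A (v - 1) * (h v - h (v - 1) + \<delta> v) / 2 + A v * (h (v - 1) - h v + \<delta> v) / 2)"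
    using left right by (intro sum_mono add_mono) auto
  also have "\<dots> = (\<Sum>v\<in>{y<..<z}. A (v - 1) * (h (v - 1 + 1) - h (v - 1)) / 2) +
      (\<Sum>v\<in>{y<..<z}. A v * (h (v - 1) - h v) / 2) + (\<Sum>v\<in>{y<..<z}. \<delta> v * ((A (v - 1) + A v) / 2))"
    by (simp add: sum.distrib[symmetric] algebra_simps add_divide_distrib diff_divide_distrib)
  also have "(\<Sum>v\<in>{y<..<z}. A (v - 1) * (h (v - 1 + 1) - h (v - 1)) / 2) = (\<Sum>v\<in>{y<..<z}. A v * (h (v + 1) - h v) / 2)"
    by (rule sum_shift_boundary[of "\<lambda>v. A v * (h (v + 1) - h v) / 2"]) (simp_all add: A0)
  also have "(\<Sum>v\<in>{y<..<z}. \<delta> v * ((A (v - 1) + A v) / 2)) = (A (x - 1) + A x) / 2"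
  proof -
    have "(\<Sum>v\<in>{y<..<z}. \<delta> v * ((A (v - 1) + A v) / 2)) = (\<Sum>v\<in>{y<..<z}. if v = x then (A (x - 1) + A x) / 2 else 0)"
      by (intro sum.cong) (auto simp: \<delta>_def)
    then show ?thesis using x by simp
  qed
  also have "(\<Sum>v\<in>{y<..<z}. A v * (h (v + 1) - h v) / 2) + (\<Sum>v\<in>{y<..<z}. A v * (h (v - 1) - h v) / 2) =
      - (\<Sum>v\<in>{y<..<z}. A v)"
  proof -
    have "A v * (h (v + 1) - h v) / 2 + A v * (h (v - 1) - h v) / 2 = - A v" for v
    proof -
      have "h (v + 1) + h (v - 1) - 2 * h v = -2" by (simp add: h_def algebra_simps)
      then have "A v * (h (v + 1) + h (v - 1) - 2 * h v) = A v * (-2)" by simp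
      then show ?thesis by (simp add: algebra_simps add_divide_distrib diff_divide_distrib)
    qed
    then show ?thesis by (simp add: sum.distrib[symmetric] sum_negf)
  qed
  finally have le: "deffuant_gen F \<theta> {y..z} \<Phi> c \<le> - (\<Sum>v\<in>{y<..<z}. A v) + (A (x - 1) + A x) / 2" .
  \<comment> \<open>The site \<open>x\<close> flips at rate at most
    \<open>(A (x - 1) + A x) / 2\<close>, and the total activity dominates each of the two terms.
    When \<open>x - 1 = y\<close> the left edge is outside the sum, but it is then a
    blockade.\<close>
  have arith: "g \<le> 0" if "g \<le> - S + (a + b) / 2" "a \<le> S" "b \<le> S" for g S a b :: real
    using that by (simp add: field_simps)
  have Ann: "0 \<le> A v" for v by (simp add: A_def)
  have 1: "A x \<le> (\<Sum>v\<in>{y<..<z}. A v)" using x Ann by (intro member_le_sum) auto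
  have 2: "A (x - 1) \<le> (\<Sum>v\<in>{y<..<z}. A v)"
  proof (cases "x - 1 = y")
    case True
    then show ?thesis using A0 Ann by (simp add: sum_nonneg)
  next
    case False
    then show ?thesis using x Ann by (intro member_le_sum) auto
  qed
  have "deffuant_gen F \<theta> {y..z} \<Phi> c \<le> 0" by (rule arith[OF le 2 1])
  then show ?thesis by (simp add: \<Phi>_def[abs_def])
qed

context deffuant
begin

lemma prob_UN_incseq_le:
  assumes "\<And>n. E n \<in> sets M" "incseq E" "\<And>n. prob (E n) \<le> K"
  shows "prob (\<Union>n. E n) \<le> K"
proof (rule LIMSEQ_le_const2)
  show "(\<lambda>n. prob (E n)) \<longlonglongrightarrow> prob (\<Union>n. E n)"
    using assms by (intro finite_Lim_measure_incseq) auto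
qed (use assms(3) in auto)

definition good_between :: "int \<Rightarrow> int \<Rightarrow> 'a set" where
  "good_between y z = {\<omega> \<in> space M. good \<theta> y (conf 0 \<omega>) \<and> good \<theta> z (conf 0 \<omega>)}"

lemma good_between_hist: "0 \<le> s \<Longrightarrow> good_between y z \<in> sets (hist s)"
proof -
  assume "0 \<le> s"
  then have [measurable]: "Measurable.pred (hist s) (\<lambda>\<omega>. good \<theta> v (conf 0 \<omega>))" for v
    by (intro good_measurable rv_hist) auto
  have "{\<omega> \<in> space (hist s). good \<theta> y (conf 0 \<omega>) \<and> good \<theta> z (conf 0 \<omega>)} \<in> sets (hist s)"
    by measurable
  then show ?thesis by (simp add: good_between_def)
qed

text \<open>On the event that \<open>x\<close> has opinion \<open>a x\<close> at time
  \<open>s\<close>, the potential plus the indicator of differing from \<open>a x\<close> has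
  nonpositive drift while both end sites are frozen. So the chance of a flip is paid for by a loss
  of mean potential; these losses telescope.\<close>

lemma flip_between_le:
  assumes x: "y < x" "x < z" and s: "0 \<le> s" "s \<le> t"
  defines "V \<equiv> \<lambda>r. \<integral>\<omega>. indicator (good_between y z) \<omega> * potential y z (conf r \<omega>) \<partial>M"
  shows "prob {\<omega> \<in> good_between y z. \<eta> t x \<omega> \<noteq> \<eta> s x \<omega>} \<le> V s - V t"
proof -
  let ?G = "good_between y z" and ?P = "\<lambda>r \<omega>. potential y z (conf r \<omega>)"
  have G [measurable]: "?G \<in> sets M" using good_between_hist[OF order_refl] by (rule hist_sets)
  define h where "h \<omega> = (of_bool (\<eta> t x \<omega> \<noteq> \<eta> s x \<omega>) :: real)" for \<omega>
  have "h \<in> borel_measurable M" unfolding h_def[abs_def] by measurable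
  then have h: "integrable M h"
    by (intro integrable_const_bound[of _ 1]) (auto simp: h_def)
  have P: "integrable M (?P r)" for r by (rule integrable_local[OF _ potential_local]) simp
  have int: "integrable M (\<lambda>\<omega>. indicator ?G \<omega> * (h \<omega> + ?P t \<omega> - ?P s \<omega>))"
    using integrable_mult_indicator[OF G, of "\<lambda>\<omega>. h \<omega> + ?P t \<omega> - ?P s \<omega>"] h P by simp
  have part: "(\<integral>\<omega>. indicator (pattern s {x} a) \<omega> * (indicator ?G \<omega> * (h \<omega> + ?P t \<omega> - ?P s \<omega>)) \<partial>M) \<le> 0" for a
  proof -
    let ?B = "?G \<inter> pattern s {x} a"
    define \<Phi> where "\<Phi> c = potential y z c + of_bool (c x \<noteq> a x)" for c :: config
    have \<Phi>: "depends_only_on {y..z} \<Phi>"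
    proof (rule depends_only_onI)
      fix c c' :: config assume eq: "\<And>v. v \<in> {y..z} \<Longrightarrow> c v = c' v"
      then show "\<Phi> c = \<Phi> c'"
        using depends_only_onD[OF potential_local eq] eq[of x] x by (simp add: \<Phi>_def)
    qed
    have B: "?B \<in> sets (hist s)" using good_between_hist[OF s(1)] pattern_hist[OF _ s(1) order_refl] by auto
    then have BM [measurable]: "?B \<in> sets M" by (rule hist_sets)
    have "(\<integral>\<omega>. indicator ?B \<omega> * \<Phi> (conf t \<omega>) \<partial>M) \<le> (\<integral>\<omega>. indicator ?B \<omega> * \<Phi> (conf s \<omega>) \<partial>M) + 0 * (t - s)"
    proof (rule dynkin_le[OF _ \<Phi> s B])
      fix r assume r: "s \<le> r" "r \<le> t"
      have "(\<integral>\<omega>. indicator ?B \<omega> * deffuant_gen F \<theta> {y..z} \<Phi> (conf r \<omega>) \<partial>M) \<le> (\<integral>\<omega>. 0 \<partial>M)"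
      proof (rule integral_mono_AE)
        show "integrable M (\<lambda>\<omega>. indicator ?B \<omega> * deffuant_gen F \<theta> {y..z} \<Phi> (conf r \<omega>))"
          by (rule integrable_ind_local[OF finite_nbhd gen_local[OF \<Phi>] BM]) simp
        have "0 \<le> r" using r s by simp
        from freeze[OF this, of y] freeze[OF this, of z] AE_space
        show "AE \<omega> in M. indicator ?B \<omega> * deffuant_gen F \<theta> {y..z} \<Phi> (conf r \<omega>) \<le> 0"
        proof eventually_elim
          case (elim \<omega>)
          have "deffuant_gen F \<theta> {y..z} \<Phi> (conf r \<omega>) \<le> 0" if "\<omega> \<in> ?B"
            unfolding \<Phi>_def[abs_def] using x elim that
            by (intro potential_drift) (auto simp: good_between_def)
          then show ?case by (simp add: indicator_def)
        qed
      qed simp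
      then show "(\<integral>\<omega>. indicator ?B \<omega> * deffuant_gen F \<theta> {y..z} \<Phi> (conf r \<omega>) \<partial>M) \<le> 0" by simp
    qed simp
    moreover have "integrable M (\<lambda>\<omega>. indicator ?B \<omega> * \<Phi> (conf r \<omega>))" for r
      by (rule integrable_ind_local[OF _ \<Phi> BM]) simp
    ultimately have "(\<integral>\<omega>. indicator ?B \<omega> * \<Phi> (conf t \<omega>) - indicator ?B \<omega> * \<Phi> (conf s \<omega>) \<partial>M) \<le> 0"
      by (subst Bochner_Integration.integral_diff) auto
    also have "(\<integral>\<omega>. indicator ?B \<omega> * \<Phi> (conf t \<omega>) - indicator ?B \<omega> * \<Phi> (conf s \<omega>) \<partial>M) =
      (\<integral>\<omega>. indicator (pattern s {x} a) \<omega> * (indicator ?G \<omega> * (h \<omega> + ?P t \<omega> - ?P s \<omega>)) \<partial>M)"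
      by (intro Bochner_Integration.integral_cong refl) (auto simp: \<Phi>_def h_def pattern_def indicator_def)
    finally show ?thesis .
  qed
  have "(\<integral>\<omega>. indicator ?G \<omega> * (h \<omega> + ?P t \<omega> - ?P s \<omega>) \<partial>M) \<le> 0"
    unfolding integral_patterns[OF finite.intros(2)[OF finite.intros(1)] int s(1), of x]
    by (intro sum_nonpos part)
  moreover have "(\<integral>\<omega>. indicator ?G \<omega> * (h \<omega> + ?P t \<omega> - ?P s \<omega>) \<partial>M) = 
    (\<integral>\<omega>. indicator ?G \<omega> * h \<omega> \<partial>M) + V t - V s"
  proof -
    have "(\<integral>\<omega>. indicator ?G \<omega> * (h \<omega> + ?P t \<omega> - ?P s \<omega>) \<partial>M) =
       (\<integral>\<omega>. indicator ?G \<omega> * h \<omega> + indicator ?G \<omega> * ?P t \<omega> - indicator ?G \<omega> * ?P s \<omega> \<partial>M)"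
      by (simp add: algebra_simps)
    also have "\<dots> = (\<integral>\<omega>. indicator ?G \<omega> * h \<omega> \<partial>M) + V t - V s"
      unfolding V_def using integrable_mult_indicator[OF G h] integrable_mult_indicator[OF G P]
      by (subst Bochner_Integration.integral_diff Bochner_Integration.integral_add | simp)+
    finally show ?thesis .
  qed
  moreover have "(\<integral>\<omega>. indicator ?G \<omega> * h \<omega> \<partial>M) = (\<integral>\<omega>. indicator {\<omega> \<in> ?G. \<eta> t x \<omega> \<noteq> \<eta> s x \<omega>} \<omega> \<partial>M)"
    by (intro Bochner_Integration.integral_cong refl) (auto simp: h_def indicator_def)
  moreover have "(\<integral>\<omega>. indicator {\<omega> \<in> ?G. \<eta> t x \<omega> \<noteq> \<eta> s x \<omega>} \<omega> \<partial>M) = prob {\<omega> \<in> ?G. \<eta> t x \<omega> \<noteq> \<eta> s x \<omega>}"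
  proof -
    have "{\<omega> \<in> ?G. \<eta> t x \<omega> \<noteq> \<eta> s x \<omega>} \<inter> space M = {\<omega> \<in> ?G. \<eta> t x \<omega> \<noteq> \<eta> s x \<omega>}"
      by (auto simp: good_between_def)
    then show ?thesis by simp
  qed
  ultimately show ?thesis by linarith
qed

text \<open>The bound of \<open>flip_between_le\<close> telescopes along any grid, so the chance
  that \<open>x\<close> moves at a dyadic time after \<open>N\<close> is at most
  \<open>V N - L\<close> for every mesh, with \<open>L\<close> the limit of \<open>V\<close>.
  Right-continuity passes from dyadic times to all times.\<close>

lemma fixation_between:
  assumes x: "y < x" "x < z"
  shows "AE \<omega> in M. \<omega> \<in> good_between y z \<longrightarrow> (\<exists>N::nat. \<forall>t\<ge>real N. \<eta> t x \<omega> = \<eta> (real N) x \<omega>)"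
proof -
  let ?G = "good_between y z"
  define V where "V r = (\<integral>\<omega>. indicator ?G \<omega> * potential y z (conf r \<omega>) \<partial>M)" for r
  note flip = flip_between_le[OF x, folded V_def]
  have G [measurable]: "?G \<in> sets M" using good_between_hist[OF order_refl] by (rule hist_sets)
  have V_anti: "V t \<le> V s" if "0 \<le> s" "s \<le> t" for s t
    using flip[OF that] measure_nonneg[of M "{\<omega> \<in> ?G. \<eta> t x \<omega> \<noteq> \<eta> s x \<omega>}"] by linarith
  have V_nonneg: "0 \<le> V r" for r
    unfolding V_def by (intro integral_nonneg_AE AE_I2) (auto simp: potential_nonneg)
  obtain L where L: "(\<lambda>N. V (real N)) \<longlonglongrightarrow> L" "\<And>N. L \<le> V (real N)"
    using decseq_convergent[of "\<lambda>N. V (real N)" 0] V_anti V_nonneg by (auto simp: decseq_def)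
  have L_le: "L \<le> V t" if "0 \<le> t" for t
  proof -
    have "V (real (nat \<lceil>t\<rceil>)) \<le> V t" using that by (intro V_anti) auto
    then show ?thesis using L(2) order_trans by blast
  qed
  define C where "C N = {\<omega> \<in> ?G. \<exists>n i. \<eta> (real N + real i / 2 ^ n) x \<omega> \<noteq> \<eta> (real N) x \<omega>}" for N :: nat
  have C [measurable]: "C N \<in> sets M" for N unfolding C_def by measurable
  have C_le: "prob (C N) \<le> V (real N) - L" for N
  proof -
    define E where "E n k = {\<omega> \<in> ?G. \<exists>i\<le>k. \<eta> (real N + real i / 2 ^ n) x \<omega> \<noteq> \<eta> (real N) x \<omega>}" for n k :: nat
    have E [measurable]: "E n k \<in> sets M" for n k unfolding E_def by measurable
    have "prob (E n k) \<le> V (real N) - V (real N + real k / 2 ^ n)" for n k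
    proof (induction k)
      case 0
      then show ?case by (simp add: E_def)
    next
      case (Suc k)
      let ?s = "real N + real k / 2 ^ n" and ?t = "real N + real (Suc k) / 2 ^ n"
      let ?F = "{\<omega> \<in> ?G. \<eta> ?t x \<omega> \<noteq> \<eta> ?s x \<omega>}"
      have [measurable]: "?F \<in> sets M" by measurable
      have "E n (Suc k) \<subseteq> E n k \<union> ?F" unfolding E_def le_Suc_eq by auto
      then have "prob (E n (Suc k)) \<le> prob (E n k \<union> ?F)" by (rule finite_measure_mono) measurable
      also have "\<dots> \<le> prob (E n k) + prob ?F" by (rule measure_Un_le) measurable
      also have "prob ?F \<le> V ?s - V ?t" by (rule flip) (auto simp: field_simps)
      finally show ?case using Suc by simp
    qed
    then have E_le: "prob (E n k) \<le> V (real N) - L" for n k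
      using L_le[of "real N + real k / 2 ^ n"] by (smt (verit) divide_nonneg_pos of_nat_0_le_iff zero_less_power)
    have union: "prob (\<Union>k. E n k) \<le> V (real N) - L" for n
    proof (rule prob_UN_incseq_le)
      show "incseq (E n)"
      proof (rule incseq_SucI)
        show "E n k \<subseteq> E n (Suc k)" for k unfolding E_def le_Suc_eq by blast
      qed
    qed (use E_le in auto)
    have incr: "incseq (\<lambda>n. \<Union>k. E n k)"
    proof (rule incseq_SucI, rule subsetI)
      fix n \<omega> assume "\<omega> \<in> (\<Union>k. E n k)"
      then obtain i where i: "\<omega> \<in> ?G" "\<eta> (real N + real i / 2 ^ n) x \<omega> \<noteq> \<eta> (real N) x \<omega>" by (auto simp: E_def)
      have "real i / 2 ^ n = real (2 * i) / 2 ^ Suc n" by simp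
      then have "\<omega> \<in> E (Suc n) (2 * i)" using i unfolding E_def by (metis (mono_tags, lifting) mem_Collect_eq order_refl)
      then show "\<omega> \<in> (\<Union>k. E (Suc n) k)" by blast
    qed
    have "prob (\<Union>n. \<Union>k. E n k) \<le> V (real N) - L"
      by (rule prob_UN_incseq_le[OF _ incr union]) measurable
    moreover have "C N = (\<Union>n. \<Union>k. E n k)" by (auto simp: C_def E_def)
    ultimately show ?thesis by simp
  qed
  have "prob (\<Inter>N. C N) \<le> 0"
  proof (rule LIMSEQ_le_const)
    show "(\<lambda>N. V (real N) - L) \<longlonglongrightarrow> 0" using tendsto_diff[OF L(1) tendsto_const[of L]] by simp
    have "prob (\<Inter>N. C N) \<le> V (real N) - L" for N
      by (rule order_trans[OF finite_measure_mono C_le[of N]]) auto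
    then show "\<exists>N. \<forall>n\<ge>N. prob (\<Inter>N. C N) \<le> V (real n) - L" by blast
  qed
  then have "prob (\<Inter>N. C N) = 0" using measure_nonneg[of M "\<Inter>N. C N"] by linarith
  then have "AE \<omega> in M. \<omega> \<notin> (\<Inter>N. C N)" by (subst (asm) prob_eq_0) auto
  with AE_space show ?thesis
  proof eventually_elim
    case (elim \<omega>)
    show ?case
    proof
      assume "\<omega> \<in> ?G"
      then obtain N where N: "\<And>n i. \<eta> (real N + real i / 2 ^ n) x \<omega> = \<eta> (real N) x \<omega>"
        using elim(2) by (auto simp: C_def)
      have "\<eta> t x \<omega> = \<eta> (real N) x \<omega>" if t: "real N \<le> t" for t
      proof -
        obtain e where e: "e > 0" "\<And>r. t \<le> r \<Longrightarrow> r < t + e \<Longrightarrow> \<eta> r x \<omega> = \<eta> t x \<omega>"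
          using right_cont[OF elim(1), of t x] t by auto
        obtain n where n: "(1/2::real) ^ n < e" using real_arch_pow_inv[OF e(1), of "1/2"] by auto
        let ?i = "nat \<lceil>(t - real N) * 2 ^ n\<rceil>"
        have "(t - real N) * 2 ^ n \<le> real ?i" "real ?i < (t - real N) * 2 ^ n + 1"
          using t by (auto simp: of_nat_nat) linarith+
        then have "t - real N \<le> real ?i / 2 ^ n" "real ?i / 2 ^ n < t - real N + (1/2) ^ n"
          by (auto simp: field_simps power_divide)
        then have "\<eta> (real N + real ?i / 2 ^ n) x \<omega> = \<eta> t x \<omega>" using n by (intro e(2)) auto
        then show ?thesis using N by simp
      qed
      then show "\<exists>N::nat. \<forall>t\<ge>real N. \<eta> t x \<omega> = \<eta> (real N) x \<omega>" by blast
    qed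
  qed
qed

end

subsection \<open>The initial configuration\<close>

definition pure :: "nat \<Rightarrow> opinion \<Rightarrow> bool" where
  "pure F u \<longleftrightarrow> u = u_minus F \<or> u = u_plus F"

text \<open>Neighbouring edges share a site, so their weights are dependent; scores of disjoint
  pairs of sites are independent under the initial law. An impure site can spoil both of its edges,
  each by at most \<theta>, and its pair is charged for both, hence
  \<open>2 * \<theta>\<close>.\<close>

definition pair_score :: "nat \<Rightarrow> nat \<Rightarrow> opinion \<Rightarrow> opinion \<Rightarrow> int" where
  "pair_score F \<theta> u v = of_bool (pure F u \<and> pure F v \<and> u \<noteq> v)
     - 2 * int \<theta> * (of_bool (\<not> pure F u) + of_bool (\<not> pure F v))"

lemma hamming_replicate: "hamming u (replicate (length u) b) = card {i. i < length u \<and> u ! i \<noteq> b}"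
  unfolding hamming_def by (rule arg_cong[where f = card]) auto

lemma hamming_minus_plus:
  "hamming (u_minus F) (u_plus F) = F" "hamming (u_plus F) (u_minus F) = F"
  unfolding hamming_def u_minus_def u_plus_def by (simp_all cong: conj_cong)

text \<open>Here \<open>F > 2 * \<theta>\<close> enters: an edge between the two opposite pure
  opinions weighs \<open>F - 2 * \<theta>\<close>, at least one. An edge between equal opinions
  weighs zero, and no edge weighs less than \<open>- \<theta>\<close>.\<close>

lemma edge_weight_ge:
  assumes "2 * \<theta> < F"
  shows "edge_weight \<theta> u v \<ge> of_bool (pure F u \<and> pure F v \<and> u \<noteq> v)
     - int \<theta> * (of_bool (\<not> pure F u) + of_bool (\<not> pure F v))"
proof (cases "pure F u \<and> pure F v")
  case True
  show ?thesis
  proof (cases "u = v")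
    case False
    then have "hamming u v = F" using True hamming_minus_plus by (auto simp: pure_def)
    then show ?thesis using True False assms by (simp add: edge_weight_def)
  qed (use True in \<open>simp add: edge_weight_def\<close>)
next
  case False
  have "edge_weight \<theta> u v \<ge> - int \<theta>" by (simp add: edge_weight_def)
  then show ?thesis using False by auto
qed

text \<open>In the next two lemmas \<open>w\<close> stands for the edge weights, \<open>d\<close> for the gains at edges between
  opposite pure sites and \<open>b\<close> for the losses charged to impure sites; each site carries the losses of
  both its edges.\<close>
lemma sum_pairs_odd:
  fixes w d b :: "nat \<Rightarrow> int"
  assumes "\<And>i. d i - b i - b (Suc i) \<le> w i" "\<And>i. 0 \<le> b i" "\<And>i. 0 \<le> d i"
  shows "(\<Sum>l<Suc n. d (2 * l + 1) - 2 * b (2 * l + 1) - 2 * b (2 * l + 2)) + b (2 * n + 2) \<le>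
    (\<Sum>i=1..Suc (2 * n). w i)"
proof (induction n)
  case 0
  show ?case using assms(1)[of "Suc 0"] assms(2)[of "Suc 0"] by simp
next
  case (Suc n)
  then show ?case
    using assms(1)[of "Suc (Suc (2 * n))"] assms(1)[of "Suc (Suc (Suc (2 * n)))"]
      assms(2)[of "Suc (Suc (Suc (2 * n)))"] assms(3)[of "Suc (Suc (2 * n))"] by simp
qed

lemma sum_pairs:
  fixes w d b :: "nat \<Rightarrow> int"
  assumes "\<And>i. d i - b i - b (Suc i) \<le> w i" "\<And>i. 0 \<le> b i" "\<And>i. 0 \<le> d i" "\<And>i. d i \<le> 1"
    and k: "1 \<le> k"
  shows "(\<Sum>l<(k + 2) div 2. d (2 * l + 1) - 2 * b (2 * l + 1) - 2 * b (2 * l + 2)) - 1 \<le> (\<Sum>i=1..k. w i)"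
proof (cases "odd k")
  case True
  then obtain n where n: "k = Suc (2 * n)" by (auto elim: oddE)
  then have k2: "(k + 2) div 2 = Suc n" by simp
  show ?thesis
    using sum_pairs_odd[where w = w and d = d and b = b and n = n, OF assms(1-3)] assms(2)[of "2 * n + 2"]
    unfolding k2 unfolding n by linarith
next
  case False
  \<comment> \<open>For even \<open>k\<close> the second site of the last pair lies beyond the last
    edge, so the edge inside that pair is not summed; its possible gain of one is what the
    \<open>- 1\<close> gives back.\<close>
  then obtain j where j: "k = 2 * j" by (auto elim: evenE)
  then obtain n where n: "k = Suc (Suc (2 * n))" using k by (cases j) auto
  then have k2: "(k + 2) div 2 = Suc (Suc n)" by simp
  show ?thesis
    using sum_pairs_odd[where w = w and d = d and b = b and n = n, OF assms(1-3)]
      assms(1)[of "Suc (Suc (2 * n))"] assms(2)[of "Suc (Suc (Suc (2 * n)))"]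
      assms(2)[of "Suc (Suc (Suc (Suc (2 * n))))"] assms(3)[of "Suc (Suc (2 * n))"]
      assms(4)[of "Suc (Suc (Suc (2 * n)))"]
    unfolding k2 unfolding n by simp
qed

lemma sum_edge_weight_ge:
  assumes F: "2 * \<theta> < F" and k: "1 \<le> k"
  shows "(\<Sum>l<(k + 2) div 2. pair_score F \<theta> (a (2 * l + 1)) (a (2 * l + 2))) - 1 \<le>
    (\<Sum>i=1..k. edge_weight \<theta> (a i) (a (Suc i)))"
proof -
  define b where "b i = int \<theta> * of_bool (\<not> pure F (a i))" for i
  define d where "d i = (of_bool (pure F (a i) \<and> pure F (a (Suc i)) \<and> a i \<noteq> a (Suc i)) :: int)" for i
  have "(\<Sum>l<(k + 2) div 2. d (2 * l + 1) - 2 * b (2 * l + 1) - 2 * b (2 * l + 2)) - 1 \<le>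
      (\<Sum>i=1..k. edge_weight \<theta> (a i) (a (Suc i)))"
  proof (rule sum_pairs[OF _ _ _ _ k])
    show "d i - b i - b (Suc i) \<le> edge_weight \<theta> (a i) (a (Suc i))" for i
      using edge_weight_ge[OF F, of "a i" "a (Suc i)"] by (simp add: b_def d_def distrib_left)
  qed (auto simp: b_def d_def)
  also have "(\<Sum>l<(k + 2) div 2. d (2 * l + 1) - 2 * b (2 * l + 1) - 2 * b (2 * l + 2)) =
      (\<Sum>l<(k + 2) div 2. pair_score F \<theta> (a (2 * l + 1)) (a (2 * l + 2)))"
    by (intro sum.cong) (auto simp: pair_score_def b_def d_def distrib_left)
  finally show ?thesis .
qed

definition score :: "nat \<Rightarrow> nat \<Rightarrow> int \<Rightarrow> int \<Rightarrow> nat \<Rightarrow> config \<Rightarrow> int" where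
  "score F \<theta> \<sigma> x l c = pair_score F \<theta> (c (x + \<sigma> * int (2 * l + 1))) (c (x + \<sigma> * int (2 * l + 2)))"

text \<open>A pair accounts for two edges, which turns slope \<open>1 / 32\<close> per pair into
  \<open>1 / 64\<close> per edge. The subtracted \<open>1\<close> absorbs the half-covered last
  pair.\<close>

lemma good_side_if_score:
  assumes F: "2 * \<theta> < F" and start: "\<theta> < hamming (c x) (c (x + \<sigma>))"
    and sc: "\<And>n. int n \<le> 32 * ((\<Sum>l<Suc n. score F \<theta> \<sigma> x l c) - 1)"
  shows "good_side \<theta> \<sigma> x c"
  unfolding good_side_def
proof (intro conjI allI impI)
  fix k :: nat assume k: "1 \<le> k"
  define n where "n = k div 2"
  have "(k + 2) div 2 = Suc n" by (simp add: n_def)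
  then have "(\<Sum>l<Suc n. score F \<theta> \<sigma> x l c) - 1 \<le>
    (\<Sum>i=1..k. edge_weight \<theta> (c (x + \<sigma> * int i)) (c (x + \<sigma> * int (Suc i))))"
    using sum_edge_weight_ge[OF F k, of "\<lambda>i. c (x + \<sigma> * int i)"] unfolding score_def by simp
  moreover have "int k \<le> 2 * int n + 1" by (simp add: n_def)
  moreover have "int k \<le> 64 * W + 1" if "S - 1 \<le> W" "int k \<le> 2 * int n + 1" "int n \<le> 32 * (S - 1)" for S W :: int
    using that by (simp add: algebra_simps)
  ultimately show "int k \<le> 64 * (\<Sum>i=1..k. edge_weight \<theta> (c (x + \<sigma> * int i)) (c (x + \<sigma> * int (Suc i)))) + 1"
    using sc[of n] by blast
qed (rule start)

text \<open>The \<open>K\<close> pairs nearest to \<open>x\<close> will be prescribed with score one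
  and build up a credit; the random scores beyond them may fall below the line of slope
  \<open>1 / 32\<close> by \<open>(K - 1) / 2\<close>. This slack makes failure exponentially
  unlikely in \<open>K\<close>, and the event reads no site of the core, so the two are
  independent.\<close>

definition tail_ok :: "nat \<Rightarrow> nat \<Rightarrow> nat \<Rightarrow> int \<Rightarrow> int \<Rightarrow> nat \<Rightarrow> config \<Rightarrow> bool" where
  "tail_ok F \<theta> K \<sigma> x m c \<longleftrightarrow> int m - 16 * (int K - 1) \<le> 32 * (\<Sum>l=K..<K + m. score F \<theta> \<sigma> x l c)"

lemma good_side_if_tail_ok:
  assumes F: "2 * \<theta> < F" and start: "\<theta> < hamming (c x) (c (x + \<sigma>))"
    and K: "1 \<le> K" and one: "\<And>l. l < K \<Longrightarrow> score F \<theta> \<sigma> x l c = 1"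
    and tail: "\<And>m. tail_ok F \<theta> K \<sigma> x m c"
  shows "good_side \<theta> \<sigma> x c"
proof (rule good_side_if_score[OF F start])
  fix n
  show "int n \<le> 32 * ((\<Sum>l<Suc n. score F \<theta> \<sigma> x l c) - 1)"
  proof (cases "Suc n \<le> K")
    case True
    then have "(\<Sum>l<Suc n. score F \<theta> \<sigma> x l c) = (\<Sum>l<Suc n. 1)" by (intro sum.cong one) auto
    then show ?thesis by simp
  next
    case False
    define m where "m = Suc n - K"
    have n: "Suc n = K + m" using False by (simp add: m_def)
    have "(\<Sum>l<Suc n. score F \<theta> \<sigma> x l c) = (\<Sum>l<K. score F \<theta> \<sigma> x l c) + (\<Sum>l=K..<K + m. score F \<theta> \<sigma> x l c)"
      unfolding n lessThan_atLeast0 by (rule sum.atLeastLessThan_concat[symmetric]) auto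
    also have "(\<Sum>l<K. score F \<theta> \<sigma> x l c) = (\<Sum>l<K. 1)" by (intro sum.cong one) auto
    finally have "(\<Sum>l<Suc n. score F \<theta> \<sigma> x l c) = int K + (\<Sum>l=K..<K + m. score F \<theta> \<sigma> x l c)" by simp
    moreover have "int n + 1 = int K + int m" using n by simp
    moreover have "int n \<le> 32 * (S - 1)"
      if "S = int K + T" "int n + 1 = int K + int m" "int m - 16 * (int K - 1) \<le> 32 * T" for S T :: int
      using that K by (simp add: algebra_simps)
    ultimately show ?thesis using tail[of m] unfolding tail_ok_def by blast
  qed
qed

text \<open>\<open>u_minus\<close> and \<open>u_plus\<close> are complementary, so the distances of
  \<open>u\<close> to them add up to \<open>F > 2 * \<theta>\<close> and one of them exceeds
  \<theta>. The sites next to \<open>x\<close> will hold that opinion, which makes both edges at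
  \<open>x\<close> blockades.\<close>

lemma far_pure_opinion:
  assumes F: "2 * \<theta> < F" and u: "u \<in> opinions F"
  obtains v v' where "pure F v" "pure F v'" "v \<noteq> v'" "\<theta> < hamming u v"
proof -
  let ?M = "{i. i < F \<and> u ! i \<noteq> False}" and ?P = "{i. i < F \<and> u ! i \<noteq> True}"
  have len: "length u = F" using u by (simp add: opinions_def)
  have "?M \<union> ?P = {..<F}" "?M \<inter> ?P = {}" by auto
  then have "card ?M + card ?P = F"
    by (metis (no_types, lifting) card_Un_disjoint card_lessThan finite_Un finite_lessThan)
  then have "\<theta> < card ?M \<or> \<theta> < card ?P" using F by linarith
  then have "\<theta> < hamming u (u_minus F) \<or> \<theta> < hamming u (u_plus F)"
    using hamming_replicate[of u False] hamming_replicate[of u True] len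
    by (simp only: u_minus_def u_plus_def)
  moreover have "u_minus F \<noteq> u_plus F" using F by (auto simp: u_minus_def u_plus_def replicate_eq_replicate)
  ultimately show ?thesis using that by (metis pure_def)
qed

lemma score_pattern:
  assumes "pure F v" "pure F v'" "v \<noteq> v'" "\<sigma> \<in> {1, -1}" "l < K"
    and pat: "\<And>z. z \<in> {x - int (2 * K) .. x + int (2 * K)} \<Longrightarrow>
      c z = (if z = x then u else if odd (z - x) then v else v')"
  shows "score F \<theta> \<sigma> x l c = 1"
proof -
  have "c (x + \<sigma> * int (2 * l + 1)) = v"
    using assms(4,5) by (subst pat) auto
  moreover have "c (x + \<sigma> * int (2 * l + 2)) = v'"
    using assms(4,5) by (subst pat) auto
  ultimately show ?thesis using assms(1,2,3) by (simp add: score_def pair_score_def)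
qed

lemma score_local:
  assumes "\<sigma> \<in> {1, -1}" and "x + \<sigma> * int (2 * l + 1) \<in> D" "x + \<sigma> * int (2 * l + 2) \<in> D"
    and "\<And>z. z \<in> D \<Longrightarrow> c z = c' z"
  shows "score F \<theta> \<sigma> x l c = score F \<theta> \<sigma> x l c'"
  unfolding score_def using assms by simp

text \<open>A bound linear in indicators, so that the exponential moment reduces to probabilities of
  single events. One impure site costs \<open>4 ^ \<theta>\<close>, two cost
  \<open>16 ^ \<theta>\<close>; the larger cost is charged per impure site.\<close>

lemma powr_score_le:
  "2 powr (- real_of_int (pair_score F \<theta> u v)) \<le>
    1 - 1 / 2 * of_bool (pure F u \<and> pure F v \<and> u \<noteq> v) + 16 ^ \<theta> * (of_bool (\<not> pure F u) + of_bool (\<not> pure F v))"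
proof -
  have 4: "2 powr (2 * real \<theta>) = 4 ^ \<theta>"
  proof -
    have "2 powr (2 * real \<theta>) = 2 powr real (2 * \<theta>)" by simp
    also have "\<dots> = 4 ^ \<theta>" by (subst powr_realpow) (simp_all add: power_mult)
    finally show ?thesis .
  qed
  have 16: "2 powr (4 * real \<theta>) = 16 ^ \<theta>"
  proof -
    have "2 powr (4 * real \<theta>) = 2 powr real (4 * \<theta>)" by simp
    also have "\<dots> = 16 ^ \<theta>" by (subst powr_realpow) (simp_all add: power_mult)
    finally show ?thesis .
  qed
  have le: "(4::real) ^ \<theta> \<le> 16 ^ \<theta>" by (intro power_mono) auto
  have half: "2 powr (-1) = (1/2 :: real)" by (simp add: powr_minus)
  consider "pure F u \<and> pure F v" | "pure F u \<noteq> pure F v" | "\<not> pure F u \<and> \<not> pure F v" by blast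
  then show ?thesis
  proof cases
    case 1
    then show ?thesis using half by (auto simp: pair_score_def)
  next
    case 2
    then show ?thesis using 4 le by (auto simp: pair_score_def)
  next
    case 3
    then show ?thesis using 16 by (auto simp: pair_score_def)
  qed
qed

text \<open>\<open>16 ^ \<theta>\<close> is the exponential cost of an impure site and
  \<open>2 ^ F * \<rho>\<close> bounds the chance of one. With their product below
  \<open>1 / 64\<close>, the exponential moment of a pair is at most
  \<open>1 - 1 / 16 + 2 / 64 = 31 / 32\<close>.\<close>

locale deffuant_small = deffuant +
  assumes F_large: "2 * \<theta> < F" and \<rho>_pos: "0 < \<rho>" and \<rho>_small: "\<rho> < 1 / (64 * 16 ^ \<theta> * 2 ^ F)"
begin

section \<open>Moments of the scores under the initial law\<close>

lemma indep_init: "indep_vars (\<lambda>_. count_space UNIV) (\<lambda>x. \<eta> 0 x) UNIV"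
  using process[unfolded deffuant_process_def, THEN conjunct2, THEN conjunct2, THEN conjunct2, THEN conjunct2, THEN conjunct1] .

lemma prob_init: "prob {\<omega> \<in> space M. \<eta> 0 x \<omega> = u} = init_pmf F \<rho> u"
  using process[unfolded deffuant_process_def, THEN conjunct2, THEN conjunct2, THEN conjunct2, THEN conjunct2,
      THEN conjunct2, THEN conjunct1] by blast

lemma expectation_mult_local:
  assumes U: "finite U" "depends_only_on U f" and V: "finite V" "depends_only_on V g" and "U \<inter> V = {}"
  shows "(\<integral>\<omega>. f (conf 0 \<omega>) * g (conf 0 \<omega>) \<partial>M) = (\<integral>\<omega>. f (conf 0 \<omega>) \<partial>M) * (\<integral>\<omega>. g (conf 0 \<omega>) \<partial>M)"
proof -
  have meas: "h \<in> borel_measurable (PiM D (\<lambda>_. count_space UNIV))" if "finite D" "depends_only_on D h"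
    for D and h :: "config \<Rightarrow> real"
    using borel_measurable_local[OF that, of "\<lambda>z \<phi>. \<phi> z" "PiM D (\<lambda>_. count_space UNIV)"] by simp
  have comp: "h \<circ> (\<lambda>\<omega>. restrict (\<lambda>i. \<eta> 0 i \<omega>) D) = (\<lambda>\<omega>. h (conf 0 \<omega>))" if "depends_only_on D h"
    for D and h :: "config \<Rightarrow> real"
    unfolding comp_def by (intro ext depends_only_onD[OF that]) simp
  have "indep_var (PiM U (\<lambda>_. count_space UNIV)) (\<lambda>\<omega>. restrict (\<lambda>i. \<eta> 0 i \<omega>) U)
      (PiM V (\<lambda>_. count_space UNIV)) (\<lambda>\<omega>. restrict (\<lambda>i. \<eta> 0 i \<omega>) V)"
    by (rule indep_var_restrict[OF indep_init]) (use assms in auto)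
  from indep_var_compose[OF this meas[OF U] meas[OF V]]
  have "indep_var borel (\<lambda>\<omega>. f (conf 0 \<omega>)) borel (\<lambda>\<omega>. g (conf 0 \<omega>))"
    unfolding comp[OF U(2)] comp[OF V(2)] .
  then show ?thesis
    by (rule indep_var_lebesgue_integral) (rule integrable_local[OF U] integrable_local[OF V])+
qed

definition init :: "(config \<Rightarrow> bool) \<Rightarrow> 'a set" where
  "init P = {\<omega> \<in> space M. P (conf 0 \<omega>)}"

lemma init_sets: "finite D \<Longrightarrow> depends_only_on D (\<lambda>c. of_bool (P c)) \<Longrightarrow> init P \<in> sets M"
proof -
  assume D: "finite D" "depends_only_on D (\<lambda>c. of_bool (P c))"
  have *: "P c = P c'" if "\<And>z. z \<in> D \<Longrightarrow> c z = c' z" for c c'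
    using depends_only_onD[OF D(2), of c c'] that by (simp add: of_bool_eq_iff)
  have "Measurable.pred M (\<lambda>\<omega>. P (conf 0 \<omega>))"
  proof (rule pred_local[OF D(1)])
    show "P c = P c'" if "\<And>z. z \<in> D \<Longrightarrow> c z = c' z" for c c' using that by (rule *)
  qed (rule rv)
  then show ?thesis unfolding init_def by measurable
qed

lemma prob_init_eq: "init P \<in> sets M \<Longrightarrow> prob (init P) = (\<integral>\<omega>. of_bool (P (conf 0 \<omega>)) \<partial>M)"
proof -
  assume "init P \<in> sets M"
  then have "prob (init P) = (\<integral>\<omega>. indicator (init P) \<omega> \<partial>M)" by simp
  also have "\<dots> = (\<integral>\<omega>. of_bool (P (conf 0 \<omega>)) \<partial>M)"
    by (intro Bochner_Integration.integral_cong refl) (auto simp: init_def)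
  finally show ?thesis .
qed

lemma prob_init_conj:
  assumes U: "finite U" "depends_only_on U (\<lambda>c. of_bool (P c))"
    and V: "finite V" "depends_only_on V (\<lambda>c. of_bool (Q c))" and "U \<inter> V = {}"
  shows "prob (init (\<lambda>c. P c \<and> Q c)) = prob (init P) * prob (init Q)"
proof -
  note s = init_sets[OF U] init_sets[OF V]
  have "init (\<lambda>c. P c \<and> Q c) = init P \<inter> init Q" by (auto simp: init_def)
  then have "init (\<lambda>c. P c \<and> Q c) \<in> sets M" using s by auto
  then show ?thesis
    using expectation_mult_local[OF U V assms(5)] s by (simp add: prob_init_eq of_bool_conj)
qed

lemma prob_init_site: "prob (init (\<lambda>c. c x = u)) = init_pmf F \<rho> u"
  using prob_init by (simp add: init_def)

lemma scaled_\<rho>: "16 ^ \<theta> * (2 ^ F * \<rho>) < 1 / 64"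
  using \<rho>_small by (simp add: field_simps)

lemma \<rho>_bound: "2 ^ F * \<rho> < 1 / 64"
proof -
  have "1 * (2 ^ F * \<rho>) \<le> 16 ^ \<theta> * (2 ^ F * \<rho>)"
    using \<rho>_pos by (intro mult_right_mono) auto
  then show ?thesis using le_less_trans[OF _ scaled_\<rho>] by (simp only: mult_1_left)
qed

lemma pow_F: "2 * 2 ^ (F - 1) = (2::real) ^ F"
  using F_large by (cases F) auto

lemma init_pmf_pure: "pure F u \<Longrightarrow> init_pmf F \<rho> u = 1 / 2 - (2 ^ (F - 1) - 1) * \<rho>"
  by (auto simp: init_pmf_def pure_def opinions_def u_minus_def u_plus_def)

lemma pure_mass: 
  assumes "pure F u" 
  shows "1 / 2 - 2 ^ F * \<rho> / 2 \<le> init_pmf F \<rho> u" "1 / 4 \<le> init_pmf F \<rho> u"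
proof -
  have "2 ^ (F - 1) * \<rho> = 2 ^ F * \<rho> / 2" using pow_F by (simp add: field_simps)
  then have eq: "(2 ^ (F - 1) - 1) * \<rho> = 2 ^ F * \<rho> / 2 - \<rho>" by (simp only: left_diff_distrib mult_1_left)
  show "1 / 2 - 2 ^ F * \<rho> / 2 \<le> init_pmf F \<rho> u"
    using \<rho>_pos unfolding init_pmf_pure[OF assms] eq by simp
  then show "1 / 4 \<le> init_pmf F \<rho> u" using \<rho>_bound by linarith
qed

lemma u_neq: "u_minus F \<noteq> u_plus F"
  using F_large by (auto simp: u_minus_def u_plus_def replicate_eq_replicate)

lemma local_site: "depends_only_on {x} (\<lambda>c. of_bool (P (c x)))"
  by (rule depends_only_onI) simp

lemma prob_impure_le: "prob (init (\<lambda>c. \<not> pure F (c x))) \<le> 2 ^ F * \<rho>"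
proof -
  let ?A = "\<lambda>u. init (\<lambda>c. c x = u)"
  have s: "?A u \<in> sets M" for u by (rule init_sets[OF _ local_site]) simp
  have "prob (?A (u_minus F) \<union> ?A (u_plus F)) = prob (?A (u_minus F)) + prob (?A (u_plus F))"
    using s u_neq by (intro finite_measure_Union) (auto simp: init_def)
  then have "prob (?A (u_minus F) \<union> ?A (u_plus F)) \<ge> 1 - 2 ^ F * \<rho>"
    using pure_mass(1)[of "u_minus F"] pure_mass(1)[of "u_plus F"] by (simp add: prob_init_site pure_def)
  moreover have "init (\<lambda>c. \<not> pure F (c x)) = space M - (?A (u_minus F) \<union> ?A (u_plus F))"
    by (auto simp: init_def pure_def)
  ultimately show ?thesis using s by (simp add: prob_compl)
qed

lemma prob_differ_ge:
  assumes "x \<noteq> y"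
  shows "1 / 8 \<le> prob (init (\<lambda>c. pure F (c x) \<and> pure F (c y) \<and> c x \<noteq> c y))"
proof -
  let ?A = "\<lambda>u v. init (\<lambda>c. c x = u \<and> c y = v)"
  have s: "?A u v \<in> sets M" for u v
    by (rule init_sets[of "{x, y}"]) (auto intro: depends_only_onI)
  have p: "1 / 16 \<le> prob (?A u v)" if "pure F u" "pure F v" for u v
  proof -
    have "prob (?A u v) = init_pmf F \<rho> u * init_pmf F \<rho> v"
      using assms by (subst prob_init_conj[OF _ local_site _ local_site]) (auto simp: prob_init_site)
    moreover have "1 / 4 * (1 / 4) \<le> init_pmf F \<rho> u * init_pmf F \<rho> v"
      using pure_mass(2)[OF that(1)] pure_mass(2)[OF that(2)] by (intro mult_mono) auto
    ultimately show ?thesis by simp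
  qed
  have "prob (?A (u_minus F) (u_plus F) \<union> ?A (u_plus F) (u_minus F)) =
      prob (?A (u_minus F) (u_plus F)) + prob (?A (u_plus F) (u_minus F))"
    using s u_neq by (intro finite_measure_Union) (auto simp: init_def)
  moreover have "init (\<lambda>c. pure F (c x) \<and> pure F (c y) \<and> c x \<noteq> c y) =
      ?A (u_minus F) (u_plus F) \<union> ?A (u_plus F) (u_minus F)"
    using u_neq by (auto simp: init_def pure_def)
  ultimately show ?thesis using p[of "u_minus F" "u_plus F"] p[of "u_plus F" "u_minus F"] by (simp add: pure_def)
qed

lemma expectation_score_le:
  assumes "x \<noteq> y"
  shows "(\<integral>\<omega>. 2 powr (- real_of_int (pair_score F \<theta> (\<eta> 0 x \<omega>) (\<eta> 0 y \<omega>))) \<partial>M) \<le> 31 / 32"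
proof -
  define d where "d c = (of_bool (pure F (c x) \<and> pure F (c y) \<and> c x \<noteq> c y) :: real)" for c :: config
  define b where "b z c = (of_bool (\<not> pure F (c z)) :: real)" for z and c :: config
  have d: "depends_only_on {x, y} d" unfolding d_def by (rule depends_only_onI) simp
  have b: "depends_only_on {z} (b z)" for z unfolding b_def by (rule depends_only_onI) simp
  have id: "integrable M (\<lambda>\<omega>. d (conf 0 \<omega>))" by (rule integrable_local[OF _ d]) simp
  have ib: "integrable M (\<lambda>\<omega>. b z (conf 0 \<omega>))" for z by (rule integrable_local[OF _ b]) simp
  have "(\<integral>\<omega>. 2 powr (- real_of_int (pair_score F \<theta> (\<eta> 0 x \<omega>) (\<eta> 0 y \<omega>))) \<partial>M) \<le>
     (\<integral>\<omega>. 1 - 1 / 2 * d (conf 0 \<omega>) + 16 ^ \<theta> * (b x (conf 0 \<omega>) + b y (conf 0 \<omega>)) \<partial>M)"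
  proof (rule integral_mono)
    have "depends_only_on {x, y} (\<lambda>c. 2 powr (- real_of_int (pair_score F \<theta> (c x) (c y))))"
      by (rule depends_only_onI) simp
    then show "integrable M (\<lambda>\<omega>. 2 powr (- real_of_int (pair_score F \<theta> (\<eta> 0 x \<omega>) (\<eta> 0 y \<omega>))))"
      by (rule integrable_local[rotated]) simp
    show "integrable M (\<lambda>\<omega>. 1 - 1 / 2 * d (conf 0 \<omega>) + 16 ^ \<theta> * (b x (conf 0 \<omega>) + b y (conf 0 \<omega>)))"
      using id ib by (intro Bochner_Integration.integrable_add Bochner_Integration.integrable_diff integrable_mult_right) auto
    show "2 powr (- real_of_int (pair_score F \<theta> (\<eta> 0 x \<omega>) (\<eta> 0 y \<omega>))) \<le>
      1 - 1 / 2 * d (conf 0 \<omega>) + 16 ^ \<theta> * (b x (conf 0 \<omega>) + b y (conf 0 \<omega>))" for \<omega>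
      unfolding d_def b_def by (rule powr_score_le)
  qed
  also have "\<dots> = 1 - 1 / 2 * (\<integral>\<omega>. d (conf 0 \<omega>) \<partial>M) + 16 ^ \<theta> * ((\<integral>\<omega>. b x (conf 0 \<omega>) \<partial>M) + (\<integral>\<omega>. b y (conf 0 \<omega>) \<partial>M))"
    using id ib by (simp add: prob_space)
  also have "(\<integral>\<omega>. d (conf 0 \<omega>) \<partial>M) = prob (init (\<lambda>c. pure F (c x) \<and> pure F (c y) \<and> c x \<noteq> c y))"
    unfolding d_def using d[unfolded d_def] by (intro prob_init_eq[symmetric] init_sets[of "{x, y}"]) auto
  also have "(\<integral>\<omega>. b x (conf 0 \<omega>) \<partial>M) = prob (init (\<lambda>c. \<not> pure F (c x)))"
    unfolding b_def using b[unfolded b_def] by (intro prob_init_eq[symmetric] init_sets[of "{x}"]) auto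
  also have "(\<integral>\<omega>. b y (conf 0 \<omega>) \<partial>M) = prob (init (\<lambda>c. \<not> pure F (c y)))"
    unfolding b_def using b[unfolded b_def] by (intro prob_init_eq[symmetric] init_sets[of "{y}"]) auto
  also have "1 - 1 / 2 * prob (init (\<lambda>c. pure F (c x) \<and> pure F (c y) \<and> c x \<noteq> c y)) +
      16 ^ \<theta> * (prob (init (\<lambda>c. \<not> pure F (c x))) + prob (init (\<lambda>c. \<not> pure F (c y)))) \<le>
      1 - 1 / 2 * (1 / 8) + 16 ^ \<theta> * (2 ^ F * \<rho> + 2 ^ F * \<rho>)"
    by (intro add_mono diff_mono mult_left_mono prob_impure_le prob_differ_ge assms) auto
  also have "\<dots> \<le> 31 / 32" unfolding distrib_left using scaled_\<rho> by linarith
  finally show ?thesis .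
qed

text \<open>The pairs occupy disjoint sites, so the exponential moment factorises.\<close>

lemma chernoff_score:
  assumes \<sigma>: "\<sigma> \<in> {1, -1}"
  shows "(\<integral>\<omega>. 2 powr (- real_of_int (\<Sum>l=K..<K + m. score F \<theta> \<sigma> x l (conf 0 \<omega>))) \<partial>M) \<le> (31 / 32) ^ m"
proof (induction m)
  case 0
  then show ?case by (simp add: prob_space)
next
  case (Suc m)
  let ?D = "\<lambda>l. {x + \<sigma> * int (2 * l + 1), x + \<sigma> * int (2 * l + 2)}"
  define U where "U = (\<Union>l\<in>{K..<K + m}. ?D l)"
  define f where "f c = 2 powr (- real_of_int (\<Sum>l=K..<K + m. score F \<theta> \<sigma> x l c))" for c
  define g where "g c = 2 powr (- real_of_int (score F \<theta> \<sigma> x (K + m) c))" for c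
  have f: "depends_only_on U f"
  proof (rule depends_only_onI)
    fix c c' :: config assume eq: "\<And>z. z \<in> U \<Longrightarrow> c z = c' z"
    have "score F \<theta> \<sigma> x l c = score F \<theta> \<sigma> x l c'" if "l \<in> {K..<K + m}" for l
      using that by (intro score_local[OF \<sigma>, of x l U] eq) (auto simp: U_def)
    then show "f c = f c'" unfolding f_def by simp
  qed
  have g: "depends_only_on (?D (K + m)) g"
  proof (rule depends_only_onI)
    fix c c' :: config assume eq: "\<And>z. z \<in> ?D (K + m) \<Longrightarrow> c z = c' z"
    have "score F \<theta> \<sigma> x (K + m) c = score F \<theta> \<sigma> x (K + m) c'"
      by (intro score_local[OF \<sigma>, of x _ "?D (K + m)"] eq) auto
    then show "g c = g c'" unfolding g_def by simp
  qed
  have "(\<integral>\<omega>. 2 powr (- real_of_int (\<Sum>l=K..<K + Suc m. score F \<theta> \<sigma> x l (conf 0 \<omega>))) \<partial>M) =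
      (\<integral>\<omega>. f (conf 0 \<omega>) * g (conf 0 \<omega>) \<partial>M)"
    by (simp add: f_def g_def powr_add[symmetric])
  also have "\<dots> = (\<integral>\<omega>. f (conf 0 \<omega>) \<partial>M) * (\<integral>\<omega>. g (conf 0 \<omega>) \<partial>M)"
    by (rule expectation_mult_local[OF _ f _ g]) (use \<sigma> in \<open>auto simp: U_def\<close>)
  also have "\<dots> \<le> (31 / 32) ^ m * (31 / 32)"
  proof (rule mult_mono)
    show "(\<integral>\<omega>. f (conf 0 \<omega>) \<partial>M) \<le> (31 / 32) ^ m" using Suc unfolding f_def .
    show "(\<integral>\<omega>. g (conf 0 \<omega>) \<partial>M) \<le> 31 / 32"
      unfolding g_def score_def using \<sigma> by (intro expectation_score_le) auto
    show "0 \<le> (\<integral>\<omega>. g (conf 0 \<omega>) \<partial>M)" by (simp add: g_def)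
  qed simp
  finally show ?case by simp
qed

end

subsection \<open>Existence of good sites and coexistence\<close>

text \<open>The Chernoff rate per pair: the moment \<open>31 / 32\<close> times
  \<open>2 powr (1 / 32)\<close>, the price of the slope \<open>1 / 32\<close>. The slope is small
  enough since \<open>(31 / 32) ^ 32 < 1 / 2\<close>.\<close>

definition decay :: real where
  "decay = 31 / 32 * 2 powr (1 / 32)"

lemma decay_pos: "0 < decay"
  by (simp add: decay_def)

lemma decay_less_1: "decay < 1"
proof (rule ccontr)
  assume "\<not> decay < 1"
  then have "1 \<le> decay ^ 32" by (intro one_le_power) simp
  moreover have "(2 powr (1 / 32)) ^ 32 = (2 :: real)"
    by (subst powr_realpow[symmetric]) (simp_all add: powr_powr)
  then have "decay ^ 32 = (31 / 32) ^ 32 * 2" unfolding decay_def power_mult_distrib by (simp only:)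
  moreover have "(31 / 32 :: real) ^ 32 * 2 < 1" by (simp add: power_divide)
  ultimately show False by simp
qed

lemma tail_ok_local:
  assumes \<sigma>: "\<sigma> \<in> {1, -1}" and "m \<le> L"
    and eq: "\<And>z. z \<in> {x - int (2 * (K + L)) .. x + int (2 * (K + L))} - {x - int (2 * K) .. x + int (2 * K)} \<Longrightarrow> c z = c' z"
  shows "tail_ok F \<theta> K \<sigma> x m c = tail_ok F \<theta> K \<sigma> x m c'"
proof -
  let ?D = "{x - int (2 * (K + L)) .. x + int (2 * (K + L))} - {x - int (2 * K) .. x + int (2 * K)}"
  have "score F \<theta> \<sigma> x l c = score F \<theta> \<sigma> x l c'" if "l \<in> {K..<K + m}" for l
    by (rule score_local[OF \<sigma>, of x l ?D]) (use that \<open>m \<le> L\<close> \<sigma> eq in auto)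
  then show ?thesis unfolding tail_ok_def by simp
qed

context deffuant_small
begin

text \<open>Markov's inequality for the exponential moment: the slack in \<open>tail_ok\<close>
  becomes the prefactor, and the slope turns \<open>31 / 32\<close> into
  \<open>decay\<close>.\<close>

lemma prob_not_tail_ok_le:
  assumes \<sigma>: "\<sigma> \<in> {1, -1}"
  shows "prob (init (\<lambda>c. \<not> tail_ok F \<theta> K \<sigma> x m c)) \<le> 2 powr (- (real K - 1) / 2) * decay ^ m"
proof -
  define h where "h c = 2 powr (- real_of_int (\<Sum>l=K..<K + m. score F \<theta> \<sigma> x l c))" for c
  define t where "t = 2 powr ((real K - 1) / 2 - real m / 32)"
  let ?D = "{x - int (2 * (K + m)) .. x + int (2 * (K + m))}"
  have h: "depends_only_on ?D h"
  proof (rule depends_only_onI)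
    fix c c' :: config assume eq: "\<And>z. z \<in> ?D \<Longrightarrow> c z = c' z"
    have "score F \<theta> \<sigma> x l c = score F \<theta> \<sigma> x l c'" if "l \<in> {K..<K + m}" for l
      by (rule score_local[OF \<sigma>, of x l ?D]) (use that \<sigma> eq in auto)
    then show "h c = h c'" unfolding h_def by simp
  qed
  have int: "integrable M (\<lambda>\<omega>. h (conf 0 \<omega>))" by (rule integrable_local[OF _ h]) simp
  have [measurable]: "(\<lambda>\<omega>. h (conf 0 \<omega>)) \<in> borel_measurable M" using int by auto
  have "t \<le> h c" if "\<not> tail_ok F \<theta> K \<sigma> x m c" for c
  proof -
    define S where "S = (\<Sum>l=K..<K + m. score F \<theta> \<sigma> x l c)"
    have "32 * S < int m - 16 * (int K - 1)" using that by (simp add: tail_ok_def S_def)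
    then have "real_of_int (32 * S) < real_of_int (int m - 16 * (int K - 1))" by (simp only: of_int_less_iff)
    then have "(real K - 1) / 2 - real m / 32 \<le> - real_of_int S" by (simp add: field_simps)
    then show ?thesis unfolding t_def h_def S_def[symmetric] by (intro powr_mono) auto
  qed
  then have "init (\<lambda>c. \<not> tail_ok F \<theta> K \<sigma> x m c) \<subseteq> {\<omega> \<in> space M. t \<le> h (conf 0 \<omega>)}"
    by (auto simp: init_def)
  then have "prob (init (\<lambda>c. \<not> tail_ok F \<theta> K \<sigma> x m c)) \<le> prob {\<omega> \<in> space M. t \<le> h (conf 0 \<omega>)}"
    by (rule finite_measure_mono) measurable
  also have "\<dots> \<le> (\<integral>\<omega>. h (conf 0 \<omega>) \<partial>M) / t"
    by (rule integral_Markov_inequality_measure[OF int, where A = "space M"]) (auto simp: h_def t_def)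
  also have "\<dots> \<le> (31 / 32) ^ m / t"
    unfolding h_def by (intro divide_right_mono chernoff_score[OF \<sigma>]) (simp add: t_def)
  also have "\<dots> = 2 powr (- (real K - 1) / 2) * decay ^ m"
  proof -
    have "inverse t = 2 powr (- (real K - 1) / 2 + real m / 32)"
      unfolding t_def powr_minus[symmetric] by (rule arg_cong[where f = "(powr) 2"]) (simp add: field_simps)
    also have "\<dots> = 2 powr (- (real K - 1) / 2) * 2 powr (real m / 32)" by (rule powr_add)
    also have "2 powr (real m / 32) = (2 powr (1 / 32)) ^ m"
      by (subst powr_realpow[symmetric]) (simp_all add: powr_powr)
    finally have inv: "inverse t = 2 powr (- (real K - 1) / 2) * (2 powr (1 / 32)) ^ m" .
    have "(31 / 32) ^ m / t = (31 / 32) ^ m * inverse t" by (rule divide_inverse)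
    also have "\<dots> = 2 powr (- (real K - 1) / 2) * decay ^ m"
      unfolding inv decay_def power_mult_distrib by (rule mult.left_commute)
    finally show ?thesis .
  qed
  finally show ?thesis .
qed

lemma tail_ok_measurable [measurable]: "\<sigma> \<in> {1, -1} \<Longrightarrow> Measurable.pred M (\<lambda>\<omega>. tail_ok F \<theta> K \<sigma> x m (conf 0 \<omega>))"
proof -
  assume \<sigma>: "\<sigma> \<in> {1, -1}"
  let ?D = "{x - int (2 * (K + m)) .. x + int (2 * (K + m))} - {x - int (2 * K) .. x + int (2 * K)}"
  show ?thesis
  proof (rule pred_local[of ?D])
    show "tail_ok F \<theta> K \<sigma> x m c = tail_ok F \<theta> K \<sigma> x m c'" if "\<And>z. z \<in> ?D \<Longrightarrow> c z = c' z" for c c'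
      by (rule tail_ok_local[OF \<sigma> order_refl that])
  qed simp_all
qed

text \<open>A geometric sum over the failing lengths. It serves twice: with \<open>L = 0\<close> it
  makes the whole tail likely once \<open>K\<close> is large, with \<open>L\<close> large it makes
  the remote part negligible.\<close>

lemma prob_far_fail_le:
  assumes \<sigma>: "\<sigma> \<in> {1, -1}"
  shows "prob (init (\<lambda>c. \<exists>m\<ge>L. \<not> tail_ok F \<theta> K \<sigma> x m c)) \<le> 2 powr (- (real K - 1) / 2) * decay ^ L / (1 - decay)"
proof -
  let ?A = "\<lambda>j. init (\<lambda>c. \<not> tail_ok F \<theta> K \<sigma> x (L + j) c)" and ?b = "2 powr (- (real K - 1) / 2) * decay ^ L"
  have A: "?A j \<in> sets M" for j using tail_ok_measurable[OF \<sigma>] unfolding init_def by measurable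
  have le: "prob (?A j) \<le> ?b * decay ^ j" for j
    using prob_not_tail_ok_le[OF \<sigma>, of K x "L + j"] by (simp add: power_add mult_ac)
  have geo: "summable (\<lambda>j. ?b * decay ^ j)"
    using decay_pos decay_less_1 by (intro summable_mult summable_geometric) auto
  have sm: "summable (\<lambda>j. prob (?A j))"
    by (rule summable_comparison_test'[OF geo]) (use le in auto)
  have "init (\<lambda>c. \<exists>m\<ge>L. \<not> tail_ok F \<theta> K \<sigma> x m c) = (\<Union>j. ?A j)"
    unfolding init_def by (auto simp: le_iff_add)
  then have "prob (init (\<lambda>c. \<exists>m\<ge>L. \<not> tail_ok F \<theta> K \<sigma> x m c)) \<le> (\<Sum>j. prob (?A j))"
    using finite_measure_subadditive_countably[of ?A] A sm by auto
  also have "\<dots> \<le> (\<Sum>j. ?b * decay ^ j)" by (rule suminf_le[OF le sm geo])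
  also have "\<dots> = ?b * (1 / (1 - decay))"
    using decay_pos decay_less_1 by (subst suminf_mult) (auto simp: suminf_geometric intro!: summable_geometric)
  finally show ?thesis by simp
qed

text \<open>The bound depends on the number of sites and not on their location, so blocks along the
  line succeed with a uniform probability. The minimum covers impure opinions, with mass \<rho>, and
  pure ones, with mass at least \<open>1 / 4\<close>.\<close>

lemma prob_pattern_ge:
  assumes "finite E" "\<And>z. z \<in> E \<Longrightarrow> a z \<in> opinions F"
  shows "min \<rho> (1 / 4) ^ card E \<le> prob (init (\<lambda>c. \<forall>z\<in>E. c z = a z))"
  using assms
proof (induction E rule: finite_induct)
  case empty
  then show ?case by (simp add: init_def prob_space)
next
  case (insert y E)
  have "prob (init (\<lambda>c. c y = a y \<and> (\<forall>z\<in>E. c z = a z))) = prob (init (\<lambda>c. c y = a y)) * prob (init (\<lambda>c. \<forall>z\<in>E. c z = a z))"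
    by (rule prob_init_conj[OF _ local_site insert(1)]) (use insert(2) in \<open>auto intro: depends_only_onI\<close>)
  moreover have "min \<rho> (1 / 4) * min \<rho> (1 / 4) ^ card E \<le> prob (init (\<lambda>c. c y = a y)) * prob (init (\<lambda>c. \<forall>z\<in>E. c z = a z))"
  proof (rule mult_mono)
    have "a y \<in> opinions F" using insert by auto
    then have "min \<rho> (1 / 4) \<le> init_pmf F \<rho> (a y)"
      using pure_mass(2)[of "a y"] by (cases "pure F (a y)") (auto simp: init_pmf_def pure_def)
    then show "min \<rho> (1 / 4) \<le> prob (init (\<lambda>c. c y = a y))" by (simp add: prob_init_site)
    show "min \<rho> (1 / 4) ^ card E \<le> prob (init (\<lambda>c. \<forall>z\<in>E. c z = a z))" using insert by auto
  qed (use \<rho>_pos in auto)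
  ultimately show ?case using insert by simp
qed

text \<open>A good site must resist disturbances from infinitely far away. Local versions of this event
  in disjoint blocks are independent, and a union bound controls the remote part; letting first the block
  length and then the number of blocks tend to infinity replaces the ergodic theorem.\<close>
lemma good_exists:
  assumes u: "u \<in> opinions F" and \<tau>: "\<tau> \<in> {1, -1}"
  shows "AE \<omega> in M. \<exists>x. N \<le> \<tau> * x \<and> \<eta> 0 x \<omega> = u \<and> good \<theta> x (conf 0 \<omega>)"
proof -
  obtain v v' where v: "pure F v" "pure F v'" "v \<noteq> v'" "\<theta> < hamming u v"
    using far_pure_opinion[OF F_large u] .
  have v_op: "v \<in> opinions F" "v' \<in> opinions F"
    using v by (auto simp: pure_def opinions_def u_minus_def u_plus_def)
  \<comment> \<open>\<open>K\<close> is taken so large that the two tails fail with total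
    probability at most \<open>1 / 2\<close>, whence the bound
    \<open>(1 - decay) / 4\<close>.\<close>
  have "(\<lambda>k. (2 powr (-1/2)) ^ k) \<longlonglongrightarrow> (0 :: real)"
  proof (rule LIMSEQ_realpow_zero)
    have "2 powr (-1/2) < 2 powr (0 :: real)" by (rule powr_less_mono) auto
    then show "2 powr (-1/2) < (1 :: real)" by simp
  qed simp
  moreover have "0 < (1 - decay) / 4" using decay_less_1 by simp
  ultimately have "\<forall>\<^sub>F k in sequentially. (2 powr (-1/2)) ^ k < (1 - decay) / 4" by (rule order_tendstoD(2))
  then obtain k where k: "(2 powr (-1/2)) ^ k < (1 - decay) / 4" by (auto simp: eventually_sequentially)
  define K where "K = Suc k"
  define \<beta> where "\<beta> = 2 powr (- (real K - 1) / 2)"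
  have "(2 powr (-1/2)) ^ k = \<beta>"
    unfolding \<beta>_def K_def by (subst powr_realpow[symmetric]) (simp_all add: powr_powr)
  then have \<beta>: "2 * (\<beta> / (1 - decay)) \<le> 1 / 2" using k decay_less_1 by (simp add: field_simps)
  define C where "C x = {x - int (2 * K) .. x + int (2 * K)}" for x
  define B where "B L x = {x - int (2 * (K + L)) .. x + int (2 * (K + L))}" for L x
  \<comment> \<open>The neighbours of \<open>x\<close> hold \<open>v\<close>, which differs from
    \<open>u\<close> on more than \<theta> issues; from there \<open>v\<close> and \<open>v'\<close>
    alternate, so that every pair of the core scores one.\<close>
  define pat where "pat x z = (if z = x then u else if odd (z - x) then v else v')" for x z :: int
  define core where "core x c \<longleftrightarrow> (\<forall>z\<in>C x. c z = pat x z)" for x and c :: config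
  define tails where "tails L x c \<longleftrightarrow> (\<forall>m\<le>L. tail_ok F \<theta> K 1 x m c \<and> tail_ok F \<theta> K (-1) x m c)" for L x c
  define far where "far L x c \<longleftrightarrow> (\<exists>m\<ge>L. \<not> tail_ok F \<theta> K 1 x m c) \<or> (\<exists>m\<ge>L. \<not> tail_ok F \<theta> K (-1) x m c)" for L x c
  \<comment> \<open>The core has \<open>4 * K + 1\<close> prescribed sites, and \<open>1 / 2\<close>
    is the least chance of good tails. \<open>q\<close> depends neither on the block length
    \<open>L\<close> nor on the position.\<close>
  define q where "q = min \<rho> (1 / 4) ^ (4 * K + 1) / 2"
  have far_le: "prob (init (far L x)) \<le> 2 * (\<beta> / (1 - decay)) * decay ^ L" for L x
  proof -
    let ?A = "\<lambda>\<sigma>. init (\<lambda>c. \<exists>m\<ge>L. \<not> tail_ok F \<theta> K \<sigma> x m c)"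
    have [measurable]: "?A 1 \<in> sets M" "?A (-1) \<in> sets M" unfolding init_def by measurable
    have "init (far L x) = ?A 1 \<union> ?A (-1)" by (auto simp: init_def far_def)
    then have "prob (init (far L x)) \<le> prob (?A 1) + prob (?A (-1))"
      by (simp only:) (rule measure_Un_le; measurable)
    then show ?thesis
      using prob_far_fail_le[of 1 L K x] prob_far_fail_le[of "-1" L K x] by (simp add: \<beta>_def)
  qed
  have far_sets [measurable]: "init (far L x) \<in> sets M" for L x unfolding far_def init_def by measurable
  have core_local: "depends_only_on (C x) (\<lambda>c. of_bool (core x c))" for x
    unfolding core_def by (rule depends_only_onI) simp
  have tails_cong: "tails L x c = tails L x c'" if "\<And>z. z \<in> B L x - C x \<Longrightarrow> c z = c' z" for L x c c'
    unfolding tails_def using tail_ok_local[of _ _ L x K c c'] that unfolding B_def C_def by auto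
  have tails_local: "depends_only_on (B L x - C x) (\<lambda>c. of_bool (tails L x c))" for L x
  proof (rule depends_only_onI)
    fix c c' :: config assume "\<And>z. z \<in> B L x - C x \<Longrightarrow> c z = c' z"
    then have "tails L x c = tails L x c'" by (rule tails_cong)
    then show "of_bool (tails L x c) = (of_bool (tails L x c') :: real)" by simp
  qed
  have finB: "finite (B L x)" "finite (C x)" "finite (B L x - C x)" for L x by (simp_all add: B_def C_def)
  have CB: "C x \<subseteq> B L x" for L x by (auto simp: B_def C_def)
  define blk where "blk L x c \<longleftrightarrow> core x c \<and> tails L x c" for L x c
  have blk_local: "depends_only_on (B L x) (\<lambda>c. of_bool (blk L x c))" for L x
  proof (rule depends_only_onI)
    fix c c' :: config assume eq: "\<And>z. z \<in> B L x \<Longrightarrow> c z = c' z"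
    have "c z = c' z" if "z \<in> C x" for z using that CB by (intro eq) blast
    then have "core x c = core x c'" unfolding core_def by simp
    moreover have "tails L x c = tails L x c'" using eq by (intro tails_cong) auto
    ultimately show "of_bool (blk L x c) = (of_bool (blk L x c') :: real)" by (simp add: blk_def)
  qed
  have blk_ge: "q \<le> prob (init (blk L x))" for L x
  proof -
    have "prob (init (blk L x)) = prob (init (core x)) * prob (init (tails L x))"
      unfolding blk_def[abs_def] using prob_init_conj[OF finB(2) core_local finB(3) tails_local] by auto
    moreover have "min \<rho> (1 / 4) ^ (4 * K + 1) \<le> prob (init (core x))"
    proof -
      have "card (C x) = 4 * K + 1" by (simp add: C_def)
      then show ?thesis unfolding core_def[abs_def]
        using prob_pattern_ge[OF finB(2), of x "pat x"] u v_op by (simp add: pat_def)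
    qed
    moreover have "1 / 2 \<le> prob (init (tails L x))"
    proof -
      have "init (tails L x) \<in> sets M" by (rule init_sets[OF finB(3) tails_local])
      moreover have "space M - init (tails L x) \<subseteq> init (far 0 x)"
        by (auto simp: init_def tails_def far_def)
      then have "prob (space M - init (tails L x)) \<le> prob (init (far 0 x))"
        by (rule finite_measure_mono) measurable
      ultimately show ?thesis using far_le[of 0 x] \<beta> by (simp add: prob_compl)
    qed
    ultimately show ?thesis unfolding q_def
      using mult_mono[of "min \<rho> (1 / 4) ^ (4 * K + 1)" "prob (init (core x))" "1 / 2" "prob (init (tails L x))"]
      by simp
  qed
  \<comment> \<open>\<open>W L\<close> is the number of sites of a block, so blocks around centres
    at this spacing are disjoint. The sign \<tau> sends them to the right or to the left.\<close>
  define W where "W L = int (4 * (K + L) + 1)" for L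
  define ctr where "ctr L i = \<tau> * (N + int i * W L)" for L and i :: nat
  have ctr_ge: "N \<le> \<tau> * ctr L i" for L i
    using \<tau> by (auto simp: ctr_def W_def)
  have disj: "B L (ctr L i) \<inter> B L (ctr L n) = {}" if "i < n" for L i n
  proof (rule ccontr)
    assume "B L (ctr L i) \<inter> B L (ctr L n) \<noteq> {}"
    then obtain z where z: "z \<in> B L (ctr L i)" "z \<in> B L (ctr L n)" by blast
    then have "\<bar>ctr L n - ctr L i\<bar> < W L" unfolding B_def W_def by auto
    moreover have "ctr L n - ctr L i = \<tau> * (int (n - i) * W L)"
      using that by (simp add: ctr_def algebra_simps of_nat_diff)
    then have "\<bar>ctr L n - ctr L i\<bar> = int (n - i) * W L"
      using \<tau> that by (auto simp: W_def abs_mult)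
    moreover have "1 * W L \<le> int (n - i) * W L"
      using that by (intro mult_right_mono) (auto simp: W_def)
    ultimately show False by simp
  qed
  have q: "0 < q" "q \<le> 1"
  proof -
    show "0 < q" using \<rho>_pos by (simp add: q_def)
    show "q \<le> 1" using blk_ge[of 0 0] prob_le_1[of "init (blk 0 0)"] by linarith
  qed
  define none where "none L n c \<longleftrightarrow> (\<forall>i<n. \<not> blk L (ctr L i) c)" for L n c
  have none_local: "depends_only_on (\<Union>i<n. B L (ctr L i)) (\<lambda>c. of_bool (none L n c))" for L n
  proof (rule depends_only_onI)
    fix c c' :: config assume eq: "\<And>z. z \<in> (\<Union>i<n. B L (ctr L i)) \<Longrightarrow> c z = c' z"
    have "blk L (ctr L i) c = blk L (ctr L i) c'" if "i < n" for i
      using depends_only_onD[OF blk_local[of L "ctr L i"], of c c'] eq that by (auto simp: of_bool_eq_iff)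
    then show "of_bool (none L n c) = (of_bool (none L n c') :: real)" by (simp add: none_def)
  qed
  have none_le: "prob (init (none L n)) \<le> (1 - q) ^ n" for L n
  proof (induction n)
    case 0
    then show ?case by simp
  next
    case (Suc n)
    have not_blk: "depends_only_on (B L (ctr L n)) (\<lambda>c. of_bool (\<not> blk L (ctr L n) c))"
    proof (rule depends_only_onI)
      fix c c' :: config assume eq: "\<And>z. z \<in> B L (ctr L n) \<Longrightarrow> c z = c' z"
      show "of_bool (\<not> blk L (ctr L n) c) = (of_bool (\<not> blk L (ctr L n) c') :: real)"
        using depends_only_onD[OF blk_local[of L "ctr L n"], of c c'] eq by (simp add: of_bool_eq_iff)
    qed
    have "init (none L (Suc n)) = init (\<lambda>c. none L n c \<and> \<not> blk L (ctr L n) c)"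
      by (auto simp: init_def none_def less_Suc_eq)
    moreover have "prob (init (\<lambda>c. none L n c \<and> \<not> blk L (ctr L n) c)) =
        prob (init (none L n)) * prob (init (\<lambda>c. \<not> blk L (ctr L n) c))"
    proof (rule prob_init_conj[OF _ none_local finB(1) not_blk])
      show "finite (\<Union>i<n. B L (ctr L i))" using finB(1) by blast
      show "(\<Union>i<n. B L (ctr L i)) \<inter> B L (ctr L n) = {}" using disj[of _ n L] by blast
    qed
    ultimately have "prob (init (none L (Suc n))) = prob (init (none L n)) * prob (init (\<lambda>c. \<not> blk L (ctr L n) c))"
      by (simp only:)
    also have "\<dots> \<le> (1 - q) ^ n * (1 - q)"
    proof (rule mult_mono)
      have "init (\<lambda>c. \<not> blk L (ctr L n) c) = space M - init (blk L (ctr L n))" by (auto simp: init_def)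
      moreover have "init (blk L (ctr L n)) \<in> sets M" by (rule init_sets[OF finB(1) blk_local])
      ultimately show "prob (init (\<lambda>c. \<not> blk L (ctr L n) c)) \<le> 1 - q"
        using blk_ge[of L "ctr L n"] by (simp add: prob_compl)
    qed (use Suc q in auto)
    finally show ?case by (simp add: mult.commute)
  qed
  have good: "good \<theta> x c" "c x = u" if "blk L x c" "\<not> far L x c" for L x c
  proof -
    have cz: "c z = pat x z" if "z \<in> C x" for z using \<open>blk L x c\<close> that by (simp add: blk_def core_def)
    then show "c x = u" by (simp add: C_def pat_def)
    have "good_side \<theta> \<sigma> x c" if \<sigma>: "\<sigma> \<in> {1, -1}" for \<sigma>
    proof (rule good_side_if_tail_ok[OF F_large, where K = K])
      have "c (x + \<sigma>) = v" using \<sigma> by (subst cz) (auto simp: C_def pat_def K_def)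
      then show "\<theta> < hamming (c x) (c (x + \<sigma>))" using \<open>c x = u\<close> v(4) by simp
      show "score F \<theta> \<sigma> x l c = 1" if "l < K" for l
        by (rule score_pattern[OF v(1,2,3) \<sigma> that, of x c u]) (use cz in \<open>simp add: C_def pat_def\<close>)
      show "tail_ok F \<theta> K \<sigma> x m c" for m
      proof (cases "m \<le> L")
        case True
        then show ?thesis using \<open>blk L x c\<close> \<sigma> by (auto simp: blk_def tails_def)
      next
        case False
        then have "L \<le> m" by simp
        then show ?thesis using \<open>\<not> far L x c\<close> \<sigma> by (auto simp: far_def)
      qed
    qed (simp add: K_def)
    then show "good \<theta> x c" by (simp add: good_def)
  qed
  define Bad where "Bad = init (\<lambda>c. \<forall>x. N \<le> \<tau> * x \<longrightarrow> \<not> (c x = u \<and> good \<theta> x c))"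
  have [measurable]: "Measurable.pred M (\<lambda>\<omega>. good \<theta> x (conf 0 \<omega>))" for x
    by (rule good_measurable) measurable
  have Bad [measurable]: "Bad \<in> sets M" unfolding Bad_def init_def by measurable
  have bound: "prob Bad \<le> (1 - q) ^ n + real n * (2 * (\<beta> / (1 - decay))) * decay ^ L" for n L
  proof -
    have "Bad \<subseteq> init (none L n) \<union> (\<Union>i<n. init (far L (ctr L i)))"
    proof
      fix \<omega> assume \<omega>: "\<omega> \<in> Bad"
      then have "\<not> blk L (ctr L i) (conf 0 \<omega>) \<or> far L (ctr L i) (conf 0 \<omega>)" for i
        using good[of L "ctr L i" "conf 0 \<omega>"] ctr_ge[of L i] unfolding Bad_def init_def by blast
      then show "\<omega> \<in> init (none L n) \<union> (\<Union>i<n. init (far L (ctr L i)))"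
        using \<omega> unfolding Bad_def init_def none_def by blast
    qed
    moreover have none_sets: "init (none L n) \<in> sets M"
      by (rule init_sets[OF _ none_local]) (simp add: finB)
    ultimately have "prob Bad \<le> prob (init (none L n) \<union> (\<Union>i<n. init (far L (ctr L i))))"
      by (intro finite_measure_mono) auto
    also have "\<dots> \<le> prob (init (none L n)) + prob (\<Union>i<n. init (far L (ctr L i)))"
      using none_sets by (intro measure_Un_le) auto
    also have "\<dots> \<le> (1 - q) ^ n + (\<Sum>i<n. prob (init (far L (ctr L i))))"
      by (intro add_mono none_le measure_UNION_le) auto
    also have "\<dots> \<le> (1 - q) ^ n + (\<Sum>i<n. 2 * (\<beta> / (1 - decay)) * decay ^ L)"
      by (intro add_left_mono sum_mono far_le)
    finally show ?thesis by simp
  qed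
  have bound': "prob Bad \<le> (1 - q) ^ n" for n
  proof (rule LIMSEQ_le_const)
    have "(\<lambda>L. decay ^ L) \<longlonglongrightarrow> 0"
      using decay_pos decay_less_1 by (intro LIMSEQ_realpow_zero) auto
    then have "(\<lambda>L. (1 - q) ^ n + real n * (2 * (\<beta> / (1 - decay))) * decay ^ L) \<longlonglongrightarrow>
        (1 - q) ^ n + real n * (2 * (\<beta> / (1 - decay))) * 0"
      by (intro tendsto_add tendsto_const tendsto_mult_left)
    then show "(\<lambda>L. (1 - q) ^ n + real n * (2 * (\<beta> / (1 - decay))) * decay ^ L) \<longlonglongrightarrow> (1 - q) ^ n" by simp
  qed (use bound in blast)
  have "prob Bad \<le> 0"
  proof (rule LIMSEQ_le_const)
    show "(\<lambda>n. (1 - q) ^ n) \<longlonglongrightarrow> 0" using q by (intro LIMSEQ_realpow_zero) auto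
  qed (use bound' in blast)
  then have "prob Bad = 0" using measure_nonneg[of M Bad] by linarith
  then have "AE \<omega> in M. \<omega> \<notin> Bad" using prob_eq_0[OF Bad] by simp
  with AE_space show ?thesis
    by eventually_elim (auto simp: Bad_def init_def)
qed

section \<open>The limiting configuration\<close>

definition limit_opinion :: "int \<Rightarrow> 'a \<Rightarrow> opinion" where
  "limit_opinion x \<omega> = \<eta> (real (LEAST N. \<forall>n\<ge>N. \<eta> (real n) x \<omega> = \<eta> (real N) x \<omega>)) x \<omega>"

lemma limit_opinion_measurable: "limit_opinion x \<in> measurable M (count_space UNIV)"
proof -
  have "(\<lambda>\<omega>. LEAST N. \<forall>n\<ge>N. \<eta> (real n) x \<omega> = \<eta> (real N) x \<omega>) \<in> measurable M (count_space UNIV)"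
    by measurable
  then have "(\<lambda>\<omega>. \<eta> (real (LEAST N. \<forall>n\<ge>N. \<eta> (real n) x \<omega> = \<eta> (real N) x \<omega>)) x \<omega>) \<in> measurable M (count_space UNIV)"
    by (rule measurable_compose_countable[rotated]) measurable
  then show ?thesis by (simp add: limit_opinion_def[abs_def])
qed

lemma limit_opinion_eq:
  assumes "\<forall>t\<ge>real N. \<eta> t x \<omega> = \<eta> (real N) x \<omega>"
  shows "\<forall>t\<ge>real N. \<eta> t x \<omega> = limit_opinion x \<omega>"
proof -
  define P where "P N \<longleftrightarrow> (\<forall>n\<ge>N. \<eta> (real n) x \<omega> = \<eta> (real N) x \<omega>)" for N :: nat
  have N: "\<eta> t x \<omega> = \<eta> (real N) x \<omega>" if "real N \<le> t" for t using assms that by blast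
  have "P N" unfolding P_def by (intro allI impI N) simp
  then have "P (Least P)" by (rule LeastI)
  have P_D: "\<eta> (real n) x \<omega> = \<eta> (real N) x \<omega>" if "P N" "N \<le> n" for N n
    using that unfolding P_def by blast
  have "\<eta> (real (max N (Least P))) x \<omega> = \<eta> (real (Least P)) x \<omega>"
    by (rule P_D[OF \<open>P (Least P)\<close>]) simp
  moreover have "\<eta> (real (max N (Least P))) x \<omega> = \<eta> (real N) x \<omega>" by (rule N) simp
  moreover have "limit_opinion x \<omega> = \<eta> (real (Least P)) x \<omega>"
    unfolding limit_opinion_def P_def[abs_def] by (rule refl)
  ultimately have lim: "limit_opinion x \<omega> = \<eta> (real N) x \<omega>" by (simp only:)
  show ?thesis unfolding lim by (rule assms)
qed

text \<open>Good sites exist on both sides of \<open>x\<close>, but at random positions; fixation is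
  therefore intersected over the countably many pairs \<open>y\<close>, \<open>z\<close>. On the
  left \<open>\<tau> = -1\<close>, and \<open>1 - x \<le> -1 * y\<close> says
  \<open>y < x\<close>.\<close>

lemma fixation: "AE \<omega> in M. \<exists>T. \<forall>t\<ge>T. \<eta> t x \<omega> = limit_opinion x \<omega>"
proof -
  have u: "u_minus F \<in> opinions F" by (simp add: opinions_def u_minus_def)
  have "AE \<omega> in M. \<forall>y z. y < x \<longrightarrow> x < z \<longrightarrow> \<omega> \<in> good_between y z \<longrightarrow>
      (\<exists>N::nat. \<forall>t\<ge>real N. \<eta> t x \<omega> = \<eta> (real N) x \<omega>)"
    unfolding AE_all_countable by (intro allI AE_impI fixation_between)
  moreover have "AE \<omega> in M. \<exists>y. 1 - x \<le> -1 * y \<and> \<eta> 0 y \<omega> = u_minus F \<and> good \<theta> y (conf 0 \<omega>)"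
    by (rule good_exists[OF u]) simp
  moreover have "AE \<omega> in M. \<exists>z. x + 1 \<le> 1 * z \<and> \<eta> 0 z \<omega> = u_minus F \<and> good \<theta> z (conf 0 \<omega>)"
    by (rule good_exists[OF u]) simp
  ultimately show ?thesis using AE_space
  proof eventually_elim
    case (elim \<omega>)
    from elim(2) obtain y where "1 - x \<le> -1 * y" and y: "good \<theta> y (conf 0 \<omega>)" by blast
    then have "y < x" by simp
    from elim(3) obtain z where "x + 1 \<le> 1 * z" and z: "good \<theta> z (conf 0 \<omega>)" by blast
    then have "x < z" by simp
    have "\<omega> \<in> good_between y z" using elim(4) y z by (simp add: good_between_def)
    then obtain N :: nat where "\<forall>t\<ge>real N. \<eta> t x \<omega> = \<eta> (real N) x \<omega>"
      using elim(1) \<open>y < x\<close> \<open>x < z\<close> by blast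
    then show ?case using limit_opinion_eq by blast
  qed
qed

text \<open>A good site has its initial opinion at all integer times, the only times that
  \<open>limit_opinion\<close> reads, and every opinion occurs at some good site.\<close>

lemma all_opinions_survive: "AE \<omega> in M. card (range (\<lambda>x. limit_opinion x \<omega>)) = 2 ^ F"
proof -
  have "AE \<omega> in M. \<forall>u\<in>opinions F. \<exists>x. \<eta> 0 x \<omega> = u \<and> good \<theta> x (conf 0 \<omega>)"
  proof (rule AE_finite_allI[OF finite_opinions])
    fix u assume "u \<in> opinions F"
    then have "AE \<omega> in M. \<exists>x. 0 \<le> 1 * x \<and> \<eta> 0 x \<omega> = u \<and> good \<theta> x (conf 0 \<omega>)"
      by (rule good_exists) simp
    then show "AE \<omega> in M. \<exists>x. \<eta> 0 x \<omega> = u \<and> good \<theta> x (conf 0 \<omega>)"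
      by (auto elim!: eventually_mono)
  qed
  moreover have "AE \<omega> in M. \<forall>x. \<forall>n::nat. good \<theta> x (conf 0 \<omega>) \<longrightarrow> \<eta> (real n) x \<omega> = \<eta> 0 x \<omega>"
    unfolding AE_all_countable
  proof (intro allI)
    fix x and n :: nat
    show "AE \<omega> in M. good \<theta> x (conf 0 \<omega>) \<longrightarrow> \<eta> (real n) x \<omega> = \<eta> 0 x \<omega>"
      using freeze[of "real n" x] by (auto elim!: eventually_mono)
  qed
  ultimately show ?thesis using AE_space
  proof eventually_elim
    case (elim \<omega>)
    have "range (\<lambda>x. limit_opinion x \<omega>) = opinions F"
    proof
      \<comment> \<open>Should no stabilising time exist, \<open>LEAST\<close> still denotes some
        integer time, and the value of the process there is an opinion.\<close>
      show "range (\<lambda>x. limit_opinion x \<omega>) \<subseteq> opinions F"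
        using elim(3) by (auto simp: limit_opinion_def opinions_def)
      show "opinions F \<subseteq> range (\<lambda>x. limit_opinion x \<omega>)"
      proof
        fix u assume "u \<in> opinions F"
        then obtain x where x: "\<eta> 0 x \<omega> = u" "good \<theta> x (conf 0 \<omega>)" using elim(1) by blast
        then have "limit_opinion x \<omega> = u" using elim(2) unfolding limit_opinion_def by blast
        then show "u \<in> range (\<lambda>x. limit_opinion x \<omega>)" by blast
      qed
    qed
    then show ?case by (simp add: card_opinions)
  qed
qed

end

theorem theorem3:
  fixes F \<theta> :: nat
  assumes "\<theta> \<ge> 1" and "F > 2 * \<theta>"
  shows "\<exists>\<rho>0>0. \<forall>\<rho>. 0 < \<rho> \<and> \<rho> < \<rho>0 \<and> \<rho> < 1 / 2 ^ F \<longrightarrow>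
     (\<forall>(M :: 'a measure) \<eta>. deffuant_process F \<theta> \<rho> M \<eta> \<longrightarrow>
       (\<exists>\<eta>inf :: int \<Rightarrow> 'a \<Rightarrow> opinion.
          (\<forall>x. \<eta>inf x \<in> measurable M (count_space UNIV)) \<and>
          (\<forall>x. AE \<omega> in M. \<exists>T. \<forall>t\<ge>T. \<eta> t x \<omega> = \<eta>inf x \<omega>) \<and>
          (AE \<omega> in M. card (range (\<lambda>x. \<eta>inf x \<omega>)) = 2 ^ F)))"
proof (rule exI[of _ "1 / (64 * 16 ^ \<theta> * 2 ^ F)"], intro conjI allI impI)
  show "(0::real) < 1 / (64 * 16 ^ \<theta> * 2 ^ F)" by simp
  fix \<rho> and M :: "'a measure" and \<eta>
  assume \<rho>: "0 < \<rho> \<and> \<rho> < 1 / (64 * 16 ^ \<theta> * 2 ^ F) \<and> \<rho> < 1 / 2 ^ F"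
    and proc: "deffuant_process F \<theta> \<rho> M \<eta>"
  interpret prob_space M using proc unfolding deffuant_process_def by (rule conjunct1)
  interpret deffuant_small M F \<theta> \<rho> \<eta>
    by unfold_locales (use proc \<rho> assms in auto)
  show "\<exists>\<eta>inf :: int \<Rightarrow> 'a \<Rightarrow> opinion.
          (\<forall>x. \<eta>inf x \<in> measurable M (count_space UNIV)) \<and>
          (\<forall>x. AE \<omega> in M. \<exists>T. \<forall>t\<ge>T. \<eta> t x \<omega> = \<eta>inf x \<omega>) \<and>
          (AE \<omega> in M. card (range (\<lambda>x. \<eta>inf x \<omega>)) = 2 ^ F)"
    using limit_opinion_measurable fixation all_opinions_survive by blast
qed

end
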